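(* Let $\mathsf f$ be an a.s. uniformly bounded additive functional on a uniformly elliptic Markov chain $\mathsf X$. Then: (a) if $H(\mathsf X,\mathsf f)=\{0\}$, then $G_{ess}(\mathsf X,\mathsf f)=\mathbb R$; (b) if $H(\mathsf X,\mathsf f)=t\mathbb Z$ with $t\ne0$, then $G_{ess}(\mathsf X,\mathsf f)=\frac{2\pi}{t}\mathbb Z$; (c) if $H(\mathsf X,\mathsf f)=\mathbb R$, then $G_{ess}(\mathsf X,\mathsf f)=\{0\}$.
   Context: A Markov chain $\mathsf X=\{X_n\}_{n\ge1}$ (possibly inhomogeneous) has complete separable metric state spaces $\mathfrak S_n\ni X_n$ with Borel $\sigma$-algebras, an initial distribution on $\mathfrak S_1$, and transition kernels $\pi_{n,n+1}(x,dy)$, so that $\mathbb P(X_{n+1}\in E\mid X_n,\dots,X_1)=\pi_{n,n+1}(X_n,E)$. It is uniformly elliptic if there are $0<\epsilon_0<1$, Borel probability measures $\mu_n$ on $\mathfrak S_n$ and measurable $p_n:\mathfrak S_n\times\mathfrak S_{n+1}\to[0,\infty)$ such that for all $n\ge1$: (a) $\pi_{n,n+1}(x,dy)=p_n(x,y)\mu_{n+1}(dy)$; (b) $0\le p_n\le1/\epsilon_0$; (c) $\int_{\mathfrak S_{n+1}}p_n(x,y)p_{n+1}(y,z)\mu_{n+1}(dy)>\epsilon_0$ for all $x\in\mathfrak S_n$, $z\in\mathfrak S_{n+2}$. By convention $\mu_n(E)=\mathbb P(X_n\in E)$. An additive functional is a sequence $\mathsf f=\{f_n\}$ of measurable $f_n:\mathfrak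 S_n\times\mathfrak S_{n+1}\to\mathbb R$; $S_N=\sum_{n=1}^Nf_n(X_n,X_{n+1})$; $\mathsf f$ is a.s. uniformly bounded if $\sup_n\mathrm{ess\,sup}|f_n(X_n,X_{n+1})|<\infty$. $\mathsf f$ is center-tight if there are constants $m_N$ such that for every $\epsilon>0$ there is $M$ with $\mathbb P[|S_N-m_N|>M]<\epsilon$ for all $N$. Algebraic and essential range. $G_{alg}(\mathsf X,\mathsf f)$ is the intersection of all closed subgroups $G\le\mathbb R$ for which there are $c_n\in\mathbb R$ with $\mathbb P[f_n(X_n,X_{n+1})-c_n\in G]=1$ for all $n\ge1$. $G_{ess}(\mathsf X,\mathsf f)=\bigcap\{G_{alg}(\mathsf X,\mathsf g):\mathsf g$ an additive functional on $\mathsf X$ with $\mathsf f-\mathsf g$ center-tight$\}$. Structure constants. The bridge distribution of $X_{n+1}$ given $X_n=x$, $X_{n+2}=z$ is the probability measure proportional to $p_n(x,y)p_{n+1}(y,z)\mu_{n+1}(dy)$. For $n\ge3$ a random position $n$ hexagon $P=\left(x_{n-2};\begin{smallmatrix}x_{n-1}\\ y_{n-1}\end{smallmatrix};\begin{smallmatrix}x_n\\ y_n\end{smallmatrix};y_{n+1}\right)$ is sampled as follows: $(x_{n-2},x_{n-1})$ is distributed like $(X_{n-2},X_{n-1})$; independently $(y_n,y_{n+1})$ is distributed like $(X_n,X_{n+1})$; given these, $x_n$ and $y_{n-1}$ are conditionally independent, $x_n$ having the bridge distribution of $X_n$ given $X_{n-1}=x_{n-1},X_{n+1}=y_{n+1}$,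 and $y_{n-1}$ the bridge distribution of $X_{n-1}$ given $X_{n-2}=x_{n-2},X_n=y_n$. The balance is $\Gamma(P)=f_{n-2}(x_{n-2},x_{n-1})+f_{n-1}(x_{n-1},x_n)+f_n(x_n,y_{n+1})-f_{n-2}(x_{n-2},y_{n-1})-f_{n-1}(y_{n-1},y_n)-f_n(y_n,y_{n+1})$. For $\xi\in\mathbb R$ set $d_n(\xi)=\mathbb E(|e^{i\xi\Gamma(P)}-1|^2)^{1/2}$. The co-range is $H(\mathsf X,\mathsf f)=\{\xi\in\mathbb R:\sum_{n=3}^\infty d_n(\xi)^2<\infty\}$. *)

theory Defs
  imports "HOL-Probability.Probability"
begin

text \<open>
  The state spaces are metric spaces on subsets of one type \<open>'a\<close>. This is no restriction:
  countably many complete separable metric spaces always embed disjointly into a common type.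
  Time starts at \<open>1\<close>; the entries of index \<open>0\<close> of all sequences are irrelevant.
\<close>

definition borel_metric :: "'a metric \<Rightarrow> 'a measure" where
  "borel_metric m = sigma (mspace m) {U. openin (mtopology_of m) U}"

locale markov_chain = prob_space M
  for M :: "'w measure" +
  fixes S :: "nat \<Rightarrow> 'a metric"
    and X :: "nat \<Rightarrow> 'w \<Rightarrow> 'a"
    and \<pi> :: "nat \<Rightarrow> 'a \<Rightarrow> 'a measure"
  assumes complete: "n \<ge> 1 \<Longrightarrow> mcomplete_of (S n)"
    and separable: "n \<ge> 1 \<Longrightarrow> separable_space (mtopology_of (S n))"
    and random_variable_X: "n \<ge> 1 \<Longrightarrow> X n \<in> M \<rightarrow>\<^sub>M borel_metric (S n)"
    and kernel: "n \<ge> 1 \<Longrightarrow> \<pi> n \<in> borel_metric (S n) \<rightarrow>\<^sub>M prob_algebra (borel_metric (S (Suc n)))"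
    and markov: "n \<ge> 1 \<Longrightarrow> E \<in> sets (borel_metric (S (Suc n))) \<Longrightarrow>
      (AE \<omega> in M. real_cond_exp M
          (vimage_algebra (space M) (\<lambda>\<omega>. \<lambda>i\<in>{1..n}. X i \<omega>) (\<Pi>\<^sub>M i\<in>{1..n}. borel_metric (S i)))
          (\<lambda>\<omega>. indicat_real E (X (Suc n) \<omega>)) \<omega>
        = measure (\<pi> n (X n \<omega>)) E)"

locale uniformly_elliptic_chain = markov_chain M S X \<pi>
  for M :: "'w measure" and S :: "nat \<Rightarrow> 'a metric" and X :: "nat \<Rightarrow> 'w \<Rightarrow> 'a"
    and \<pi> :: "nat \<Rightarrow> 'a \<Rightarrow> 'a measure" +
  fixes \<epsilon>\<^sub>0 :: real
    and \<mu> :: "nat \<Rightarrow> 'a measure"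
    and p :: "nat \<Rightarrow> 'a \<times> 'a \<Rightarrow> real"
  assumes eps0: "0 < \<epsilon>\<^sub>0" "\<epsilon>\<^sub>0 < 1"
    and prob_\<mu>: "n \<ge> 1 \<Longrightarrow> prob_space (\<mu> n)"
    and sets_\<mu>: "n \<ge> 1 \<Longrightarrow> sets (\<mu> n) = sets (borel_metric (S n))"
    and measurable_p: "n \<ge> 1 \<Longrightarrow>
      p n \<in> borel_measurable (borel_metric (S n) \<Otimes>\<^sub>M borel_metric (S (Suc n)))"
    and transition_density: "n \<ge> 1 \<Longrightarrow> x \<in> mspace (S n) \<Longrightarrow>
      \<pi> n x = density (\<mu> (Suc n)) (\<lambda>y. ennreal (p n (x, y)))"
    and p_bounds: "n \<ge> 1 \<Longrightarrow> x \<in> mspace (S n) \<Longrightarrow> y \<in> mspace (S (Suc n)) \<Longrightarrow>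
      0 \<le> p n (x, y) \<and> p n (x, y) \<le> 1 / \<epsilon>\<^sub>0"
    and two_step: "n \<ge> 1 \<Longrightarrow> x \<in> mspace (S n) \<Longrightarrow> z \<in> mspace (S (n + 2)) \<Longrightarrow>
      (\<integral>y. p n (x, y) * p (Suc n) (y, z) \<partial>\<mu> (Suc n)) > \<epsilon>\<^sub>0"

definition additive_functional :: "(nat \<Rightarrow> 'a metric) \<Rightarrow> (nat \<Rightarrow> 'a \<times> 'a \<Rightarrow> real) \<Rightarrow> bool" where
  "additive_functional S f \<longleftrightarrow>
    (\<forall>n\<ge>1. f n \<in> borel_measurable (borel_metric (S n) \<Otimes>\<^sub>M borel_metric (S (Suc n))))"

definition partial_sum ::
    "(nat \<Rightarrow> 'w \<Rightarrow> 'a) \<Rightarrow> (nat \<Rightarrow> 'a \<times> 'a \<Rightarrow> real) \<Rightarrow> nat \<Rightarrow> 'w \<Rightarrow> real" where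
  "partial_sum X f N \<omega> = (\<Sum>n=1..N. f n (X n \<omega>, X (Suc n) \<omega>))"

definition as_uniformly_bounded ::
    "'w measure \<Rightarrow> (nat \<Rightarrow> 'w \<Rightarrow> 'a) \<Rightarrow> (nat \<Rightarrow> 'a \<times> 'a \<Rightarrow> real) \<Rightarrow> bool" where
  "as_uniformly_bounded M X f \<longleftrightarrow>
    (SUP n\<in>{1..}. esssup M (\<lambda>\<omega>. ereal \<bar>f n (X n \<omega>, X (Suc n) \<omega>)\<bar>)) < \<infinity>"

definition center_tight ::
    "'w measure \<Rightarrow> (nat \<Rightarrow> 'w \<Rightarrow> 'a) \<Rightarrow> (nat \<Rightarrow> 'a \<times> 'a \<Rightarrow> real) \<Rightarrow> bool" where
  "center_tight M X f \<longleftrightarrow>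
    (\<exists>m. \<forall>\<epsilon>>0. \<exists>K. \<forall>N\<ge>1. \<P>(\<omega> in M. \<bar>partial_sum X f N \<omega> - m N\<bar> > K) < \<epsilon>)"

definition closed_real_subgroup :: "real set \<Rightarrow> bool" where
  "closed_real_subgroup G \<longleftrightarrow>
    closed G \<and> 0 \<in> G \<and> (\<forall>x\<in>G. \<forall>y\<in>G. x + y \<in> G) \<and> (\<forall>x\<in>G. - x \<in> G)"

definition G_alg ::
    "'w measure \<Rightarrow> (nat \<Rightarrow> 'w \<Rightarrow> 'a) \<Rightarrow> (nat \<Rightarrow> 'a \<times> 'a \<Rightarrow> real) \<Rightarrow> real set" where
  "G_alg M X f = \<Inter>{G. closed_real_subgroup G \<and>
    (\<exists>c. \<forall>n\<ge>1. \<P>(\<omega> in M. f n (X n \<omega>, X (Suc n) \<omega>) - c n \<in> G) = 1)}"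

definition G_ess ::
    "'w measure \<Rightarrow> (nat \<Rightarrow> 'a metric) \<Rightarrow> (nat \<Rightarrow> 'w \<Rightarrow> 'a) \<Rightarrow> (nat \<Rightarrow> 'a \<times> 'a \<Rightarrow> real) \<Rightarrow> real set" where
  "G_ess M S X f = \<Inter>{G_alg M X g | g.
    additive_functional S g \<and> center_tight M X (\<lambda>n z. f n z - g n z)}"

text \<open>\<open>bridge \<mu> p n x z\<close> is the law of \<open>X\<^bsub>n+1\<^esub>\<close> given \<open>X\<^bsub>n\<^esub> = x\<close> and \<open>X\<^bsub>n+2\<^esub> = z\<close>.\<close>

definition bridge ::
    "(nat \<Rightarrow> 'a measure) \<Rightarrow> (nat \<Rightarrow> 'a \<times> 'a \<Rightarrow> real) \<Rightarrow> nat \<Rightarrow> 'a \<Rightarrow> 'a \<Rightarrow> 'a measure" where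
  "bridge \<mu> p n x z = density (\<mu> (Suc n)) (\<lambda>y. ennreal (p n (x, y) * p (Suc n) (y, z) /
     (\<integral>y'. p n (x, y') * p (Suc n) (y', z) \<partial>\<mu> (Suc n))))"

text \<open>
  A position \<open>n\<close> hexagon, \<open>n \<ge> 3\<close>, is the tuple
  \<open>(x\<^bsub>n-2\<^esub>, x\<^bsub>n-1\<^esub>, x\<^bsub>n\<^esub>, y\<^bsub>n-1\<^esub>, y\<^bsub>n\<^esub>, y\<^bsub>n+1\<^esub>)\<close>. In the names below the suffixes
  \<open>a, b, c, d\<close> stand for the times \<open>n-2, n-1, n, n+1\<close>.
\<close>

type_synonym 'a hexagon = "'a \<times> 'a \<times> 'a \<times> 'a \<times> 'a \<times> 'a"

definition hexagon_space :: "(nat \<Rightarrow> 'a metric) \<Rightarrow> nat \<Rightarrow> 'a hexagon measure" where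
  "hexagon_space S n =
     borel_metric (S (n - 2)) \<Otimes>\<^sub>M borel_metric (S (n - 1)) \<Otimes>\<^sub>M borel_metric (S n) \<Otimes>\<^sub>M
     borel_metric (S (n - 1)) \<Otimes>\<^sub>M borel_metric (S n) \<Otimes>\<^sub>M borel_metric (S (n + 1))"

definition pair_law :: "'w measure \<Rightarrow> (nat \<Rightarrow> 'a metric) \<Rightarrow> (nat \<Rightarrow> 'w \<Rightarrow> 'a) \<Rightarrow> nat \<Rightarrow> ('a \<times> 'a) measure"
  where "pair_law M S X n =
    distr M (borel_metric (S n) \<Otimes>\<^sub>M borel_metric (S (Suc n))) (\<lambda>\<omega>. (X n \<omega>, X (Suc n) \<omega>))"

definition hexagon_law ::
    "'w measure \<Rightarrow> (nat \<Rightarrow> 'a metric) \<Rightarrow> (nat \<Rightarrow> 'w \<Rightarrow> 'a) \<Rightarrow> (nat \<Rightarrow> 'a measure) \<Rightarrow>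
      (nat \<Rightarrow> 'a \<times> 'a \<Rightarrow> real) \<Rightarrow> nat \<Rightarrow> 'a hexagon measure" where
  "hexagon_law M S X \<mu> p n = do {
     (xa, xb) \<leftarrow> pair_law M S X (n - 2);
     (yc, yd) \<leftarrow> pair_law M S X n;
     xc \<leftarrow> bridge \<mu> p (n - 1) xb yd;
     yb \<leftarrow> bridge \<mu> p (n - 2) xa yc;
     return (hexagon_space S n) (xa, xb, xc, yb, yc, yd)
   }"

fun balance :: "(nat \<Rightarrow> 'a \<times> 'a \<Rightarrow> real) \<Rightarrow> nat \<Rightarrow> 'a hexagon \<Rightarrow> real" where
  "balance f n (xa, xb, xc, yb, yc, yd) =
     f (n - 2) (xa, xb) + f (n - 1) (xb, xc) + f n (xc, yd)
     - f (n - 2) (xa, yb) - f (n - 1) (yb, yc) - f n (yc, yd)"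

definition structure_const ::
    "'w measure \<Rightarrow> (nat \<Rightarrow> 'a metric) \<Rightarrow> (nat \<Rightarrow> 'w \<Rightarrow> 'a) \<Rightarrow> (nat \<Rightarrow> 'a measure) \<Rightarrow>
      (nat \<Rightarrow> 'a \<times> 'a \<Rightarrow> real) \<Rightarrow> (nat \<Rightarrow> 'a \<times> 'a \<Rightarrow> real) \<Rightarrow> nat \<Rightarrow> real \<Rightarrow> real" where
  "structure_const M S X \<mu> p f n \<xi> =
     sqrt (\<integral>P. (cmod (exp (\<i> * of_real (\<xi> * balance f n P)) - 1))\<^sup>2 \<partial>hexagon_law M S X \<mu> p n)"

definition co_range ::
    "'w measure \<Rightarrow> (nat \<Rightarrow> 'a metric) \<Rightarrow> (nat \<Rightarrow> 'w \<Rightarrow> 'a) \<Rightarrow> (nat \<Rightarrow> 'a measure) \<Rightarrow>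
      (nat \<Rightarrow> 'a \<times> 'a \<Rightarrow> real) \<Rightarrow> (nat \<Rightarrow> 'a \<times> 'a \<Rightarrow> real) \<Rightarrow> real set" where
  "co_range M S X \<mu> p f = {\<xi>. summable (\<lambda>k. (structure_const M S X \<mu> p f (k + 3) \<xi>)\<^sup>2)}"

end

theory Submission
  imports Defs
begin

text \<open>
  Suppose that \<open>f - g\<close> is center-tight, that \<open>g - c\<close> takes values in a group \<open>G\<close>, and that
  \<open>exp (i \<xi> x) = 1\<close> on \<open>G\<close>. Then \<open>f\<close> and \<open>h = f - g\<close> have the same structure constants at \<open>\<xi>\<close>, so
  \<open>\<xi>\<close> is in the co-range of \<open>f\<close> once it is in that of \<open>h\<close>. But the co-range of a center-tight \<open>h\<close> is
  the whole line: the twisted transition operators over five consecutive times contract by a factor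
  \<open>1 - c d\<^sub>n(\<eta>)\<^sup>2\<close> at every frequency \<open>\<eta>\<close>, tightness keeps the characteristic functions of the centered
  sums away from \<open>0\<close> for small \<open>\<eta>\<close>, and \<open>d\<^sub>n(2\<eta>) \<le> 2 d\<^sub>n(\<eta>)\<close> passes from small to all frequencies.

  Conversely, let \<open>\<xi> \<noteq> 0\<close> be in the co-range. Fix a typical path \<open>z\<close> and average the hexagons with
  \<open>x\<^bsub>n-2\<^esub> = z\<^bsub>n-2\<^esub>\<close>, \<open>x\<^bsub>n-1\<^esub> = z\<^bsub>n-1\<^esub>\<close> over their two bridges. This shows that, modulo \<open>2\<pi>/\<xi>\<close>, \<open>f\<^sub>n\<close> is a
  constant plus a bounded gradient plus an error of summable second moments. Gradient and errors are
  center-tight, the latter because the two-step contraction in \<open>L\<^sup>2\<close> bounds the variance of a sum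
  by the sum of the second moments. The theorem follows from the list of closed subgroups of the line.
\<close>

section \<open>Phases, closed subgroups and auxiliary estimates\<close>

text \<open>The two directions use the hexagon law differently. With the end points fixed these
  paths are independent, and the mean of the squared phase difference becomes twice the gap between
  the squares of the plain and of the twisted three-step kernel. The structure constant controls
  this gap only after averaging over the end points, whereas an operator bound must hold for every
  starting point; two further steps are therefore put in front of the three. Since such blocks see
  only every fifth hexagon, the argument is run for each residue modulo 5. For the converse the law
  is used exactly. Its two edges are independent, so freezing the first one leaves the second with
  its own law. Phases are known only modulo a full turn and bridge averages have modulus at most
  one, so everything is phrased with arguments; the error is then bounded by pi by
  construction.\<close>

lemma borel_measurable_Arg [measurable]: "Arg \<in> borel_measurable borel"
proof -
  \<comment> \<open>\<open>Arg\<close> is continuous off the closed negative half-line; on it the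
    value is \<open>pi\<close>, except for the conventional value 0 at 0.\<close>
  have "(\<lambda>z. indicator (- \<real>\<^sub>\<le>\<^sub>0) z *\<^sub>R Arg z) \<in> borel_measurable borel"
    by (intro borel_measurable_continuous_on_indicator)
       (auto intro!: borel_comp closed_nonpos_Reals_complex continuous_at_imp_continuous_on continuous_at_Arg)
  moreover have [measurable]: "(\<real>\<^sub>\<le>\<^sub>0 :: complex set) \<in> sets borel"
    by (intro borel_closed closed_nonpos_Reals_complex)
  moreover have "(\<lambda>z. indicator (\<real>\<^sub>\<le>\<^sub>0 - {0}) z *\<^sub>R pi) \<in> borel_measurable (borel :: complex measure)"
    by measurable
  ultimately have "(\<lambda>z. indicator (- \<real>\<^sub>\<le>\<^sub>0) z *\<^sub>R Arg z + indicator (\<real>\<^sub>\<le>\<^sub>0 - {0}) z *\<^sub>R pi)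
      \<in> borel_measurable borel"
    by (intro borel_measurable_add)
  also have "(\<lambda>z. indicator (- \<real>\<^sub>\<le>\<^sub>0) z *\<^sub>R Arg z + indicator (\<real>\<^sub>\<le>\<^sub>0 - {0}) z *\<^sub>R pi) = Arg"
  proof
    fix z :: complex
    have "Arg z = pi" if "z \<in> \<real>\<^sub>\<le>\<^sub>0" "z \<noteq> 0"
      using that unfolding Arg_eq_pi by (auto simp: complex_nonpos_Reals_iff complex_eq_iff)
    then show "indicator (- \<real>\<^sub>\<le>\<^sub>0) z *\<^sub>R Arg z + indicator (\<real>\<^sub>\<le>\<^sub>0 - {0}) z *\<^sub>R pi = Arg z"
      by (auto simp: indicator_def Arg_zero)
  qed
  finally show ?thesis .
qed

lemma less_tan:
  fixes x :: real
  assumes "0 < x" "x < pi / 2"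
  shows "x < tan x"
proof -
  have "(\<lambda>x. tan x - x) 0 < (\<lambda>x. tan x - x) x"
  proof (rule DERIV_pos_imp_increasing_open[OF assms(1)])
    fix y :: real assume y: "0 < y" "y < x"
    then have c: "0 < cos y" using assms by (intro cos_gt_zero) auto
    have "cos y \<noteq> 1" using cos_monotone_0_pi[of 0 y] y assms by auto
    then have "cos y < 1" using cos_le_one[of y] by linarith
    then have "(cos y)\<^sup>2 < 1" using c by (simp add: power_less_one_iff)
    then have "inverse ((cos y)\<^sup>2) - 1 > 0" using c by (simp add: one_less_inverse_iff)
    moreover have "((\<lambda>x. tan x - x) has_real_derivative inverse ((cos y)\<^sup>2) - 1) (at y)"
      using c by (auto intro!: derivative_eq_intros)
    ultimately show "\<exists>l. ((\<lambda>x. tan x - x) has_real_derivative l) (at y) \<and> 0 < l" by blast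
  next
    have "cos y \<noteq> 0" if "y \<in> {0..x}" for y using that assms cos_gt_zero_pi[of y] by auto
    then show "continuous_on {0..x} (\<lambda>x. tan x - x)" by (intro continuous_intros) auto
  qed
  then show ?thesis by simp
qed

text \<open>In half angles \<open>1 - cos y\<close> is twice the square of
  \<open>sin (y / 2)\<close>, and \<open>sin (y / 2)\<close> is at least
  \<open>y / 2 * cos (y / 2)\<close>. The constant 1/4 arises because the square of
  \<open>cos (y / 2)\<close> is at least 1/2 on this range.\<close>

lemma one_minus_cos_ge:
  fixes x :: real
  assumes "\<bar>x\<bar> \<le> pi / 2"
  shows "x\<^sup>2 / 4 \<le> 1 - cos x"
proof -
  have *: "y\<^sup>2 / 4 \<le> 1 - cos y" if "0 \<le> y" "y \<le> pi / 2" for y :: real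
  proof -
    have 1: "y / 2 * cos (y / 2) \<le> sin (y / 2)"
    proof (cases "y = 0")
      case False
      then have "y / 2 < tan (y / 2)" using that by (intro less_tan) auto
      moreover have "cos (y / 2) > 0" using that False by (intro cos_gt_zero) auto
      ultimately show ?thesis by (simp add: tan_def field_simps)
    qed auto
    have c: "cos y \<ge> 0" using that by (intro cos_ge_zero) auto
    have h: "cos y = 2 * (cos (y / 2))\<^sup>2 - 1" using cos_double_cos[of "y/2"] by simp
    have "(y / 2)\<^sup>2 * (cos (y / 2))\<^sup>2 \<le> (sin (y / 2))\<^sup>2"
      using power_mono[OF 1, of 2] that by (simp add: power_mult_distrib[symmetric] cos_ge_zero)
    also have "\<dots> = (1 - cos y) / 2" using h by (simp add: sin_squared_eq)
    finally have "(y / 2)\<^sup>2 * (cos (y / 2))\<^sup>2 \<le> (1 - cos y) / 2" .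
    moreover have "(y / 2)\<^sup>2 * (1 / 2) \<le> (y / 2)\<^sup>2 * (cos (y / 2))\<^sup>2"
      using c h by (intro mult_left_mono) auto
    ultimately show ?thesis by (simp add: power2_eq_square)
  qed
  show ?thesis using *[of "\<bar>x\<bar>"] assms by auto
qed

text \<open>The factor \<open>r\<close> will be the product of the moduli of two bridge averages. If
  the real part of \<open>u\<close> is nonnegative, shrinking \<open>r\<close> only enlarges the
  right-hand side; otherwise the right-hand side is at least 16, which exceeds
  \<open>pi\<^sup>2\<close>.\<close>

lemma Arg_sq_le:
  assumes "cmod u = 1" "0 \<le> r" "r \<le> 1"
  shows "(Arg u)\<^sup>2 \<le> 16 * (1 - r * Re u)"
proof -
  have u: "Re u = cos (Arg u)"
    using assms(1) by (metis cis_Arg cis.sel(1) norm_zero sgn_eq zero_neq_one div_by_1 of_real_1)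
  have a: "\<bar>Arg u\<bar> \<le> pi" using Arg_bounded[of u] by auto
  show ?thesis
  proof (cases "\<bar>Arg u\<bar> \<le> pi / 2")
    case True
    then have c: "0 \<le> cos (Arg u)" by (intro cos_ge_zero) auto
    have "r * cos (Arg u) \<le> 1 * cos (Arg u)" using c assms by (intro mult_right_mono) auto
    then show ?thesis using one_minus_cos_ge[OF True] cos_le_one[of "Arg u"] unfolding u right_diff_distrib by argo
  next
    case False
    have "cos (Arg u) \<le> 0"
      using cos_ge_zero[of "pi - \<bar>Arg u\<bar>"] False a by (simp add: cos_diff)
    then have "r * Re u \<le> 0" using assms unfolding u by (simp add: mult_nonneg_nonpos)
    moreover have "(Arg u)\<^sup>2 \<le> pi\<^sup>2" using a by (metis abs_le_square_iff abs_of_pos pi_gt_zero)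
    moreover have "pi\<^sup>2 \<le> 4\<^sup>2" using pi_less_4 by (intro power_mono) auto
    ultimately show ?thesis by simp
  qed
qed

lemma norm_cis_minus_1_sq: "(cmod (cis x - 1))\<^sup>2 = 2 - 2 * cos x"
proof -
  have "(cmod (cis x - 1))\<^sup>2 = (cos x - 1)\<^sup>2 + (sin x)\<^sup>2"
    by (simp add: cmod_def)
  also have "\<dots> = 2 - 2 * cos x" using sin_cos_squared_add[of x] by (simp add: power2_eq_square algebra_simps)
  finally show ?thesis .
qed

lemma borel_measurable_cis [measurable]: "cis \<in> borel_measurable borel"
  unfolding cis_conv_exp by measurable

text \<open>The integrand is 2 minus twice the real part of a factor in \<open>s\<close> times a
  factor in \<open>t\<close>, so the double integral factorizes. With \<open>\<kappa> = 0\<close>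
  this serves for two paths with common end points; in general \<open>\<kappa>\<close> is the phase
  of the two fixed edges of a hexagon, and \<open>A\<close> and \<open>B\<close> are its
  bridges.\<close>

lemma nn_integral_phase_difference:
  fixes \<phi> :: "'a \<Rightarrow> real" and \<psi> :: "'b \<Rightarrow> real"
  assumes "finite_measure A" "finite_measure B"
  assumes [measurable]: "\<phi> \<in> borel_measurable A" "\<psi> \<in> borel_measurable B"
  shows "(\<integral>\<^sup>+s. \<integral>\<^sup>+t. ennreal ((cmod (cis (\<kappa> + \<phi> s - \<psi> t) - 1))\<^sup>2) \<partial>B \<partial>A) =
    ennreal (2 * measure A (space A) * measure B (space B) -
      2 * Re (cis \<kappa> * (\<integral>s. cis (\<phi> s) \<partial>A) * cnj (\<integral>t. cis (\<psi> t) \<partial>B)))"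
proof -
  interpret A: finite_measure A by fact
  interpret B: finite_measure B by fact
  have iA [simp]: "integrable A (\<lambda>s. cis (\<phi> s))" by (intro A.integrable_const_bound[of _ 1]) auto
  have iB [simp]: "integrable B (\<lambda>s. cis (\<psi> s))" by (intro B.integrable_const_bound[of _ 1]) auto
  have c: "(cmod (cis (\<kappa> + \<phi> s - \<psi> t) - 1))\<^sup>2 = 2 - 2 * Re (cis \<kappa> * cis (\<phi> s) * cnj (cis (\<psi> t)))" for s t
    by (simp add: norm_cis_minus_1_sq cis_mult cis_cnj flip: cis_mult)
       (simp add: algebra_simps cos_add cos_diff sin_add sin_diff)
  have iR: "integrable B (\<lambda>t. Re (z * cnj (cis (\<psi> t))))" for z
    by (intro integrable_Re integrable_mult_right) simp
  have IB: "(\<integral>t. Re (z * cnj (cis (\<psi> t))) \<partial>B) = Re (z * cnj (\<integral>t. cis (\<psi> t) \<partial>B))" for z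
    by (subst integral_Re) (auto simp flip: integral_cnj)
  have "(\<integral>\<^sup>+t. ennreal ((cmod (cis (\<kappa> + \<phi> s - \<psi> t) - 1))\<^sup>2) \<partial>B) =
      ennreal (2 * measure B (space B) - 2 * Re (cis \<kappa> * cis (\<phi> s) * cnj (\<integral>t. cis (\<psi> t) \<partial>B)))" for s
  proof -
    have "(\<integral>\<^sup>+t. ennreal ((cmod (cis (\<kappa> + \<phi> s - \<psi> t) - 1))\<^sup>2) \<partial>B) =
       ennreal (\<integral>t. 2 - 2 * Re (cis \<kappa> * cis (\<phi> s) * cnj (cis (\<psi> t))) \<partial>B)"
      unfolding c
      by (intro nn_integral_eq_integral AE_I2 Bochner_Integration.integrable_diff integrable_mult_right iR)
         (simp_all only: flip: c, simp_all)
    also have "(\<integral>t. 2 - 2 * Re (cis \<kappa> * cis (\<phi> s) * cnj (cis (\<psi> t))) \<partial>B)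
       = 2 * measure B (space B) - 2 * Re (cis \<kappa> * cis (\<phi> s) * cnj (\<integral>t. cis (\<psi> t) \<partial>B))"
      by (subst Bochner_Integration.integral_diff)
         (auto simp only: IB integral_mult_right_zero lebesgue_integral_const real_scaleR_def mult.commute[of _ 2] intro!: iR integrable_mult_right)
    finally show ?thesis .
  qed
  note inner = this
  define z where "z = cnj (\<integral>t. cis (\<psi> t) \<partial>B)"
  have pos: "0 \<le> 2 * measure B (space B) - 2 * Re (cis \<kappa> * cis (\<phi> s) * z)" for s
  proof -
    have "Re (cis \<kappa> * cis (\<phi> s) * z) \<le> cmod (cis \<kappa> * cis (\<phi> s) * z)" by (rule complex_Re_le_cmod)
    also have "\<dots> = cmod (\<integral>t. cis (\<psi> t) \<partial>B)" by (simp add: norm_mult z_def)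
    also have "\<dots> \<le> (\<integral>t. cmod (cis (\<psi> t)) \<partial>B)" by (rule integral_norm_bound)
    finally show ?thesis by simp
  qed
  have iR2: "integrable A (\<lambda>s. Re (cis \<kappa> * cis (\<phi> s) * z))"
    by (intro integrable_Re integrable_mult_right integrable_mult_left) simp
  have IA: "(\<integral>s. Re (cis \<kappa> * cis (\<phi> s) * z) \<partial>A) = Re (cis \<kappa> * (\<integral>s. cis (\<phi> s) \<partial>A) * z)"
    by (subst integral_Re) (auto intro!: integrable_mult_left integrable_mult_right)
  have "(\<integral>s. 2 * measure B (space B) - 2 * Re (cis \<kappa> * cis (\<phi> s) * z) \<partial>A) =
      2 * measure B (space B) * measure A (space A) - 2 * Re (cis \<kappa> * (\<integral>s. cis (\<phi> s) \<partial>A) * z)"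
    by (subst Bochner_Integration.integral_diff)
       (auto simp only: IA integral_mult_right_zero lebesgue_integral_const real_scaleR_def
          mult.commute[of "measure A (space A)"] A.integrable_const intro!: iR2 integrable_mult_right)
  moreover have "(\<integral>\<^sup>+s. ennreal (2 * measure B (space B) - 2 * Re (cis \<kappa> * cis (\<phi> s) * z)) \<partial>A) =
      ennreal (\<integral>s. 2 * measure B (space B) - 2 * Re (cis \<kappa> * cis (\<phi> s) * z) \<partial>A)"
    by (intro nn_integral_eq_integral AE_I2 Bochner_Integration.integrable_diff integrable_mult_right
        iR2 pos A.integrable_const)
  ultimately show ?thesis
    unfolding inner z_def[symmetric] by (simp only: mult_ac)
qed

text \<open>Everything depends on the infimum \<open>a\<close> of the positive elements:
  \<open>a = 0\<close> makes the group dense, hence the whole line by closedness, while a positive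
  \<open>a\<close> is attained and generates the group by division with remainder.\<close>

lemma closed_real_subgroup_cases:
  assumes "closed_real_subgroup G"
  obtains "G = UNIV" | "G = {0}" | a where "a > 0" "G = {a * of_int k | k::int. True}"
proof -
  have cl: "closed G" and 0: "0 \<in> G" and add: "\<And>x y. x \<in> G \<Longrightarrow> y \<in> G \<Longrightarrow> x + y \<in> G"
    and neg: "\<And>x. x \<in> G \<Longrightarrow> - x \<in> G"
    using assms by (auto simp: closed_real_subgroup_def)
  have mn: "of_nat n * x \<in> G" if "x \<in> G" for n x
    using that by (induction n) (auto simp: 0 algebra_simps intro: add)
  have mi: "of_int k * x \<in> G" if "x \<in> G" for k x
    using mn[OF that, of "nat k"] neg[OF mn[OF that, of "nat (- k)"]]
    by (cases "k \<ge> 0") auto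
  have floor_mult: "0 \<le> x - a * of_int \<lfloor>x / a\<rfloor>" "x - a * of_int \<lfloor>x / a\<rfloor> < a" if "a > 0" for x a :: real
    using floor_correct[of "x / a"] mult_left_mono[of "of_int \<lfloor>x / a\<rfloor>" "x / a" a]
      mult_strict_left_mono[of "x / a" "of_int \<lfloor>x / a\<rfloor> + 1" a] that
    by (auto simp: algebra_simps)
  have rem: "x - a * of_int k \<in> G" if "x \<in> G" "a \<in> G" for x a k
    using add[OF that(1) neg[OF mi[OF that(2), of k]]] by (simp add: mult.commute)
  define Pos where "Pos = {x \<in> G. x > 0}"
  define a where "a = Inf Pos"
  have bdd: "bdd_below Pos" by (auto simp: Pos_def intro!: bdd_belowI[of _ 0])
  show ?thesis
  proof (cases "Pos = {}")
    case True
    have "x = 0" if "x \<in> G" for x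
      using True that neg[OF that] by (auto simp: Pos_def) (metis less_eq_real_def linorder_not_le neg_0_less_iff_less)
    then show ?thesis using that(2) 0 by auto
  next
    case False
    have a0: "a \<ge> 0" unfolding a_def using False by (intro cInf_greatest) (auto simp: Pos_def)
    show ?thesis
    proof (cases "a = 0")
      case True
      have "x \<in> G" for x
      proof -
        have "x \<in> closure G" unfolding closure_approachable
        proof safe
          fix e :: real assume "e > 0"
          then obtain b where b: "b \<in> Pos" "b < e"
            using cInf_lessD[OF False, of e] True unfolding a_def by auto
          then have b': "b > 0" "b \<in> G" by (auto simp: Pos_def)
          have "b * of_int \<lfloor>x / b\<rfloor> \<in> G" using mi[OF b'(2)] by (simp add: mult.commute)
          moreover have "dist (b * of_int \<lfloor>x / b\<rfloor>) x < e"
            using floor_mult[OF b'(1), of x] b by (auto simp: dist_real_def)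
          ultimately show "\<exists>y\<in>G. dist y x < e" by blast
        qed
        then show ?thesis using cl by simp
      qed
      then show ?thesis using that(1) by auto
    next
      case False
      with a0 have a: "a > 0" by simp
      have le: "a \<le> x" if "x \<in> G" "x > 0" for x
        unfolding a_def using that bdd by (intro cInf_lower) (auto simp: Pos_def)
      \<comment> \<open>Were \<open>a\<close> not attained, there would be group elements
        \<open>c < b\<close> between \<open>a\<close> and \<open>2 * a\<close>, and their difference
        would be a positive element below \<open>a\<close>.\<close>
      have aG: "a \<in> G"
      proof (rule ccontr)
        assume "a \<notin> G"
        obtain b where b: "b \<in> Pos" "b < 2 * a"
          using cInf_lessD[OF \<open>Pos \<noteq> {}\<close>, of "2 * a"] a unfolding a_def by auto
        then have bG: "b \<in> G" "b > 0" by (auto simp: Pos_def)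
        with le \<open>a \<notin> G\<close> have ab: "a < b" by (metis less_eq_real_def)
        obtain c where c: "c \<in> Pos" "c < b"
          using cInf_lessD[OF \<open>Pos \<noteq> {}\<close>, of b] ab unfolding a_def by auto
        have "b - c \<in> G" using rem[OF bG(1), of c 1] c by (auto simp: Pos_def)
        then have "a \<le> b - c" using le c by auto
        moreover have "a \<le> c" using le c by (auto simp: Pos_def)
        ultimately show False using b by simp
      qed
      have "x \<in> {a * of_int k | k::int. True}" if "x \<in> G" for x
      proof -
        have "\<not> 0 < x - a * of_int \<lfloor>x / a\<rfloor>"
          using le[OF rem[OF that aG]] floor_mult[OF a, of x] by fastforce
        then have "x = a * of_int \<lfloor>x / a\<rfloor>" using floor_mult[OF a, of x] by simp
        then show ?thesis by blast
      qed
      moreover have "a * of_int k \<in> G" for k using mi[OF aG] by (simp add: mult.commute)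
      ultimately show ?thesis using that(3)[OF a] by blast
    qed
  qed
qed

text \<open>Cauchy-Schwarz for a weight that need not have mass one, read off from the nonnegative
  variance about the weighted mean \<open>t\<close>. In the main application the weight is a
  two-step density from which a constant has been subtracted.\<close>

lemma square_integral_weighted_le:
  fixes w u :: "'a \<Rightarrow> real"
  assumes int: "integrable N w" "integrable N (\<lambda>x. w x * u x)" "integrable N (\<lambda>x. w x * (u x)\<^sup>2)"
    and nn: "\<And>x. x \<in> space N \<Longrightarrow> 0 \<le> w x" and pos: "0 < (\<integral>x. w x \<partial>N)"
  shows "(\<integral>x. w x * u x \<partial>N)\<^sup>2 \<le> (\<integral>x. w x \<partial>N) * (\<integral>x. w x * (u x)\<^sup>2 \<partial>N)"
proof -
  let ?W = "\<integral>x. w x \<partial>N" and ?a = "\<integral>x. w x * u x \<partial>N" and ?b = "\<integral>x. w x * (u x)\<^sup>2 \<partial>N"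
  define t where "t = ?a / ?W"
  have "0 \<le> (\<integral>x. w x * (u x - t)\<^sup>2 \<partial>N)" using nn by (intro integral_nonneg_AE AE_I2) simp
  also have "(\<integral>x. w x * (u x - t)\<^sup>2 \<partial>N) = (\<integral>x. w x * (u x)\<^sup>2 - 2 * t * (w x * u x) + t\<^sup>2 * w x \<partial>N)"
    by (intro Bochner_Integration.integral_cong refl) (simp add: power2_eq_square algebra_simps)
  also have "\<dots> = ?b - 2 * t * ?a + t\<^sup>2 * ?W"
    using int by simp
  also have "\<dots> = ?b - ?a\<^sup>2 / ?W" using pos by (simp add: t_def field_simps power2_eq_square)
  finally show ?thesis using pos by (simp add: field_simps)
qed

text \<open>Conditional expectations of a sum and of its phase are both computed backwards from a
  terminal time \<open>N\<close>. The recursion runs on the remaining time \<open>N - k\<close>, so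
  that \<open>U\<close> is frozen at \<open>z\<close> from \<open>N\<close> on.\<close>

lemma backward_recursion:
  fixes A :: "nat \<Rightarrow> 'c \<Rightarrow> 'c"
  obtains U where "\<And>k. N \<le> k \<Longrightarrow> U k = z" "\<And>k. k < N \<Longrightarrow> U k = A k (U (Suc k))"
proof
  let ?U = "\<lambda>k. rec_nat z (\<lambda>i v. A (N - Suc i) v) (N - k)"
  show "?U k = z" if "N \<le> k" for k using that by simp
  show "?U k = A k (?U (Suc k))" if "k < N" for k
    using that Suc_diff_Suc[OF that] by (metis (lifting) Suc_leI diff_diff_cancel less_imp_le rec_nat_Suc_imp)
qed

text \<open>The weights are \<open>e\<close> and \<open>1 - e\<close> so that dividing by the second
  one cancels one of the two factors \<open>1 - e\<close> that the square of a contraction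
  produces.\<close>

lemma square_add_le_convex:
  fixes a r e :: real
  assumes "0 < e" "e < 1"
  shows "(a + r)\<^sup>2 \<le> a\<^sup>2 / e + r\<^sup>2 / (1 - e)"
proof -
  have "a\<^sup>2 / e + r\<^sup>2 / (1 - e) - (a + r)\<^sup>2 = (a * (1 - e) - r * e)\<^sup>2 / (e * (1 - e))"
    using assms by (simp add: field_simps power2_eq_square)
  moreover have "0 \<le> (a * (1 - e) - r * e)\<^sup>2 / (e * (1 - e))" using assms by simp
  ultimately show ?thesis by linarith
qed

lemma nn_integral_swap:
  assumes "sigma_finite_measure A" "sigma_finite_measure B"
    and "(\<lambda>t. f (fst t) (snd t)) \<in> borel_measurable (A \<Otimes>\<^sub>M B)"
  shows "(\<integral>\<^sup>+x. \<integral>\<^sup>+y. f x y \<partial>B \<partial>A) = (\<integral>\<^sup>+y. \<integral>\<^sup>+x. f x y \<partial>A \<partial>B)"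
proof -
  interpret A: sigma_finite_measure A by fact
  interpret B: sigma_finite_measure B by fact
  interpret pair_sigma_finite A B ..
  show ?thesis using Fubini'[of f] assms(3) by (simp add: case_prod_unfold)
qed

lemma prod_one_minus_le_exp:
  fixes a :: "nat \<Rightarrow> real"
  assumes "finite I" "\<And>i. i \<in> I \<Longrightarrow> a i \<le> 1"
  shows "(\<Prod>i\<in>I. 1 - a i) \<le> exp (- (\<Sum>i\<in>I. a i))"
proof -
  have "(\<Prod>i\<in>I. 1 - a i) \<le> (\<Prod>i\<in>I. exp (- a i))"
    using assms(2) exp_ge_add_one_self[of "- a _"] by (intro prod_mono) auto
  also have "\<dots> = exp (- (\<Sum>i\<in>I. a i))"
    using assms(1) by (simp add: exp_sum flip: sum_negf)
  finally show ?thesis .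
qed

text \<open>\<open>cis (2 * x) - 1\<close> is \<open>cis x - 1\<close> times
  \<open>cis x + 1\<close>, and the second factor has modulus at most 2.\<close>

lemma norm_cis_double_minus_1_le: "(cmod (cis (2 * x) - 1))\<^sup>2 \<le> 4 * (cmod (cis x - 1))\<^sup>2"
proof -
  have "(cos x)\<^sup>2 \<ge> 2 * cos x - 1"
    using zero_le_power2[of "cos x - 1"] by (simp add: power2_eq_square algebra_simps)
  then show ?thesis
    unfolding norm_cis_minus_1_sq using cos_double_cos[of x] by simp
qed

lemma borel_measurable_cnj [measurable]: "cnj \<in> borel_measurable borel"
  by (intro borel_measurable_continuous_onI continuous_intros)

lemma cis_eq_cisE:
  assumes "cis x = cis y"
  obtains n :: int where "x = y + 2 * pi * of_int n"
proof -
  have "sin x = sin y \<and> cos x = cos y" using assms by (auto simp: complex_eq_iff)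
  then show ?thesis using that unfolding sin_cos_eq_iff by auto
qed

lemma mult_cis_Arg: "of_real (cmod z) * cis (Arg z) = z"
  using rcis_cmod_Arg[of z] by (simp only: rcis_def)

text \<open>For the first two summands in the reduction to a lattice, which receive no
  correction.\<close>

lemma (in prob_space) tight_single:
  fixes Z :: "'a \<Rightarrow> real"
  assumes [measurable]: "Z \<in> borel_measurable M" and "0 < \<epsilon>"
  obtains K where "\<P>(\<omega> in M. K < \<bar>Z \<omega>\<bar>) < \<epsilon>" "0 \<le> K"
proof -
  let ?A = "\<lambda>n::nat. {\<omega> \<in> space M. real n < \<bar>Z \<omega>\<bar>}"
  have "(\<lambda>n. measure M (?A n)) \<longlonglongrightarrow> measure M (\<Inter>n. ?A n)"
    by (rule finite_Lim_measure_decseq) (auto simp: decseq_def)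
  also have "(\<Inter>n. ?A n) = {}"
  proof (intro equals0I)
    fix \<omega> assume *: "\<omega> \<in> (\<Inter>n. ?A n)"
    obtain n where "\<bar>Z \<omega>\<bar> < real n" using reals_Archimedean2 by blast
    moreover have "real n < \<bar>Z \<omega>\<bar>" using * by simp
    ultimately show False by simp
  qed
  finally have "(\<lambda>n. measure M (?A n)) \<longlonglongrightarrow> 0" by simp
  then have "\<forall>\<^sub>F n in sequentially. measure M (?A n) < \<epsilon>"
    using \<open>0 < \<epsilon>\<close> by (rule order_tendstoD)
  then obtain n where "measure M (?A n) < \<epsilon>" by (auto simp: eventually_sequentially)
  then show ?thesis by (intro that[of "real n"]) auto
qed

lemma (in prob_space) prob_abs_gt_le:
  fixes Z :: "'a \<Rightarrow> real"
  assumes [measurable]: "Z \<in> borel_measurable M" and int: "integrable M (\<lambda>\<omega>. (Z \<omega>)\<^sup>2)"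
    and V: "(\<integral>\<omega>. (Z \<omega>)\<^sup>2 \<partial>M) \<le> V" and K: "0 < K"
  shows "\<P>(\<omega> in M. K < \<bar>Z \<omega>\<bar>) \<le> V / K\<^sup>2"
proof -
  let ?A = "{\<omega> \<in> space M. K < \<bar>Z \<omega>\<bar>}"
  have "K\<^sup>2 * measure M ?A = (\<integral>\<omega>. K\<^sup>2 * indicator ?A \<omega> \<partial>M)" by simp
  also have "\<dots> \<le> (\<integral>\<omega>. (Z \<omega>)\<^sup>2 \<partial>M)"
  proof (rule integral_mono[OF _ int])
    show "integrable M (\<lambda>\<omega>. K\<^sup>2 * indicator ?A \<omega>)"
      by (intro integrable_mult_right integrable_real_indicator) (auto simp: emeasure_eq_measure)
    fix \<omega> assume "\<omega> \<in> space M"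
    show "K\<^sup>2 * indicator ?A \<omega> \<le> (Z \<omega>)\<^sup>2"
      using K power_mono[of K "\<bar>Z \<omega>\<bar>" 2] by (auto simp: indicator_def)
  qed
  finally show ?thesis using V K by (simp add: field_simps)
qed

lemma closed_real_subgroup_multiples: "closed_real_subgroup {a * of_int k | k::int. True}"
proof -
  have eq: "{a * of_int k | k::int. True} = (\<lambda>x. a *\<^sub>R x) ` \<int>"
    by (auto simp: Ints_def)
  have "closed {a * of_int k | k::int. True}"
    unfolding eq by (intro closed_scaling closed_Ints)
  moreover have "\<exists>k::int. 0 = a * of_int k" by (rule exI[of _ 0]) simp
  moreover have "\<exists>l::int. a * of_int i + a * of_int j = a * of_int l" for i j :: int
    by (rule exI[of _ "i + j"]) (simp add: distrib_left)
  moreover have "\<exists>l::int. - (a * of_int i) = a * of_int l" for i :: int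
    by (rule exI[of _ "- i"]) simp
  ultimately show ?thesis unfolding closed_real_subgroup_def by blast
qed

section \<open>Chains with bounded transition densities\<close>

text \<open>
  Time is shifted by one so that it starts at \<open>0\<close>. The measure \<open>m k\<close> is both the state space and the
  law of \<open>Y k\<close>, and \<open>F\<close> plays the role of the natural filtration.
\<close>

locale elliptic = prob_space M
  for M :: "'w measure" +
  fixes F :: "nat \<Rightarrow> 'w measure" and m :: "nat \<Rightarrow> 'a measure"
    and Y :: "nat \<Rightarrow> 'w \<Rightarrow> 'a" and q :: "nat \<Rightarrow> 'a \<times> 'a \<Rightarrow> real" and e :: real
  assumes e: "0 < e" "e < 1"
    and subalg: "\<And>k. subalgebra M (F k)"
    and Y_F: "\<And>j k. j \<le> k \<Longrightarrow> Y j \<in> F k \<rightarrow>\<^sub>M m j"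
    and law_Y: "\<And>k. distr M (m k) (Y k) = m k"
    and q_meas [measurable]: "\<And>k. q k \<in> borel_measurable (m k \<Otimes>\<^sub>M m (Suc k))"
    and q_nonneg: "\<And>k x y. x \<in> space (m k) \<Longrightarrow> y \<in> space (m (Suc k)) \<Longrightarrow> 0 \<le> q k (x, y)"
    and q_le: "\<And>k x y. x \<in> space (m k) \<Longrightarrow> y \<in> space (m (Suc k)) \<Longrightarrow> q k (x, y) \<le> 1 / e"
    and q_total: "\<And>k x. x \<in> space (m k) \<Longrightarrow> (\<integral>y. q k (x, y) \<partial>m (Suc k)) = 1"
    and two_step: "\<And>k x z. x \<in> space (m k) \<Longrightarrow> z \<in> space (m (Suc (Suc k))) \<Longrightarrow>
      e < (\<integral>y. q k (x, y) * q (Suc k) (y, z) \<partial>m (Suc k))"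
    and markov_set: "\<And>k A E. A \<in> sets (F k) \<Longrightarrow> E \<in> sets (m (Suc k)) \<Longrightarrow>
      emeasure M (A \<inter> (Y (Suc k) -` E \<inter> space M)) =
        (\<integral>\<^sup>+\<omega>. (\<integral>\<^sup>+y. ennreal (q k (Y k \<omega>, y)) * indicator E y \<partial>m (Suc k)) * indicator A \<omega> \<partial>M)"
begin

abbreviation mm :: "nat \<Rightarrow> ('a \<times> 'a) measure" where
  "mm k \<equiv> m k \<Otimes>\<^sub>M m (Suc k)"

abbreviation YY :: "nat \<Rightarrow> 'w \<Rightarrow> 'a \<times> 'a" where
  "YY k \<omega> \<equiv> (Y k \<omega>, Y (Suc k) \<omega>)"

lemma F_to_M: "f \<in> F k \<rightarrow>\<^sub>M N \<Longrightarrow> f \<in> M \<rightarrow>\<^sub>M N"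
  using measurable_from_subalg[OF subalg] .

lemma Y_meas [measurable]: "Y k \<in> M \<rightarrow>\<^sub>M m k"
  using F_to_M[OF Y_F[OF order_refl]] .

lemma id_F: "(\<lambda>\<omega>. \<omega>) \<in> M \<rightarrow>\<^sub>M F k"
  using subalg[of k] by (auto simp: measurable_def subalgebra_def)

lemma space_F [simp]: "space (F k) = space M"
  using subalg[of k] by (auto simp: subalgebra_def)

lemma prob_m: "prob_space (m k)"
  using prob_space_distr[OF Y_meas, of k] by (simp add: law_Y)

lemma sigma_finite_m: "sigma_finite_measure (m k)"
  by (rule prob_space_imp_sigma_finite[OF prob_m])

lemma space_Y: "\<omega> \<in> space M \<Longrightarrow> Y k \<omega> \<in> space (m k)"
  using measurable_space[OF Y_meas] .

lemma measure_m [simp]: "measure (m k) (space (m k)) = 1"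
  using prob_m by (rule prob_space.prob_space)

lemma integrable_m:
  fixes f :: "_ \<Rightarrow> 'b::{banach, second_countable_topology}"
  assumes "f \<in> borel_measurable (m k)" "\<And>y. y \<in> space (m k) \<Longrightarrow> norm (f y) \<le> C"
  shows "integrable (m k) f"
proof -
  interpret mk: prob_space "m k" by (rule prob_m)
  show ?thesis using assms by (intro mk.integrable_const_bound[of _ C] AE_I2) auto
qed

lemma integrable_q: "x \<in> space (m k) \<Longrightarrow> integrable (m (Suc k)) (\<lambda>y. q k (x, y))"
  using q_nonneg q_le by (intro integrable_m[of _ _ "1 / e"]) auto

lemma integrable_q_scaleR:
  fixes h :: "_ \<Rightarrow> 'b::{banach, second_countable_topology}"
  assumes x: "x \<in> space (m k)" and [measurable]: "h \<in> borel_measurable (m (Suc k))"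
    and b: "\<And>y. y \<in> space (m (Suc k)) \<Longrightarrow> norm (h y) \<le> C"
  shows "integrable (m (Suc k)) (\<lambda>y. q k (x, y) *\<^sub>R h y)"
proof (rule integrable_m[of _ _ "1 / e * C"])
  show "(\<lambda>y. q k (x, y) *\<^sub>R h y) \<in> borel_measurable (m (Suc k))"
    using x by measurable
  fix y assume y: "y \<in> space (m (Suc k))"
  then show "norm (q k (x, y) *\<^sub>R h y) \<le> 1 / e * C"
    using x q_nonneg[OF x y] q_le[OF x y] b[OF y] e by (simp only: norm_scaleR, intro mult_mono) auto
qed

text \<open>The transition operator, applied to functions of an edge \<open>(x, y)\<close> rather
  than of its end point. The value type is general because both real moments and complex phases are
  averaged.\<close>

definition avg :: "nat \<Rightarrow> ('a \<times> 'a \<Rightarrow> 'b::{banach, second_countable_topology}) \<Rightarrow> 'a \<Rightarrow> 'b" where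
  "avg k h x = (\<integral>y. q k (x, y) *\<^sub>R h (x, y) \<partial>m (Suc k))"

lemma avg_measurable [measurable]:
  assumes [measurable]: "h \<in> borel_measurable (mm k)"
  shows "avg k h \<in> borel_measurable (m k)"
proof -
  interpret mk: sigma_finite_measure "m (Suc k)" by (rule sigma_finite_m)
  show ?thesis unfolding avg_def by measurable
qed

lemma avg_bound:
  fixes h :: "_ \<Rightarrow> 'b::{banach, second_countable_topology}"
  assumes [measurable]: "h \<in> borel_measurable (mm k)"
    and x: "x \<in> space (m k)"
    and b: "\<And>y. y \<in> space (m (Suc k)) \<Longrightarrow> norm (h (x, y)) \<le> C"
  shows "norm (avg k h x) \<le> C"
proof -
  have [measurable]: "(\<lambda>y. h (x, y)) \<in> borel_measurable (m (Suc k))" using x by measurable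
  have "norm (avg k h x) \<le> (\<integral>y. norm (q k (x, y) *\<^sub>R h (x, y)) \<partial>m (Suc k))"
    unfolding avg_def by (rule integral_norm_bound)
  also have "\<dots> \<le> (\<integral>y. q k (x, y) * C \<partial>m (Suc k))"
  proof (rule integral_mono)
    show "integrable (m (Suc k)) (\<lambda>y. norm (q k (x, y) *\<^sub>R h (x, y)))"
      by (intro integrable_norm integrable_q_scaleR[OF x _ b]) auto
    show "integrable (m (Suc k)) (\<lambda>y. q k (x, y) * C)"
      using integrable_q[OF x] by simp
    fix y assume y: "y \<in> space (m (Suc k))"
    show "norm (q k (x, y) *\<^sub>R h (x, y)) \<le> q k (x, y) * C"
      using q_nonneg[OF x y] b[OF y] by (simp add: mult_left_mono)
  qed
  also have "\<dots> = C" using q_total[OF x] by simp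
  finally show ?thesis .
qed

text \<open>The past is kept as the whole sample point together with the sigma-algebra
  \<open>F k\<close>, so that quantities depending on it need not be written as functions of a path.
  Both measures agree on rectangles by \<open>markov_set\<close>, and the rectangles form an
  intersection-stable generator.\<close>

lemma markov_law:
  "distr M (F k \<Otimes>\<^sub>M m (Suc k)) (\<lambda>\<omega>. (\<omega>, Y (Suc k) \<omega>)) =
   density (distr M (F k) (\<lambda>\<omega>. \<omega>) \<Otimes>\<^sub>M m (Suc k)) (\<lambda>(\<omega>, y). ennreal (q k (Y k \<omega>, y)))"
  (is "?L = density (?P \<Otimes>\<^sub>M _) ?g")
proof -
  interpret m: prob_space "m (Suc k)" by (rule prob_m)
  note Y_F[OF order_refl, of k, measurable]
  have pair [measurable]: "(\<lambda>\<omega>. (\<omega>, Y (Suc k) \<omega>)) \<in> M \<rightarrow>\<^sub>M F k \<Otimes>\<^sub>M m (Suc k)"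
    by (rule measurable_Pair[OF id_F Y_meas])
  have g [measurable]: "?g \<in> borel_measurable (?P \<Otimes>\<^sub>M m (Suc k))" by measurable
  let ?E = "{A \<times> E | A E. A \<in> sets (F k) \<and> E \<in> sets (m (Suc k))}"
  let ?\<Omega> = "space M \<times> space (m (Suc k))"
  interpret L: prob_space ?L by (rule prob_space_distr[OF pair])
  show ?thesis
  proof (rule measure_eqI_generator_eq[where E = ?E and \<Omega> = ?\<Omega> and A = "\<lambda>_. ?\<Omega>"])
    show "Int_stable ?E" by (rule Int_stable_pair_measure_generator)
    show "?E \<subseteq> Pow ?\<Omega>" using sets.space_closed[of "F k"] sets.space_closed[of "m (Suc k)"] by auto
    show "sets ?L = sigma_sets ?\<Omega> ?E" by (simp add: sets_pair_measure)
    show "sets (density (?P \<Otimes>\<^sub>M m (Suc k)) ?g) = sigma_sets ?\<Omega> ?E" by (simp add: sets_pair_measure)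
    have "space M \<in> sets (F k)" using sets.top[of "F k"] by simp
    then show "range (\<lambda>_::nat. ?\<Omega>) \<subseteq> ?E"
      by (intro image_subsetI CollectI exI conjI) (rule refl | assumption | rule sets.top)+
    show "(\<Union>i::nat. ?\<Omega>) = ?\<Omega>" by simp
    show "emeasure ?L ?\<Omega> \<noteq> \<infinity>" for i :: nat using L.emeasure_finite by simp
  next
    fix Z assume "Z \<in> ?E"
    then obtain A E where Z: "Z = A \<times> E" and A [measurable]: "A \<in> sets (F k)"
      and E [measurable]: "E \<in> sets (m (Suc k))" by (elim CollectE exE conjE)
    have "(\<lambda>z. ?g z * indicator E (snd z)) \<in> borel_measurable (F k \<Otimes>\<^sub>M m (Suc k))"
      by measurable
    from m.borel_measurable_nn_integral_fst[OF this]
    have inner: "(\<lambda>\<omega>. \<integral>\<^sup>+y. ennreal (q k (Y k \<omega>, y)) * indicator E y \<partial>m (Suc k)) \<in> borel_measurable (F k)"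
      by simp
    have ZL: "Z \<in> sets (F k \<Otimes>\<^sub>M m (Suc k))" unfolding Z using A E by (rule pair_measureI)
    have "(\<lambda>\<omega>. (\<omega>, Y (Suc k) \<omega>)) -` Z \<inter> space M = A \<inter> (Y (Suc k) -` E \<inter> space M)"
      unfolding Z by blast
    then have "emeasure ?L Z = emeasure M (A \<inter> (Y (Suc k) -` E \<inter> space M))"
      using emeasure_distr[OF pair ZL] by simp
    also have "\<dots> = (\<integral>\<^sup>+\<omega>. (\<integral>\<^sup>+y. ennreal (q k (Y k \<omega>, y)) * indicator E y \<partial>m (Suc k)) * indicator A \<omega> \<partial>M)"
      by (rule markov_set[OF A E])
    also have "\<dots> = (\<integral>\<^sup>+\<omega>. (\<integral>\<^sup>+y. ennreal (q k (Y k \<omega>, y)) * indicator E y \<partial>m (Suc k)) * indicator A \<omega> \<partial>?P)"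
    proof -
      have "(\<lambda>\<omega>. (\<integral>\<^sup>+y. ennreal (q k (Y k \<omega>, y)) * indicator E y \<partial>m (Suc k)) * indicator A \<omega>)
          \<in> borel_measurable ?P"
        using borel_measurable_times_ennreal[OF inner borel_measurable_indicator[OF A]]
        by (simp only: measurable_distr_eq1)
      from nn_integral_distr[OF id_F this] show ?thesis by simp
    qed
    also have "\<dots> = (\<integral>\<^sup>+\<omega>. (\<integral>\<^sup>+y. ?g (\<omega>, y) * indicator Z (\<omega>, y) \<partial>m (Suc k)) \<partial>?P)"
    proof (rule nn_integral_cong)
      fix \<omega>
      show "(\<integral>\<^sup>+y. ennreal (q k (Y k \<omega>, y)) * indicator E y \<partial>m (Suc k)) * indicator A \<omega> =
          (\<integral>\<^sup>+y. ?g (\<omega>, y) * indicator Z (\<omega>, y) \<partial>m (Suc k))"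
        unfolding Z by (cases "\<omega> \<in> A") (simp_all add: indicator_times)
    qed
    also have "\<dots> = (\<integral>\<^sup>+z. ?g z * indicator Z z \<partial>(?P \<Otimes>\<^sub>M m (Suc k)))"
      using ZL by (intro m.nn_integral_fst borel_measurable_times_ennreal g borel_measurable_indicator)
        (simp add: sets_pair_measure)
    also have "\<dots> = emeasure (density (?P \<Otimes>\<^sub>M m (Suc k)) ?g) Z"
      using ZL by (intro emeasure_density[symmetric] g) (simp add: sets_pair_measure)
    finally show "emeasure ?L Z = emeasure (density (?P \<Otimes>\<^sub>M m (Suc k)) ?g) Z" .
  qed
qed

lemma markov_integral:
  fixes \<Phi> :: "'w \<times> 'a \<Rightarrow> 'b::{banach, second_countable_topology}"
  assumes \<Phi> [measurable]: "\<Phi> \<in> borel_measurable (F k \<Otimes>\<^sub>M m (Suc k))"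
    and b: "\<And>\<omega> y. \<omega> \<in> space M \<Longrightarrow> y \<in> space (m (Suc k)) \<Longrightarrow> norm (\<Phi> (\<omega>, y)) \<le> C"
  shows "(\<integral>\<omega>. \<Phi> (\<omega>, Y (Suc k) \<omega>) \<partial>M) =
    (\<integral>\<omega>. (\<integral>y. q k (Y k \<omega>, y) *\<^sub>R \<Phi> (\<omega>, y) \<partial>m (Suc k)) \<partial>M)"
proof -
  note Y_F[OF order_refl, of k, measurable]
  have pair [measurable]: "(\<lambda>\<omega>. (\<omega>, Y (Suc k) \<omega>)) \<in> M \<rightarrow>\<^sub>M F k \<Otimes>\<^sub>M m (Suc k)"
    by (rule measurable_Pair[OF id_F Y_meas])
  interpret m: prob_space "m (Suc k)" by (rule prob_m)
  let ?P = "distr M (F k) (\<lambda>\<omega>. \<omega>)"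
  interpret P: prob_space ?P by (rule prob_space_distr[OF id_F])
  interpret Pm: pair_prob_space ?P "m (Suc k)" ..
  have "(\<integral>\<omega>. \<Phi> (\<omega>, Y (Suc k) \<omega>) \<partial>M) = (\<integral>z. \<Phi> z \<partial>distr M (F k \<Otimes>\<^sub>M m (Suc k)) (\<lambda>\<omega>. (\<omega>, Y (Suc k) \<omega>)))"
    by (subst integral_distr[OF pair]) auto
  also have "\<dots> = (\<integral>z. \<Phi> z \<partial>density (?P \<Otimes>\<^sub>M m (Suc k)) (\<lambda>z. ennreal (q k (Y k (fst z), snd z))))"
    unfolding markov_law by (simp add: case_prod_unfold)
  also have "\<dots> = (\<integral>z. q k (Y k (fst z), snd z) *\<^sub>R \<Phi> z \<partial>(?P \<Otimes>\<^sub>M m (Suc k)))"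
    using space_Y q_nonneg by (subst integral_density) (auto simp: space_pair_measure intro!: AE_I2)
  also have "\<dots> = (\<integral>\<omega>. (\<integral>y. q k (Y k \<omega>, y) *\<^sub>R \<Phi> (\<omega>, y) \<partial>m (Suc k)) \<partial>?P)"
  proof -
    have "integrable (?P \<Otimes>\<^sub>M m (Suc k)) (\<lambda>z. q k (Y k (fst z), snd z) *\<^sub>R \<Phi> z)"
    proof (rule Pm.P.integrable_const_bound[of _ "1 / e * C"])
      show "AE z in ?P \<Otimes>\<^sub>M m (Suc k). norm (q k (Y k (fst z), snd z) *\<^sub>R \<Phi> z) \<le> 1 / e * C"
      proof (rule AE_I2)
        fix z assume z: "z \<in> space (?P \<Otimes>\<^sub>M m (Suc k))"
        then have *: "Y k (fst z) \<in> space (m k)" "snd z \<in> space (m (Suc k))" "fst z \<in> space M"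
          by (auto simp: space_pair_measure space_Y)
        show "norm (q k (Y k (fst z), snd z) *\<^sub>R \<Phi> z) \<le> 1 / e * C"
          unfolding norm_scaleR using q_nonneg[OF *(1,2)] q_le[OF *(1,2)] b[OF *(3,2)] e
          by (intro mult_mono) auto
      qed
    qed measurable
    from Pm.integral_fst'[OF this] show ?thesis by simp
  qed
  also have "\<dots> = (\<integral>\<omega>. (\<integral>y. q k (Y k \<omega>, y) *\<^sub>R \<Phi> (\<omega>, y) \<partial>m (Suc k)) \<partial>M)"
    by (rule integral_distr[OF id_F]) measurable
  finally show ?thesis .
qed

text \<open>Conditioning in the form used later: a factor known at time \<open>k\<close> stays in
  place while the next step is replaced by its average.\<close>

lemma markov_avg:
  fixes g :: "'w \<Rightarrow> 'b::{real_normed_field, banach, second_countable_topology}"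
  assumes g [measurable]: "g \<in> borel_measurable (F k)" and gC: "\<And>\<omega>. \<omega> \<in> space M \<Longrightarrow> norm (g \<omega>) \<le> C"
    and h [measurable]: "h \<in> borel_measurable (mm k)"
    and hD: "\<And>x y. x \<in> space (m k) \<Longrightarrow> y \<in> space (m (Suc k)) \<Longrightarrow> norm (h (x, y)) \<le> D"
  shows "(\<integral>\<omega>. g \<omega> * h (YY k \<omega>) \<partial>M) = (\<integral>\<omega>. g \<omega> * avg k h (Y k \<omega>) \<partial>M)"
proof -
  note Y_F[OF order_refl, of k, measurable]
  have "(\<integral>\<omega>. g \<omega> * h (YY k \<omega>) \<partial>M) =
     (\<integral>\<omega>. (\<integral>y. q k (Y k \<omega>, y) *\<^sub>R (g \<omega> * h (Y k \<omega>, y)) \<partial>m (Suc k)) \<partial>M)"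
  proof (rule markov_integral[of "\<lambda>z. g (fst z) * h (Y k (fst z), snd z)" k "C * D", simplified fst_conv snd_conv])
    show "(\<lambda>z. g (fst z) * h (Y k (fst z), snd z)) \<in> borel_measurable (F k \<Otimes>\<^sub>M m (Suc k))"
      by measurable
    fix \<omega> y assume "\<omega> \<in> space M" "y \<in> space (m (Suc k))"
    then show "norm (g \<omega> * h (Y k \<omega>, y)) \<le> C * D"
      unfolding norm_mult using gC[of \<omega>] hD[of "Y k \<omega>" y] space_Y[of \<omega> k]
      by (intro mult_mono) (auto intro: order_trans[OF norm_ge_zero])
  qed
  also have "\<dots> = (\<integral>\<omega>. g \<omega> * avg k h (Y k \<omega>) \<partial>M)"
    by (simp add: avg_def flip: mult_scaleR_right)
  finally show ?thesis .
qed

lemma integral_Y: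
  fixes u :: "'a \<Rightarrow> 'b::{banach, second_countable_topology}"
  assumes [measurable]: "u \<in> borel_measurable (m k)"
  shows "(\<integral>\<omega>. u (Y k \<omega>) \<partial>M) = (\<integral>x. u x \<partial>m k)"
  using integral_distr[OF Y_meas[of k], of u] by (simp add: law_Y)

lemma expectation_avg:
  fixes h :: "'a \<times> 'a \<Rightarrow> 'b::{real_normed_field, banach, second_countable_topology}"
  assumes h [measurable]: "h \<in> borel_measurable (mm k)"
    and hD: "\<And>x y. x \<in> space (m k) \<Longrightarrow> y \<in> space (m (Suc k)) \<Longrightarrow> norm (h (x, y)) \<le> D"
  shows "(\<integral>\<omega>. h (YY k \<omega>) \<partial>M) = (\<integral>x. avg k h x \<partial>m k)"
  using markov_avg[of "\<lambda>_. 1" k 1 h D] assms by (simp add: integral_Y)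

section \<open>Variance of additive functionals\<close>

lemma integrable_bounded:
  fixes f :: "_ \<Rightarrow> 'b::{banach, second_countable_topology}"
  assumes "f \<in> borel_measurable M" "\<And>\<omega>. \<omega> \<in> space M \<Longrightarrow> norm (f \<omega>) \<le> C"
  shows "integrable M f"
  using assms by (intro integrable_const_bound[of _ C] AE_I2) auto

lemma avg_cong:
  assumes "\<And>y. y \<in> space (m (Suc k)) \<Longrightarrow> h (x, y) = h' (x, y)"
  shows "avg k h x = avg k h' x"
  unfolding avg_def using assms by (intro Bochner_Integration.integral_cong) auto

lemma avg_add:
  fixes h h' :: "_ \<Rightarrow> 'b::{banach, second_countable_topology}"
  assumes [measurable]: "h \<in> borel_measurable (mm k)" "h' \<in> borel_measurable (mm k)"
    and x [measurable]: "x \<in> space (m k)"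
    and b: "\<And>y. y \<in> space (m (Suc k)) \<Longrightarrow> norm (h (x, y)) \<le> C"
      "\<And>y. y \<in> space (m (Suc k)) \<Longrightarrow> norm (h' (x, y)) \<le> D"
  shows "avg k (\<lambda>z. h z + h' z) x = avg k h x + avg k h' x"
  unfolding avg_def scaleR_add_right
  by (rule Bochner_Integration.integral_add; rule integrable_q_scaleR[OF x]) (use b in auto)

lemma avg_square_le:
  fixes h :: "_ \<Rightarrow> real"
  assumes [measurable]: "h \<in> borel_measurable (mm k)"
    and x [measurable]: "x \<in> space (m k)"
    and b: "\<And>y. y \<in> space (m (Suc k)) \<Longrightarrow> \<bar>h (x, y)\<bar> \<le> C"
  shows "(avg k h x)\<^sup>2 \<le> avg k (\<lambda>z. (h z)\<^sup>2) x"
proof -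
  have b2: "norm ((h (x, y))\<^sup>2) \<le> C\<^sup>2" if "y \<in> space (m (Suc k))" for y
    using power_mono[OF b[OF that], of 2] by simp
  have "(\<integral>y. q k (x, y) * h (x, y) \<partial>m (Suc k))\<^sup>2
      \<le> (\<integral>y. q k (x, y) \<partial>m (Suc k)) * (\<integral>y. q k (x, y) * (h (x, y))\<^sup>2 \<partial>m (Suc k))"
    by (rule square_integral_weighted_le)
       (use integrable_q[OF x] integrable_q_scaleR[OF x _ b2] integrable_q_scaleR[OF x, of "\<lambda>y. h (x, y)" C] b
          q_nonneg[OF x] q_total[OF x] in auto)
  then show ?thesis by (simp add: avg_def q_total[OF x])
qed

lemma integral_avg_snd:
  fixes u :: "'a \<Rightarrow> 'b::{real_normed_field, banach, second_countable_topology}"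
  assumes [measurable]: "u \<in> borel_measurable (m (Suc k))"
    and "\<And>y. y \<in> space (m (Suc k)) \<Longrightarrow> norm (u y) \<le> D"
  shows "(\<integral>x. avg k (\<lambda>z. u (snd z)) x \<partial>m k) = (\<integral>y. u y \<partial>m (Suc k))"
  using expectation_avg[of "\<lambda>z. u (snd z)" k D] assms by (simp add: integral_Y)

text \<open>The two-step transition density, which is also the normalizing constant of the
  bridge.\<close>

definition step2 :: "nat \<Rightarrow> 'a \<Rightarrow> 'a \<Rightarrow> real" where
  "step2 k x z = (\<integral>y. q k (x, y) * q (Suc k) (y, z) \<partial>m (Suc k))"

lemma step2_measurable [measurable]:
  "(\<lambda>z. step2 k (fst z) (snd z)) \<in> borel_measurable (m k \<Otimes>\<^sub>M m (Suc (Suc k)))"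
proof -
  interpret mk: sigma_finite_measure "m (Suc k)" by (rule sigma_finite_m)
  show ?thesis unfolding step2_def by measurable
qed

lemma step2_gt: "x \<in> space (m k) \<Longrightarrow> z \<in> space (m (Suc (Suc k))) \<Longrightarrow> e < step2 k x z"
  unfolding step2_def by (rule two_step)

lemma step2_le:
  assumes x: "x \<in> space (m k)" and z: "z \<in> space (m (Suc (Suc k)))"
  shows "step2 k x z \<le> 1 / e"
proof -
  have "norm (avg k (\<lambda>t. q (Suc k) (snd t, z)) x) \<le> 1 / e"
    using x z q_nonneg[OF _ z] q_le[OF _ z] by (intro avg_bound) auto
  then show ?thesis by (simp add: avg_def step2_def)
qed

lemma avg_avg_snd:
  fixes u :: "'a \<Rightarrow> real"
  assumes x [measurable]: "x \<in> space (m k)" and [measurable]: "u \<in> borel_measurable (m (Suc (Suc k)))"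
    and b: "\<And>z. z \<in> space (m (Suc (Suc k))) \<Longrightarrow> \<bar>u z\<bar> \<le> C"
  shows "avg k (\<lambda>t. avg (Suc k) (\<lambda>t. u (snd t)) (snd t)) x = (\<integral>z. step2 k x z * u z \<partial>m (Suc (Suc k)))"
proof -
  interpret m1: prob_space "m (Suc k)" by (rule prob_m)
  interpret m2: prob_space "m (Suc (Suc k))" by (rule prob_m)
  interpret p: pair_prob_space "m (Suc k)" "m (Suc (Suc k))" ..
  let ?f = "\<lambda>t. q k (x, fst t) * (q (Suc k) t * u (snd t))"
  have int: "integrable (mm (Suc k)) (case_prod (\<lambda>y z. ?f (y, z)))"
  proof (rule p.P.integrable_const_bound[of _ "1 / e * (1 / e * C)"])
    show "AE t in m (Suc k) \<Otimes>\<^sub>M m (Suc (Suc k)). norm (case_prod (\<lambda>y z. ?f (y, z)) t) \<le> 1 / e * (1 / e * C)"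
    proof (rule AE_I2)
      fix t assume "t \<in> space (mm (Suc k))"
      then obtain y z where t: "t = (y, z)" and y: "y \<in> space (m (Suc k))" and z: "z \<in> space (m (Suc (Suc k)))"
        by (auto simp: space_pair_measure)
      show "norm (case_prod (\<lambda>y z. ?f (y, z)) t) \<le> 1 / e * (1 / e * C)"
        unfolding t prod.case fst_conv snd_conv real_norm_def abs_mult
        using q_nonneg[OF x y] q_le[OF x y] q_nonneg[OF y z] q_le[OF y z] b[OF z] e
        by (intro mult_mono) auto
    qed
  qed measurable
  have "avg k (\<lambda>t. avg (Suc k) (\<lambda>t. u (snd t)) (snd t)) x =
     (\<integral>y. (\<integral>z. ?f (y, z) \<partial>m (Suc (Suc k))) \<partial>m (Suc k))"
    by (simp add: avg_def)
  also have "\<dots> = (\<integral>z. (\<integral>y. ?f (y, z) \<partial>m (Suc k)) \<partial>m (Suc (Suc k)))"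
    by (rule p.Fubini_integral[OF int, symmetric])
  also have "\<dots> = (\<integral>z. step2 k x z * u z \<partial>m (Suc (Suc k)))"
    by (simp add: step2_def flip: mult.assoc)
  finally show ?thesis .
qed

text \<open>The two-step density is the constant \<open>e\<close> plus a nonnegative remainder of
  mass \<open>1 - e\<close>. The constant part annihilates \<open>u\<close>, which has mean zero, so
  Cauchy-Schwarz is needed for the remainder only. Integrating over the starting point preserves the
  second moment of \<open>u\<close>, because the chain carries the law \<open>m k\<close> to the
  later laws.\<close>

lemma two_step_contraction:
  fixes \<alpha> u :: "'a \<Rightarrow> real"
  assumes [measurable]: "\<alpha> \<in> borel_measurable (m k)" "u \<in> borel_measurable (m (Suc (Suc k)))"
    and \<alpha>C: "\<And>x. x \<in> space (m k) \<Longrightarrow> \<bar>\<alpha> x\<bar> \<le> C"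
    and uD: "\<And>z. z \<in> space (m (Suc (Suc k))) \<Longrightarrow> \<bar>u z\<bar> \<le> D"
    and u0: "(\<integral>z. u z \<partial>m (Suc (Suc k))) = 0"
  defines "PP \<equiv> (\<lambda>u. avg k (\<lambda>t. avg (Suc k) (\<lambda>t. u (snd t)) (snd t)))"
  shows "(\<integral>x. (\<alpha> x + PP u x)\<^sup>2 \<partial>m k) \<le> (\<integral>x. (\<alpha> x)\<^sup>2 \<partial>m k) / e + (1 - e) * (\<integral>z. (u z)\<^sup>2 \<partial>m (Suc (Suc k)))"
proof -
  let ?m = "m (Suc (Suc k))"
  have PP_meas [measurable]: "PP v \<in> borel_measurable (m k)" if [measurable]: "v \<in> borel_measurable ?m"
    for v :: "'a \<Rightarrow> real"
    unfolding PP_def by measurable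
  have PP_bound: "\<bar>PP v x\<bar> \<le> B" if [measurable]: "v \<in> borel_measurable ?m" and x: "x \<in> space (m k)"
    and B: "\<And>z. z \<in> space ?m \<Longrightarrow> \<bar>v z\<bar> \<le> B" for v :: "'a \<Rightarrow> real" and B x
    unfolding PP_def using x B
    by (simp only: flip: real_norm_def) (intro avg_bound; measurable; simp)
  have u2: "\<bar>(u z)\<^sup>2\<bar> \<le> D\<^sup>2" if "z \<in> space ?m" for z
    using power_mono[OF uD[OF that], of 2] by simp
  have PP_eq: "PP v x = (\<integral>z. step2 k x z * v z \<partial>?m)" if "v \<in> borel_measurable ?m" "x \<in> space (m k)"
    "\<And>z. z \<in> space ?m \<Longrightarrow> \<bar>v z\<bar> \<le> B" for v :: "'a \<Rightarrow> real" and B x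
    unfolding PP_def using that by (intro avg_avg_snd)
  have pw: "(\<alpha> x + PP u x)\<^sup>2 \<le> (\<alpha> x)\<^sup>2 / e + (PP (\<lambda>z. (u z)\<^sup>2) x - e * (\<integral>z. (u z)\<^sup>2 \<partial>?m))"
    if x [measurable]: "x \<in> space (m k)" for x
  proof -
    let ?R = "\<lambda>z. step2 k x z - e"
    have st [measurable]: "(\<lambda>z. step2 k x z) \<in> borel_measurable ?m"
      using measurable_compose[OF measurable_Pair1'[OF x] step2_measurable] by simp
    have bi: "integrable ?m (\<lambda>z. step2 k x z * v z)" if [measurable]: "v \<in> borel_measurable ?m"
      and B: "\<And>z. z \<in> space ?m \<Longrightarrow> \<bar>v z\<bar> \<le> B" for v :: "'a \<Rightarrow> real" and B
    proof (rule integrable_m[of _ _ "1 / e * B"])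
      show "norm (step2 k x z * v z) \<le> 1 / e * B" if "z \<in> space ?m" for z
        unfolding real_norm_def abs_mult using step2_gt[OF x that] step2_le[OF x that] B[OF that] e
        by (intro mult_mono) auto
    qed measurable
    have i: "integrable ?m v" if [measurable]: "v \<in> borel_measurable ?m"
      and B: "\<And>z. z \<in> space ?m \<Longrightarrow> \<bar>v z\<bar> \<le> B" for v :: "'a \<Rightarrow> real" and B
      using integrable_m[OF that(1), of B] B by auto
    have bi1: "integrable ?m (\<lambda>z. step2 k x z)" using bi[of "\<lambda>_. 1" 1] by simp
    have i1: "integrable ?m (\<lambda>z. e)" by (rule integrable_m[of _ _ e]) (use e in auto)
    have I1: "(\<integral>z. ?R z \<partial>?m) = 1 - e"
    proof -
      have "(\<integral>z. step2 k x z \<partial>?m) = PP (\<lambda>_. 1) x" using PP_eq[of "\<lambda>_. 1" x 1] x by simp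
      also have "\<dots> = avg k (\<lambda>_. 1) x" unfolding PP_def
        by (rule avg_cong) (simp add: avg_def q_total)
      also have "\<dots> = 1" using q_total[OF x] by (simp add: avg_def)
      finally show ?thesis using i1 bi1 by simp
    qed
    have I: "(\<integral>z. ?R z * v z \<partial>?m) = PP v x - e * (\<integral>z. v z \<partial>?m)" "integrable ?m (\<lambda>z. ?R z * v z)"
      if [measurable]: "v \<in> borel_measurable ?m"
      and B: "\<And>z. z \<in> space ?m \<Longrightarrow> \<bar>v z\<bar> \<le> B" for v :: "'a \<Rightarrow> real" and B
      using bi[of v, OF that] i[of v, OF that] PP_eq[of v x, OF that(1) x B] by (simp_all add: left_diff_distrib)
    have "(PP u x)\<^sup>2 = (\<integral>z. ?R z * u z \<partial>?m)\<^sup>2" using I(1)[of u D] uD u0 by simp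
    also have "\<dots> \<le> (\<integral>z. ?R z \<partial>?m) * (\<integral>z. ?R z * (u z)\<^sup>2 \<partial>?m)"
      using I(2)[of u D] I(2)[of "\<lambda>z. (u z)\<^sup>2" "D\<^sup>2"] uD u2 I1 e bi1 i1 step2_gt[OF x]
      by (intro square_integral_weighted_le) (auto simp: less_imp_le)
    also have "\<dots> = (1 - e) * (PP (\<lambda>z. (u z)\<^sup>2) x - e * (\<integral>z. (u z)\<^sup>2 \<partial>?m))"
      using I1 I(1)[of "\<lambda>z. (u z)\<^sup>2" "D\<^sup>2"] u2 by simp
    finally have "(PP u x)\<^sup>2 / (1 - e) \<le> PP (\<lambda>z. (u z)\<^sup>2) x - e * (\<integral>z. (u z)\<^sup>2 \<partial>?m)"
      using e by (simp add: field_simps)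
    then show ?thesis using square_add_le_convex[OF e, of "\<alpha> x" "PP u x"] by linarith
  qed
  interpret mk: prob_space "m k" by (rule prob_m)
  have ia: "integrable (m k) (\<lambda>x. (\<alpha> x)\<^sup>2)"
    using \<alpha>C power_mono[OF \<alpha>C, of _ 2] by (intro integrable_m[of _ _ "C\<^sup>2"]) auto
  have ip: "integrable (m k) (PP (\<lambda>z. (u z)\<^sup>2))"
    using PP_bound[OF _ _ u2] by (intro integrable_m[of _ _ "D\<^sup>2"]) auto
  have il: "integrable (m k) (\<lambda>x. (\<alpha> x + PP u x)\<^sup>2)"
  proof (rule integrable_m[of _ _ "(C + D)\<^sup>2"])
    fix x assume x: "x \<in> space (m k)"
    have "\<bar>\<alpha> x + PP u x\<bar> \<le> C + D" using \<alpha>C[OF x] PP_bound[OF _ x uD] by (intro abs_triangle_ineq[THEN order_trans] add_mono) auto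
    from power_mono[OF this, of 2] show "norm ((\<alpha> x + PP u x)\<^sup>2) \<le> (C + D)\<^sup>2" by simp
  qed measurable
  have "(\<integral>x. (\<alpha> x + PP u x)\<^sup>2 \<partial>m k) \<le>
     (\<integral>x. (\<alpha> x)\<^sup>2 / e + (PP (\<lambda>z. (u z)\<^sup>2) x - e * (\<integral>z. (u z)\<^sup>2 \<partial>?m)) \<partial>m k)"
    by (intro integral_mono il pw Bochner_Integration.integrable_add Bochner_Integration.integrable_diff
        integrable_divide ia ip mk.integrable_const)
  also have "\<dots> = (\<integral>x. (\<alpha> x)\<^sup>2 \<partial>m k) / e + ((\<integral>x. PP (\<lambda>z. (u z)\<^sup>2) x \<partial>m k) - e * (\<integral>z. (u z)\<^sup>2 \<partial>?m))"
    using ia ip mk.prob_space by (simp add: Bochner_Integration.integral_add Bochner_Integration.integral_diff)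
  also have "(\<integral>x. PP (\<lambda>z. (u z)\<^sup>2) x \<partial>m k) = (\<integral>y. avg (Suc k) (\<lambda>t. (u (snd t))\<^sup>2) y \<partial>m (Suc k))"
    unfolding PP_def using u2 by (intro integral_avg_snd[of _ _ "D\<^sup>2"]) (measurable, intro avg_bound, auto)
  also have "\<dots> = (\<integral>z. (u z)\<^sup>2 \<partial>?m)"
    using u2 by (intro integral_avg_snd[of "\<lambda>z. (u z)\<^sup>2" _ "D\<^sup>2"]) auto
  finally show ?thesis by (simp add: left_diff_distrib)
qed

lemma pair_meas [measurable]:
  assumes [measurable]: "h \<in> borel_measurable (mm k)"
  shows "(\<lambda>\<omega>. h (YY k \<omega>)) \<in> borel_measurable M"
  by measurable

lemma pair_meas_F:
  assumes [measurable]: "h \<in> borel_measurable (mm j)" and "j < k"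
  shows "(\<lambda>\<omega>. h (YY j \<omega>)) \<in> borel_measurable (F k)"
proof -
  have [measurable]: "Y j \<in> F k \<rightarrow>\<^sub>M m j" "Y (Suc j) \<in> F k \<rightarrow>\<^sub>M m (Suc j)"
    using \<open>j < k\<close> by (auto intro: Y_F)
  show ?thesis by measurable
qed

text \<open>
  If \<open>U\<^sub>k\<close> is the conditional expectation of the sum from time \<open>k\<close> on, then \<open>S\<^sub>k + U\<^sub>k(Y\<^sub>k)\<close> is a
  martingale, and the two-step contraction bounds \<open>\<Sum>\<parallel>U\<^sub>k\<parallel>\<^sup>2\<close> by \<open>\<Sum>\<parallel>h\<^sub>k\<parallel>\<^sup>2\<close>.
\<close>

lemma second_moment_centered_sum:
  fixes h :: "nat \<Rightarrow> 'a \<times> 'a \<Rightarrow> real"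
  assumes h_meas: "\<And>k. h k \<in> borel_measurable (mm k)"
    and hC: "\<And>k x y. x \<in> space (m k) \<Longrightarrow> y \<in> space (m (Suc k)) \<Longrightarrow> \<bar>h k (x, y)\<bar> \<le> C"
    and h0: "\<And>k. (\<integral>\<omega>. h k (YY k \<omega>) \<partial>M) = 0"
  shows "(\<integral>\<omega>. (\<Sum>k<N. h k (YY k \<omega>))\<^sup>2 \<partial>M) \<le>
    (3 + 28 / e\<^sup>2) * (\<Sum>k<N. \<integral>\<omega>. (h k (YY k \<omega>))\<^sup>2 \<partial>M)"
proof -
  \<comment> \<open>Truncation at \<open>N\<close> makes the backward recursion valid for every
    \<open>k\<close>, so that the estimates below have no boundary cases.\<close>
  define H where "H k = (if k < N then h k else (\<lambda>_. 0))" for k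
  have H_meas [measurable]: "H k \<in> borel_measurable (mm k)" for k
    unfolding H_def using h_meas by auto
  obtain \<omega>\<^sub>0 where "\<omega>\<^sub>0 \<in> space M" using not_empty by blast
  then have C0: "0 \<le> C"
    using hC[OF space_Y space_Y, of \<omega>\<^sub>0 \<omega>\<^sub>0 0] by (meson abs_ge_zero order_trans)
  have HC: "\<bar>H k (x, y)\<bar> \<le> C" if "x \<in> space (m k)" "y \<in> space (m (Suc k))" for k x y
    unfolding H_def using hC[OF that] C0 by auto
  have H0: "(\<integral>\<omega>. H k (YY k \<omega>) \<partial>M) = 0" for k
    unfolding H_def using h0 by auto
  obtain U :: "nat \<Rightarrow> 'a \<Rightarrow> real" where U_ge: "\<And>k. N \<le> k \<Longrightarrow> U k = (\<lambda>_. 0)"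
    and U_lt: "\<And>k. k < N \<Longrightarrow> U k = avg k (\<lambda>z. H k z + U (Suc k) (snd z))"
    using backward_recursion[where N = N and z = "\<lambda>_. 0" and A = "\<lambda>k v. avg k (\<lambda>z. H k z + v (snd z))"]
    by metis
  have U_eq: "U k = avg k (\<lambda>z. H k z + U (Suc k) (snd z))" for k
    using U_lt[of k] U_ge[of k] U_ge[of "Suc k"] by (cases "k < N") (auto simp: H_def avg_def)
  have "U k \<in> borel_measurable (m k) \<and> (\<exists>D\<ge>0. \<forall>x\<in>space (m k). \<bar>U k x\<bar> \<le> D) \<and> (\<integral>x. U k x \<partial>m k) = 0" for k
  proof (cases "k \<le> N")
    case True
    then show ?thesis
    proof (induction rule: inc_induct)
      case base
      show ?case using U_ge[of N] by auto
    next
      case (step k)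
      then obtain D where [measurable]: "U (Suc k) \<in> borel_measurable (m (Suc k))"
        and D: "D \<ge> 0" "\<And>x. x \<in> space (m (Suc k)) \<Longrightarrow> \<bar>U (Suc k) x\<bar> \<le> D"
        and U0: "(\<integral>x. U (Suc k) x \<partial>m (Suc k)) = 0" by blast
      have b: "norm (H k (x, y) + U (Suc k) (snd (x, y))) \<le> C + D"
        if "x \<in> space (m k)" "y \<in> space (m (Suc k))" for x y
        using HC[OF that] D(2)[OF that(2)] by simp
      have 1: "U k \<in> borel_measurable (m k)" unfolding U_eq[of k] by measurable
      have 2: "\<forall>x\<in>space (m k). \<bar>U k x\<bar> \<le> C + D" unfolding U_eq[of k]
        using b by (auto simp flip: real_norm_def intro!: avg_bound)
      have "(\<integral>x. U k x \<partial>m k) = (\<integral>\<omega>. H k (YY k \<omega>) + U (Suc k) (snd (YY k \<omega>)) \<partial>M)"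
        unfolding U_eq[of k] by (rule expectation_avg[symmetric, where D = "C + D"]) (measurable, rule b)
      also have "\<dots> = (\<integral>\<omega>. H k (YY k \<omega>) \<partial>M) + (\<integral>\<omega>. U (Suc k) (Y (Suc k) \<omega>) \<partial>M)"
        unfolding snd_conv
        by (intro Bochner_Integration.integral_add integrable_bounded[of _ C] integrable_bounded[of _ D])
           (use HC D space_Y in \<open>auto intro!: pair_meas\<close>)
      also have "\<dots> = 0" using H0 U0 by (simp add: integral_Y)
      finally show ?case using 1 2 C0 D(1) by (intro conjI exI[of _ "C + D"]) auto
    qed
  next
    case False
    then show ?thesis using U_ge[of k] by auto
  qed
  then have U_meas [measurable]: "\<And>k. U k \<in> borel_measurable (m k)"
    and "\<And>k. \<exists>D\<ge>0. \<forall>x\<in>space (m k). \<bar>U k x\<bar> \<le> D" and U0: "\<And>k. (\<integral>x. U k x \<partial>m k) = 0"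
    by blast+
  then obtain D where D0: "\<And>k. 0 \<le> D k" and UD: "\<And>k x. x \<in> space (m k) \<Longrightarrow> \<bar>U k x\<bar> \<le> D k"
    by metis
  define v where "v k = (\<integral>\<omega>. (H k (YY k \<omega>))\<^sup>2 \<partial>M)" for k
  define u where "u k = (\<integral>x. (U k x)\<^sup>2 \<partial>m k)" for k
  have v_nonneg: "0 \<le> v k" for k unfolding v_def by simp
  have u_nonneg: "0 \<le> u k" for k unfolding u_def by simp
  have u_ge: "u k = 0" if "N \<le> k" for k unfolding u_def using U_ge[OF that] by simp
  have H2: "norm ((H k (x, y))\<^sup>2) \<le> C\<^sup>2" if "x \<in> space (m k)" "y \<in> space (m (Suc k))" for k x y
    using power_mono[OF HC[OF that], of 2] by simp
  have U2: "norm ((U k x)\<^sup>2) \<le> (D k)\<^sup>2" if "x \<in> space (m k)" for k x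
    using power_mono[OF UD[OF that], of 2] by simp
  have iH2: "integrable M (\<lambda>\<omega>. (H k (YY k \<omega>))\<^sup>2)" for k
    by (rule integrable_bounded[of _ "C\<^sup>2"]) (use H2 space_Y in \<open>auto intro!: pair_meas\<close>)
  have iU2: "integrable M (\<lambda>\<omega>. (U k (Y k \<omega>))\<^sup>2)" for k
    by (rule integrable_bounded[of _ "(D k)\<^sup>2"]) (use U2 space_Y in auto)
  have u_Y: "(\<integral>\<omega>. (U k (Y k \<omega>))\<^sup>2 \<partial>M) = u k" for k
    unfolding u_def using integral_Y[of "\<lambda>x. (U k x)\<^sup>2" k] by simp

  define \<phi> where "\<phi> k = avg k (H k)" for k
  have \<phi>_meas [measurable]: "\<phi> k \<in> borel_measurable (m k)" for k unfolding \<phi>_def by measurable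
  have \<phi>C: "\<bar>\<phi> k x\<bar> \<le> C" if "x \<in> space (m k)" for k x
    unfolding \<phi>_def real_norm_def[symmetric] using that HC by (intro avg_bound) auto
  have \<phi>2: "norm ((\<phi> k x)\<^sup>2) \<le> C\<^sup>2" if "x \<in> space (m k)" for k x
    using power_mono[OF \<phi>C[OF that], of 2] by simp
  have i\<phi>2: "integrable M (\<lambda>\<omega>. (\<phi> k (Y k \<omega>))\<^sup>2)" for k
    by (rule integrable_bounded[of _ "C\<^sup>2"]) (use \<phi>2 space_Y in auto)
  have \<phi>v: "(\<integral>\<omega>. (\<phi> k (Y k \<omega>))\<^sup>2 \<partial>M) \<le> v k" for k
  proof -
    have "(\<integral>\<omega>. (\<phi> k (Y k \<omega>))\<^sup>2 \<partial>M) = (\<integral>x. (\<phi> k x)\<^sup>2 \<partial>m k)"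
      using integral_Y[of "\<lambda>x. (\<phi> k x)\<^sup>2" k] by simp
    also have "\<dots> \<le> (\<integral>x. avg k (\<lambda>z. (H k z)\<^sup>2) x \<partial>m k)"
    proof (rule integral_mono)
      show "integrable (m k) (\<lambda>x. (\<phi> k x)\<^sup>2)" by (rule integrable_m[OF _ \<phi>2]) auto
      show "integrable (m k) (avg k (\<lambda>z. (H k z)\<^sup>2))"
        by (intro integrable_m[of _ _ "C\<^sup>2"] avg_bound H2) auto
      show "(\<phi> k x)\<^sup>2 \<le> avg k (\<lambda>z. (H k z)\<^sup>2) x" if "x \<in> space (m k)" for x
        unfolding \<phi>_def using that HC by (intro avg_square_le) auto
    qed
    also have "\<dots> = v k" unfolding v_def
      using H2 by (intro expectation_avg[symmetric, of _ _ "C\<^sup>2"]) auto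
    finally show ?thesis .
  qed
  \<comment> \<open>Unrolling the recursion twice writes \<open>U k\<close> as
    \<open>\<alpha> k\<close> plus the two-step average of \<open>U (Suc (Suc k))\<close>;
    \<open>\<alpha> k\<close> collects the two summands met on the way.\<close>
  define \<alpha> where "\<alpha> k = avg k (\<lambda>z. H k z + \<phi> (Suc k) (snd z))" for k
  have \<alpha>_meas [measurable]: "\<alpha> k \<in> borel_measurable (m k)" for k unfolding \<alpha>_def by measurable
  have H\<phi>: "\<bar>H k (x, y) + \<phi> (Suc k) (snd (x, y))\<bar> \<le> 2 * C"
    if "x \<in> space (m k)" "y \<in> space (m (Suc k))" for k x y
    using HC[OF that] \<phi>C[OF that(2)] by simp
  have \<alpha>C: "\<bar>\<alpha> k x\<bar> \<le> 2 * C" if "x \<in> space (m k)" for k x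
    unfolding \<alpha>_def real_norm_def[symmetric] using that H\<phi> by (intro avg_bound) auto
  have \<alpha>v: "(\<integral>x. (\<alpha> k x)\<^sup>2 \<partial>m k) \<le> 2 * v k + 2 * v (Suc k)" for k
  proof -
    have b: "norm ((H k (x, y) + \<phi> (Suc k) (snd (x, y)))\<^sup>2) \<le> (2 * C)\<^sup>2"
      if "x \<in> space (m k)" "y \<in> space (m (Suc k))" for x y
      using power_mono[OF H\<phi>[OF that], of 2] by simp
    have "(\<integral>x. (\<alpha> k x)\<^sup>2 \<partial>m k) \<le> (\<integral>x. avg k (\<lambda>z. (H k z + \<phi> (Suc k) (snd z))\<^sup>2) x \<partial>m k)"
    proof (rule integral_mono)
      show "integrable (m k) (\<lambda>x. (\<alpha> k x)\<^sup>2)"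
        using power_mono[OF \<alpha>C, of _ k 2] by (intro integrable_m[of _ _ "(2 * C)\<^sup>2"]) auto
      show "integrable (m k) (avg k (\<lambda>z. (H k z + \<phi> (Suc k) (snd z))\<^sup>2))"
        by (intro integrable_m[of _ _ "(2 * C)\<^sup>2"] avg_bound b) auto
      show "(\<alpha> k x)\<^sup>2 \<le> avg k (\<lambda>z. (H k z + \<phi> (Suc k) (snd z))\<^sup>2) x" if "x \<in> space (m k)" for x
        unfolding \<alpha>_def using that H\<phi> by (intro avg_square_le) auto
    qed
    also have "\<dots> = (\<integral>\<omega>. (H k (YY k \<omega>) + \<phi> (Suc k) (snd (YY k \<omega>)))\<^sup>2 \<partial>M)"
      using b by (intro expectation_avg[symmetric, of "\<lambda>z. (H k z + \<phi> (Suc k) (snd z))\<^sup>2" _ "(2 * C)\<^sup>2"]) auto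
    also have "\<dots> \<le> (\<integral>\<omega>. 2 * (H k (YY k \<omega>))\<^sup>2 + 2 * (\<phi> (Suc k) (Y (Suc k) \<omega>))\<^sup>2 \<partial>M)"
    proof (rule integral_mono)
      show "integrable M (\<lambda>\<omega>. (H k (YY k \<omega>) + \<phi> (Suc k) (snd (YY k \<omega>)))\<^sup>2)"
        by (rule integrable_bounded[of _ "(2 * C)\<^sup>2"]) (measurable, use b space_Y in auto)
      show "integrable M (\<lambda>\<omega>. 2 * (H k (YY k \<omega>))\<^sup>2 + 2 * (\<phi> (Suc k) (Y (Suc k) \<omega>))\<^sup>2)"
        using iH2[of k] i\<phi>2[of "Suc k"] by simp
      show "(H k (YY k \<omega>) + \<phi> (Suc k) (snd (YY k \<omega>)))\<^sup>2 \<le>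
         2 * (H k (YY k \<omega>))\<^sup>2 + 2 * (\<phi> (Suc k) (Y (Suc k) \<omega>))\<^sup>2" for \<omega>
        using sum_squares_bound[of "H k (YY k \<omega>)" "\<phi> (Suc k) (Y (Suc k) \<omega>)"]
        by (simp add: power2_sum)
    qed
    also have "\<dots> = 2 * v k + 2 * (\<integral>\<omega>. (\<phi> (Suc k) (Y (Suc k) \<omega>))\<^sup>2 \<partial>M)"
      unfolding v_def using iH2[of k] i\<phi>2[of "Suc k"] by simp
    finally show ?thesis using \<phi>v[of "Suc k"] by simp
  qed

  \<comment> \<open>The recursion skips one index because densities are bounded below only after two
    steps. The hypothesis \<open>h0\<close> enters through the vanishing mean of \<open>U\<close>,
    which the contraction requires.\<close>
  have u_rec: "u k \<le> (2 * v k + 2 * v (Suc k)) / e + (1 - e) * u (Suc (Suc k))" for k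
  proof -
    have dec: "U k x = \<alpha> k x + avg k (\<lambda>t. avg (Suc k) (\<lambda>t. U (Suc (Suc k)) (snd t)) (snd t)) x"
      if x: "x \<in> space (m k)" for x
    proof -
      have "U k x = avg k (\<lambda>z. (H k z + \<phi> (Suc k) (snd z)) + avg (Suc k) (\<lambda>t. U (Suc (Suc k)) (snd t)) (snd z)) x"
        unfolding U_eq[of k]
      proof (rule avg_cong)
        fix y assume y: "y \<in> space (m (Suc k))"
        have "U (Suc k) y = \<phi> (Suc k) y + avg (Suc k) (\<lambda>t. U (Suc (Suc k)) (snd t)) y"
          unfolding U_eq[of "Suc k"] \<phi>_def using y HC UD by (intro avg_add) auto
        then show "H k (x, y) + U (Suc k) (snd (x, y)) =
          H k (x, y) + \<phi> (Suc k) (snd (x, y)) + avg (Suc k) (\<lambda>t. U (Suc (Suc k)) (snd t)) (snd (x, y))"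
          by simp
      qed
      also have "\<dots> = \<alpha> k x + avg k (\<lambda>t. avg (Suc k) (\<lambda>t. U (Suc (Suc k)) (snd t)) (snd t)) x"
        unfolding \<alpha>_def
      proof (rule avg_add[OF _ _ x])
        show "norm (H k (x, y) + \<phi> (Suc k) (snd (x, y))) \<le> 2 * C" if "y \<in> space (m (Suc k))" for y
          using H\<phi>[OF x that] by simp
        show "norm (avg (Suc k) (\<lambda>t. U (Suc (Suc k)) (snd t)) (snd (x, y))) \<le> D (Suc (Suc k))"
          if "y \<in> space (m (Suc k))" for y
          using UD that by (intro avg_bound) auto
      qed measurable
      finally show ?thesis .
    qed
    have "u k = (\<integral>x. (\<alpha> k x + avg k (\<lambda>t. avg (Suc k) (\<lambda>t. U (Suc (Suc k)) (snd t)) (snd t)) x)\<^sup>2 \<partial>m k)"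
      unfolding u_def by (intro Bochner_Integration.integral_cong refl) (simp add: dec)
    also have "\<dots> \<le> (\<integral>x. (\<alpha> k x)\<^sup>2 \<partial>m k) / e + (1 - e) * u (Suc (Suc k))"
      unfolding u_def using \<alpha>C UD U0 by (intro two_step_contraction) auto
    also have "(\<integral>x. (\<alpha> k x)\<^sup>2 \<partial>m k) / e \<le> (2 * v k + 2 * v (Suc k)) / e"
      using \<alpha>v[of k] e by (intro divide_right_mono) auto
    finally show ?thesis by simp
  qed
  \<comment> \<open>A shift drops the term at 0 and adds the one at \<open>N\<close>, which is
    zero.\<close>
  have shift: "(\<Sum>k<N. w (Suc k)) \<le> (\<Sum>k<N. w k)" if "\<And>k. 0 \<le> w k" "w N = 0" for w :: "nat \<Rightarrow> real"
  proof -
    have "(\<Sum>k<N. w (Suc k)) + w 0 = (\<Sum>k<N. w k) + w N"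
      using sum.lessThan_Suc_shift[of w N] sum.lessThan_Suc[of w N] by simp
    then show ?thesis using that(1)[of 0] that(2) by simp
  qed
  have vN: "v N = 0" unfolding v_def H_def by simp
  \<comment> \<open>After summation the term with the factor \<open>1 - e\<close> is absorbed on the
    left, which leaves a factor \<open>e\<close> there. Together with the division by
    \<open>e\<close> in \<open>u_rec\<close> this accounts for \<open>e\<^sup>2\<close>.\<close>
  have su: "(\<Sum>k<N. u k) \<le> 4 / e\<^sup>2 * (\<Sum>k<N. v k)"
  proof -
    have "(\<Sum>k<N. u k) \<le> (\<Sum>k<N. (2 * v k + 2 * v (Suc k)) / e + (1 - e) * u (Suc (Suc k)))"
      by (intro sum_mono u_rec)
    also have "\<dots> = (2 * (\<Sum>k<N. v k) + 2 * (\<Sum>k<N. v (Suc k))) / e + (1 - e) * (\<Sum>k<N. u (Suc (Suc k)))"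
      by (simp add: sum.distrib sum_distrib_left flip: sum_divide_distrib)
    also have "\<dots> \<le> (4 * (\<Sum>k<N. v k)) / e + (1 - e) * (\<Sum>k<N. u k)"
    proof (intro add_mono divide_right_mono mult_left_mono)
      show "2 * (\<Sum>k<N. v k) + 2 * (\<Sum>k<N. v (Suc k)) \<le> 4 * (\<Sum>k<N. v k)"
        using shift[of v, OF v_nonneg vN] by simp
      have "(\<Sum>k<N. u (Suc (Suc k))) \<le> (\<Sum>k<N. u (Suc k))"
        using shift[of "\<lambda>k. u (Suc k)"] u_nonneg u_ge by simp
      also have "\<dots> \<le> (\<Sum>k<N. u k)" using shift[of u] u_nonneg u_ge by simp
      finally show "(\<Sum>k<N. u (Suc (Suc k))) \<le> (\<Sum>k<N. u k)" .
    qed (use e in auto)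
    finally have "e * (\<Sum>k<N. u k) \<le> 4 * (\<Sum>k<N. v k) / e" by (simp add: left_diff_distrib)
    then show ?thesis using e by (simp add: field_simps power2_eq_square)
  qed

  \<comment> \<open>Martingale decomposition\<close>
  define S where "S k \<omega> = (\<Sum>j<k. H j (YY j \<omega>))" for k \<omega>
  \<comment> \<open>A martingale with increments \<open>d\<close>: since \<open>U k\<close> is the
    average of \<open>H k\<close> plus \<open>U (Suc k)\<close>, the increment has mean zero given
    the past. As \<open>U N\<close> vanishes, \<open>Z N\<close> is the sum itself.\<close>
  define Z where "Z k \<omega> = S k \<omega> + U k (Y k \<omega>)" for k \<omega>
  define d where "d k \<omega> = H k (YY k \<omega>) + U (Suc k) (Y (Suc k) \<omega>) - U k (Y k \<omega>)" for k \<omega>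
  have Z_F: "Z k \<in> borel_measurable (F k)" for k
  proof -
    note Y_F[OF order_refl, of k, measurable]
    have "S k \<in> borel_measurable (F k)" unfolding S_def
      by (intro borel_measurable_sum pair_meas_F) auto
    moreover have "(\<lambda>\<omega>. U k (Y k \<omega>)) \<in> borel_measurable (F k)" by measurable
    ultimately show ?thesis unfolding Z_def by simp
  qed
  have SC: "\<bar>S k \<omega>\<bar> \<le> real k * C" if "\<omega> \<in> space M" for k \<omega>
  proof -
    have "\<bar>S k \<omega>\<bar> \<le> (\<Sum>j<k. \<bar>H j (YY j \<omega>)\<bar>)" unfolding S_def by (rule sum_abs)
    also have "\<dots> \<le> (\<Sum>j<k. C)" using HC space_Y that by (intro sum_mono) auto
    finally show ?thesis by simp
  qed
  have ZC: "norm (Z k \<omega>) \<le> real k * C + D k" if "\<omega> \<in> space M" for k \<omega>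
    unfolding Z_def using SC[OF that, of k] UD[OF space_Y[OF that], of k] by simp
  have Z_M [measurable]: "Z k \<in> borel_measurable M" for k by (rule F_to_M[OF Z_F])
  have d_M [measurable]: "d k \<in> borel_measurable M" for k unfolding d_def by measurable
  have dC: "norm (d k \<omega>) \<le> C + D (Suc k) + D k" if "\<omega> \<in> space M" for k \<omega>
    unfolding d_def using HC[OF space_Y space_Y, OF that that, of k] UD[OF space_Y[OF that], of k]
      UD[OF space_Y[OF that], of "Suc k"] by simp
  have ZS: "Z (Suc k) \<omega> = Z k \<omega> + d k \<omega>" for k \<omega>
    unfolding Z_def d_def S_def by simp
  have bnd_sq: "norm ((f :: real)\<^sup>2) \<le> B\<^sup>2" if "norm f \<le> B" for f B
    using power_mono[OF that, of 2] by simp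
  have iZ2: "integrable M (\<lambda>\<omega>. (Z k \<omega>)\<^sup>2)" for k
    by (rule integrable_bounded[OF _ bnd_sq[OF ZC]]) auto
  have id2: "integrable M (\<lambda>\<omega>. (d k \<omega>)\<^sup>2)" for k
    by (rule integrable_bounded[OF _ bnd_sq[OF dC]]) auto
  have orth: "(\<integral>\<omega>. Z k \<omega> * d k \<omega> \<partial>M) = 0" and iZd: "integrable M (\<lambda>\<omega>. Z k \<omega> * d k \<omega>)" for k
  proof -
    have b: "norm (H k (x, y) + U (Suc k) (snd (x, y))) \<le> C + D (Suc k)"
      if "x \<in> space (m k)" "y \<in> space (m (Suc k))" for x y
      using HC[OF that] UD[OF that(2)] by simp
    have 1: "(\<integral>\<omega>. Z k \<omega> * (H k (YY k \<omega>) + U (Suc k) (snd (YY k \<omega>))) \<partial>M)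
       = (\<integral>\<omega>. Z k \<omega> * U k (Y k \<omega>) \<partial>M)"
      unfolding U_eq[of k]
      by (rule markov_avg[where h = "\<lambda>z. H k z + U (Suc k) (snd z)"], rule Z_F, erule ZC, measurable, erule b)
    have i1: "integrable M (\<lambda>\<omega>. Z k \<omega> * (H k (YY k \<omega>) + U (Suc k) (snd (YY k \<omega>))))"
    proof (rule integrable_bounded[of _ "(real k * C + D k) * (C + D (Suc k))"])
      show "norm (Z k \<omega> * (H k (YY k \<omega>) + U (Suc k) (snd (YY k \<omega>))))
         \<le> (real k * C + D k) * (C + D (Suc k))" if "\<omega> \<in> space M" for \<omega>
        unfolding norm_mult using ZC[OF that] b[OF space_Y space_Y, OF that that]
        by (intro mult_mono) (use C0 D0[of k] in auto)
    qed measurable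
    have i2: "integrable M (\<lambda>\<omega>. Z k \<omega> * U k (Y k \<omega>))"
    proof (rule integrable_bounded[of _ "(real k * C + D k) * D k"])
      show "norm (Z k \<omega> * U k (Y k \<omega>)) \<le> (real k * C + D k) * D k" if "\<omega> \<in> space M" for \<omega>
        unfolding norm_mult using ZC[OF that] UD[OF space_Y[OF that], of k]
        by (intro mult_mono) (use C0 D0[of k] in auto)
    qed measurable
    have *: "Z k \<omega> * d k \<omega> = Z k \<omega> * (H k (YY k \<omega>) + U (Suc k) (snd (YY k \<omega>)))
        - Z k \<omega> * U k (Y k \<omega>)" for \<omega>
      by (simp add: d_def algebra_simps)
    show "(\<integral>\<omega>. Z k \<omega> * d k \<omega> \<partial>M) = 0" "integrable M (\<lambda>\<omega>. Z k \<omega> * d k \<omega>)"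
      unfolding * using i1 i2 1 by (simp_all only: Bochner_Integration.integral_diff Bochner_Integration.integrable_diff)
  qed
  have d2: "(\<integral>\<omega>. (d k \<omega>)\<^sup>2 \<partial>M) \<le> 3 * (v k + u (Suc k) + u k)" for k
  proof -
    have "(\<integral>\<omega>. (d k \<omega>)\<^sup>2 \<partial>M) \<le>
      (\<integral>\<omega>. 3 * ((H k (YY k \<omega>))\<^sup>2 + (U (Suc k) (Y (Suc k) \<omega>))\<^sup>2 + (U k (Y k \<omega>))\<^sup>2) \<partial>M)"
    proof (rule integral_mono[OF id2])
      show "integrable M (\<lambda>\<omega>. 3 * ((H k (YY k \<omega>))\<^sup>2 + (U (Suc k) (Y (Suc k) \<omega>))\<^sup>2 + (U k (Y k \<omega>))\<^sup>2))"
        using iH2[of k] iU2[of k] iU2[of "Suc k"] by simp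
      fix \<omega>
      have three: "(a + b - c)\<^sup>2 \<le> 3 * (a\<^sup>2 + b\<^sup>2 + c\<^sup>2)" for a b c :: real
      proof -
        have "3 * (a\<^sup>2 + b\<^sup>2 + c\<^sup>2) - (a + b - c)\<^sup>2 = (a - b)\<^sup>2 + (a + c)\<^sup>2 + (b + c)\<^sup>2"
          by (simp add: power2_eq_square algebra_simps)
        then show ?thesis using zero_le_power2[of "a - b"] zero_le_power2[of "a + c"] zero_le_power2[of "b + c"] by linarith
      qed
      show "(d k \<omega>)\<^sup>2 \<le> 3 * ((H k (YY k \<omega>))\<^sup>2 + (U (Suc k) (Y (Suc k) \<omega>))\<^sup>2 + (U k (Y k \<omega>))\<^sup>2)"
        unfolding d_def by (rule three)
    qed
    also have "\<dots> = 3 * (v k + u (Suc k) + u k)"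
      using iH2[of k] iU2[of k] iU2[of "Suc k"] by (simp add: v_def u_Y)
    finally show ?thesis .
  qed
  have Z2: "(\<integral>\<omega>. (Z k \<omega>)\<^sup>2 \<partial>M) = u 0 + (\<Sum>j<k. \<integral>\<omega>. (d j \<omega>)\<^sup>2 \<partial>M)" for k
  proof (induction k)
    case 0
    show ?case by (simp add: Z_def S_def u_Y)
  next
    case (Suc k)
    have "(Z (Suc k) \<omega>)\<^sup>2 = (Z k \<omega>)\<^sup>2 + 2 * (Z k \<omega> * d k \<omega>) + (d k \<omega>)\<^sup>2" for \<omega>
      unfolding ZS by (simp add: power2_sum)
    then show ?case using iZ2[of k] id2[of k] iZd[of k] orth[of k] Suc by simp
  qed
  have "(\<integral>\<omega>. (\<Sum>k<N. h k (YY k \<omega>))\<^sup>2 \<partial>M) = (\<integral>\<omega>. (Z N \<omega>)\<^sup>2 \<partial>M)"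
    unfolding Z_def S_def using U_ge[of N] by (simp add: H_def)
  also have "\<dots> \<le> u 0 + (\<Sum>k<N. 3 * (v k + u (Suc k) + u k))"
    unfolding Z2 by (intro add_left_mono sum_mono d2)
  also have "\<dots> = u 0 + 3 * (\<Sum>k<N. v k) + 3 * (\<Sum>k<N. u (Suc k)) + 3 * (\<Sum>k<N. u k)"
    by (simp add: sum.distrib sum_distrib_left)
  \<comment> \<open>Here 7 is 1 + 3 + 3: one from \<open>u 0\<close> and three from each of the two
    sums of \<open>u\<close>. With the factor 4 in \<open>su\<close> it produces the constant
    28.\<close>
  also have "\<dots> \<le> 3 * (\<Sum>k<N. v k) + 7 * (\<Sum>k<N. u k)"
  proof -
    have "u 0 \<le> (\<Sum>k<N. u k)"
    proof (cases "N = 0")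
      case False
      then show ?thesis using member_le_sum[of 0 "{..<N}" u] u_nonneg by auto
    qed (use u_ge in auto)
    then show ?thesis using shift[of u] u_nonneg u_ge[of N] by simp
  qed
  also have "\<dots> \<le> 3 * (\<Sum>k<N. v k) + 7 * (4 / e\<^sup>2 * (\<Sum>k<N. v k))"
    using su by simp
  also have "\<dots> = (3 + 28 / e\<^sup>2) * (\<Sum>k<N. v k)" by (simp add: algebra_simps)
  also have "(\<Sum>k<N. v k) = (\<Sum>k<N. \<integral>\<omega>. (h k (YY k \<omega>))\<^sup>2 \<partial>M)"
    unfolding v_def H_def by simp
  finally show ?thesis .
qed

text \<open>Centering by expectations does not increase second moments, so the bound for centered
  sums applies, with \<open>c N\<close> the sum of the means. The uniform variance bound is later
  turned into tightness by Chebyshev's inequality.\<close>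

lemma tight_of_summable_second_moments:
  fixes h :: "nat \<Rightarrow> 'a \<times> 'a \<Rightarrow> real"
  assumes [measurable]: "\<And>k. h k \<in> borel_measurable (mm k)"
    and hC: "\<And>k x y. x \<in> space (m k) \<Longrightarrow> y \<in> space (m (Suc k)) \<Longrightarrow> \<bar>h k (x, y)\<bar> \<le> C"
    and sm: "summable (\<lambda>k. \<integral>\<omega>. (h k (YY k \<omega>))\<^sup>2 \<partial>M)"
  obtains c V where "\<And>N. (\<integral>\<omega>. ((\<Sum>k<N. h k (YY k \<omega>)) - c N)\<^sup>2 \<partial>M) \<le> V"
proof -
  define \<mu> where "\<mu> k = (\<integral>\<omega>. h k (YY k \<omega>) \<partial>M)" for k
  let ?X = "\<lambda>k \<omega>. h k (YY k \<omega>)"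
  have ih: "integrable M (?X k)" for k
    by (rule integrable_bounded[of _ C]) (use hC space_Y in auto)
  have ih2: "integrable M (\<lambda>\<omega>. (?X k \<omega>)\<^sup>2)" for k
  proof (rule integrable_bounded[of _ "C\<^sup>2"])
    show "norm ((?X k \<omega>)\<^sup>2) \<le> C\<^sup>2" if "\<omega> \<in> space M" for \<omega>
      using power_mono[OF hC[OF space_Y space_Y, OF that that, of k], of 2] by simp
  qed measurable
  have \<mu>C: "\<bar>\<mu> k\<bar> \<le> C" for k
  proof -
    have "\<bar>\<mu> k\<bar> \<le> (\<integral>\<omega>. \<bar>?X k \<omega>\<bar> \<partial>M)" unfolding \<mu>_def by (rule integral_abs_bound)
    also have "\<dots> \<le> (\<integral>\<omega>. C \<partial>M)" using hC space_Y ih by (intro integral_mono) auto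
    finally show ?thesis by (simp add: prob_space)
  qed
  have var: "(\<integral>\<omega>. (?X k \<omega> - \<mu> k)\<^sup>2 \<partial>M) \<le> (\<integral>\<omega>. (?X k \<omega>)\<^sup>2 \<partial>M)" for k
    using variance_eq[OF ih ih2, of k] unfolding \<mu>_def by simp
  let ?K = "3 + 28 / e\<^sup>2" and ?v = "\<lambda>k. \<integral>\<omega>. (?X k \<omega>)\<^sup>2 \<partial>M"
  have "(\<integral>\<omega>. ((\<Sum>k<N. ?X k \<omega>) - (\<Sum>k<N. \<mu> k))\<^sup>2 \<partial>M) \<le> ?K * (\<Sum>k. ?v k)" for N
  proof -
    have "(\<integral>\<omega>. (\<Sum>k<N. ?X k \<omega> - \<mu> k)\<^sup>2 \<partial>M) \<le> ?K * (\<Sum>k<N. \<integral>\<omega>. (?X k \<omega> - \<mu> k)\<^sup>2 \<partial>M)"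
    proof (rule second_moment_centered_sum[of "\<lambda>k z. h k z - \<mu> k" "2 * C"])
      show "\<bar>h k (x, y) - \<mu> k\<bar> \<le> 2 * C" if "x \<in> space (m k)" "y \<in> space (m (Suc k))" for k x y
        using hC[OF that] \<mu>C[of k] by simp
      show "(\<integral>\<omega>. ?X k \<omega> - \<mu> k \<partial>M) = 0" for k using ih[of k] by (simp add: \<mu>_def prob_space)
    qed measurable
    also have "\<dots> \<le> ?K * (\<Sum>k<N. ?v k)"
      by (intro mult_left_mono sum_mono var) simp
    also have "\<dots> \<le> ?K * (\<Sum>k. ?v k)"
      using sm by (intro mult_left_mono sum_le_suminf) auto
    finally show ?thesis by (simp add: sum_subtractf)
  qed
  then show ?thesis by (rule that)
qed

section \<open>Hexagons\<close>

definition pairs :: "nat \<Rightarrow> ('a \<times> 'a) measure" where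
  "pairs k = distr M (mm k) (\<lambda>\<omega>. (YY k \<omega>))"

lemma sets_pairs [measurable_cong, simp]: "sets (pairs k) = sets (mm k)"
  by (simp add: pairs_def)

lemma space_pairs [simp]: "space (pairs k) = space (m k) \<times> space (m (Suc k))"
  by (simp add: pairs_def space_pair_measure)

lemma prob_pairs: "prob_space (pairs k)"
  unfolding pairs_def by (rule prob_space_distr) measurable

text \<open>Disintegration of the law of an edge; it opens the hexagon law up into transition
  densities.\<close>

lemma nn_integral_pairs:
  assumes [measurable]: "g \<in> borel_measurable (mm k)"
  shows "(\<integral>\<^sup>+s. g s \<partial>pairs k) = (\<integral>\<^sup>+x. \<integral>\<^sup>+y. ennreal (q k (x, y)) * g (x, y) \<partial>m (Suc k) \<partial>m k)"
proof -
  note YF = Y_F[OF order_refl, of k]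
  note YF [measurable]
  interpret m1: prob_space "m (Suc k)" by (rule prob_m)
  let ?P = "distr M (F k) (\<lambda>\<omega>. \<omega>)"
  let ?r = "\<lambda>x. \<integral>\<^sup>+y. ennreal (q k (x, y)) * g (x, y) \<partial>m (Suc k)"
  have pair: "(\<lambda>\<omega>. (\<omega>, Y (Suc k) \<omega>)) \<in> M \<rightarrow>\<^sub>M F k \<Otimes>\<^sub>M m (Suc k)"
    by (rule measurable_Pair[OF id_F Y_meas])
  have gm: "(\<lambda>t. g (Y k (fst t), snd t)) \<in> borel_measurable (F k \<Otimes>\<^sub>M m (Suc k))"
    by measurable
  have rm: "?r \<in> borel_measurable (m k)" by measurable
  have "(\<integral>\<^sup>+s. g s \<partial>pairs k) = (\<integral>\<^sup>+\<omega>. g (YY k \<omega>) \<partial>M)"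
    unfolding pairs_def by (subst nn_integral_distr) auto
  also have "\<dots> = (\<integral>\<^sup>+t. g (Y k (fst t), snd t) \<partial>distr M (F k \<Otimes>\<^sub>M m (Suc k)) (\<lambda>\<omega>. (\<omega>, Y (Suc k) \<omega>)))"
    using gm by (subst nn_integral_distr[OF pair]) auto
  also have "\<dots> = (\<integral>\<^sup>+t. ennreal (q k (Y k (fst t), snd t)) * g (Y k (fst t), snd t) \<partial>(?P \<Otimes>\<^sub>M m (Suc k)))"
    unfolding markov_law case_prod_unfold by (subst nn_integral_density) auto
  also have "\<dots> = (\<integral>\<^sup>+\<omega>. ?r (Y k \<omega>) \<partial>?P)"
  proof -
    have "(\<lambda>t. ennreal (q k (Y k (fst t), snd t)) * g (Y k (fst t), snd t)) \<in> borel_measurable (?P \<Otimes>\<^sub>M m (Suc k))"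
      by measurable
    from m1.nn_integral_fst[OF this] show ?thesis by simp
  qed
  also have "\<dots> = (\<integral>\<^sup>+\<omega>. ?r (Y k \<omega>) \<partial>M)"
  proof -
    have "(\<lambda>\<omega>. ?r (Y k \<omega>)) \<in> borel_measurable (F k)" by (rule measurable_compose[OF YF rm])
    then have "(\<lambda>\<omega>. ?r (Y k \<omega>)) \<in> borel_measurable ?P" by (simp only: measurable_distr_eq1)
    from nn_integral_distr[OF id_F this] show ?thesis by simp
  qed
  also have "\<dots> = (\<integral>\<^sup>+x. ?r x \<partial>distr M (m k) (Y k))" by (subst nn_integral_distr) auto
  finally show ?thesis unfolding law_Y .
qed

definition bdg :: "nat \<Rightarrow> 'a \<Rightarrow> 'a \<Rightarrow> 'a measure" where
  "bdg k x z = density (m (Suc k)) (\<lambda>y. ennreal (q k (x, y) * q (Suc k) (y, z) / step2 k x z))"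

lemma sets_bdg [measurable_cong, simp]: "sets (bdg k x z) = sets (m (Suc k))"
  by (simp add: bdg_def)

lemma space_bdg [simp]: "space (bdg k x z) = space (m (Suc k))"
  by (simp add: bdg_def)

lemma step2_pos: "x \<in> space (m k) \<Longrightarrow> z \<in> space (m (Suc (Suc k))) \<Longrightarrow> 0 < step2 k x z"
  using step2_gt[of x k z] e by linarith

lemma bdg_weight_measurable:
  assumes [measurable]: "x \<in> space (m k)" "z \<in> space (m (Suc (Suc k)))"
  shows "(\<lambda>y. q k (x, y) * q (Suc k) (y, z) / step2 k x z) \<in> borel_measurable (m (Suc k))"
  by measurable

lemma bdg_weight_bounds:
  assumes x: "x \<in> space (m k)" and y: "y \<in> space (m (Suc k))" and z: "z \<in> space (m (Suc (Suc k)))"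
  shows "0 \<le> q k (x, y) * q (Suc k) (y, z) / step2 k x z"
    and "q k (x, y) * q (Suc k) (y, z) / step2 k x z \<le> 1 / e * (q k (x, y) * q (Suc k) (y, z))"
proof -
  have nn: "0 \<le> q k (x, y) * q (Suc k) (y, z)" using q_nonneg x y z by simp
  show "0 \<le> q k (x, y) * q (Suc k) (y, z) / step2 k x z"
    using nn step2_pos[OF x z] by simp
  show "q k (x, y) * q (Suc k) (y, z) / step2 k x z \<le> 1 / e * (q k (x, y) * q (Suc k) (y, z))"
    using divide_left_mono[OF less_imp_le[OF step2_gt[OF x z]] nn] step2_pos[OF x z] e by simp
qed

lemma prob_bdg:
  assumes x: "x \<in> space (m k)" and z: "z \<in> space (m (Suc (Suc k)))"
  shows "prob_space (bdg k x z)"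
proof
  let ?w = "\<lambda>y. q k (x, y) * q (Suc k) (y, z)"
  have "integrable (m (Suc k)) ?w"
  proof (rule integrable_m[of _ _ "1 / e * (1 / e)"])
    show "norm (?w y) \<le> 1 / e * (1 / e)" if "y \<in> space (m (Suc k))" for y
      unfolding norm_mult using q_nonneg[OF x that] q_le[OF x that] q_nonneg[OF that z] q_le[OF that z] e
      by (intro mult_mono) auto
  qed (use x z in measurable)
  then have i: "integrable (m (Suc k)) (\<lambda>y. ?w y / step2 k x z)" by simp
  have "emeasure (bdg k x z) (space (bdg k x z)) = (\<integral>\<^sup>+y. ennreal (?w y / step2 k x z) \<partial>m (Suc k))"
    unfolding bdg_def using bdg_weight_measurable[OF x z] by (simp add: emeasure_density cong: nn_integral_cong)
  also have "\<dots> = ennreal (\<integral>y. ?w y / step2 k x z \<partial>m (Suc k))"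
    using bdg_weight_bounds(1)[OF x _ z] by (intro nn_integral_eq_integral i AE_I2) auto
  also have "(\<integral>y. ?w y / step2 k x z \<partial>m (Suc k)) = 1"
    using step2_pos[OF x z] by (simp add: step2_def)
  finally show "emeasure (bdg k x z) (space (bdg k x z)) = 1" by simp
qed

lemma nn_integral_bdg:
  assumes x: "x \<in> space (m k)" and z: "z \<in> space (m (Suc (Suc k)))"
    and [measurable]: "g \<in> borel_measurable (m (Suc k))"
  shows "(\<integral>\<^sup>+y. g y \<partial>bdg k x z) = (\<integral>\<^sup>+y. ennreal (q k (x, y) * q (Suc k) (y, z) / step2 k x z) * g y \<partial>m (Suc k))"
  unfolding bdg_def using bdg_weight_measurable[OF x z] by (subst nn_integral_density) auto

text \<open>The normalizer \<open>step2\<close> exceeds \<open>e\<close>. Dropping it leaves bare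
  transition densities, which can be regrouped with those of the two edges of a hexagon.\<close>

lemma nn_integral_bdg_le:
  assumes x: "x \<in> space (m k)" and z: "z \<in> space (m (Suc (Suc k)))"
    and g: "g \<in> borel_measurable (m (Suc k))"
  shows "(\<integral>\<^sup>+y. g y \<partial>bdg k x z) \<le>
    (\<integral>\<^sup>+y. ennreal (1 / e) * (ennreal (q k (x, y)) * ennreal (q (Suc k) (y, z))) * g y \<partial>m (Suc k))"
  unfolding nn_integral_bdg[OF assms]
proof (intro nn_integral_mono mult_right_mono)
  fix y assume y: "y \<in> space (m (Suc k))"
  have "ennreal (q k (x, y) * q (Suc k) (y, z) / step2 k x z) \<le> ennreal (1 / e * (q k (x, y) * q (Suc k) (y, z)))"
    by (intro ennreal_leI bdg_weight_bounds x y z)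
  also have "\<dots> = ennreal (1 / e) * (ennreal (q k (x, y)) * ennreal (q (Suc k) (y, z)))"
    using q_nonneg[OF x y] q_nonneg[OF y z] e
    by (simp only: ennreal_mult mult_nonneg_nonneg zero_le_divide_1_iff less_imp_le)
  finally show "ennreal (q k (x, y) * q (Suc k) (y, z) / step2 k x z) \<le>
     ennreal (1 / e) * (ennreal (q k (x, y)) * ennreal (q (Suc k) (y, z)))" .
qed auto

definition hexagons :: "nat \<Rightarrow> 'a hexagon measure" where
  "hexagons k = m k \<Otimes>\<^sub>M m (Suc k) \<Otimes>\<^sub>M m (Suc (Suc k)) \<Otimes>\<^sub>M
     m (Suc k) \<Otimes>\<^sub>M m (Suc (Suc k)) \<Otimes>\<^sub>M m (Suc (Suc (Suc k)))"

text \<open>Expectation under the hexagon law, written as an iterated integral: \<open>s\<close> and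
  \<open>t\<close> are the two independent edges, \<open>c\<close> and \<open>b'\<close> the bridge
  points. Nonnegative integrands allow the order of integration to be changed without integrability
  conditions.\<close>

definition hexint :: "nat \<Rightarrow> ('a hexagon \<Rightarrow> ennreal) \<Rightarrow> ennreal" where
  "hexint k \<Phi> = (\<integral>\<^sup>+s. \<integral>\<^sup>+t. \<integral>\<^sup>+c. \<integral>\<^sup>+b'. \<Phi> (fst s, snd s, c, b', fst t, snd t)
      \<partial>bdg k (fst s) (fst t) \<partial>bdg (Suc k) (snd s) (snd t) \<partial>pairs (Suc (Suc k)) \<partial>pairs k)"

lemma hexint_mono:
  assumes "\<And>P. P \<in> space (hexagons k) \<Longrightarrow> \<Phi> P \<le> \<Psi> P"
  shows "hexint k \<Phi> \<le> hexint k \<Psi>"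
  unfolding hexint_def by (intro nn_integral_mono assms) (auto simp: hexagons_def space_pair_measure)

lemma hexint_const: "hexint k (\<lambda>_. C) = C"
proof -
  interpret p: prob_space "pairs k" by (rule prob_pairs)
  interpret p2: prob_space "pairs (Suc (Suc k))" by (rule prob_pairs)
  have [simp]: "emeasure (bdg j x z) (space (m (Suc j))) = 1"
    if "x \<in> space (m j)" "z \<in> space (m (Suc (Suc j)))" for j x z
    using prob_space.emeasure_space_1[OF prob_bdg[OF that]] by simp
  have "hexint k (\<lambda>_. C) = (\<integral>\<^sup>+s. \<integral>\<^sup>+t. C \<partial>pairs (Suc (Suc k)) \<partial>pairs k)"
    unfolding hexint_def by (intro nn_integral_cong) auto
  then show ?thesis using p.emeasure_space_1 p2.emeasure_space_1 by simp
qed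

text \<open>The order of integration is chosen so that both paths from \<open>a\<close> to \<open>d\<close> become independent.\<close>

lemma hexint_le:
  assumes \<Phi>: "\<Phi> \<in> borel_measurable (hexagons k)"
  defines "W \<equiv> (\<lambda>(a, b, c, d). ennreal (q k (a, b)) * ennreal (q (Suc k) (b, c)) * ennreal (q (Suc (Suc k)) (c, d)))"
  shows "hexint k \<Phi> \<le> ennreal (1 / e) * ennreal (1 / e) *
    (\<integral>\<^sup>+a. \<integral>\<^sup>+d. \<integral>\<^sup>+b. \<integral>\<^sup>+c. \<integral>\<^sup>+b'. \<integral>\<^sup>+c'. W (a, b, c, d) * (W (a, b', c', d) * \<Phi> (a, b, c, b', c', d))
       \<partial>m (Suc (Suc k)) \<partial>m (Suc k) \<partial>m (Suc (Suc k)) \<partial>m (Suc k) \<partial>m (Suc (Suc (Suc k))) \<partial>m k)"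
proof -
  let ?m0 = "m k" and ?m1 = "m (Suc k)" and ?m2 = "m (Suc (Suc k))" and ?m3 = "m (Suc (Suc (Suc k)))"
  note sf = sigma_finite_m
  interpret m0: sigma_finite_measure ?m0 by (rule sf)
  interpret m1: sigma_finite_measure ?m1 by (rule sf)
  interpret m2: sigma_finite_measure ?m2 by (rule sf)
  interpret m3: sigma_finite_measure ?m3 by (rule sf)
  have \<Phi>_meas [measurable]: "\<Phi> \<in> borel_measurable (?m0 \<Otimes>\<^sub>M ?m1 \<Otimes>\<^sub>M ?m2 \<Otimes>\<^sub>M ?m1 \<Otimes>\<^sub>M ?m2 \<Otimes>\<^sub>M ?m3)"
    using \<Phi> unfolding hexagons_def .
  let ?r0 = "\<lambda>x y. ennreal (q k (x, y))" and ?r1 = "\<lambda>x y. ennreal (q (Suc k) (x, y))"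
    and ?r2 = "\<lambda>x y. ennreal (q (Suc (Suc k)) (x, y))" and ?e = "ennreal (1 / e)"
  \<comment> \<open>The six densities regroup: those of the first edge and of the bridge point
    \<open>c\<close> belong to the path \<open>a, b, c, d\<close>, those of the bridge point
    \<open>b'\<close> and of the second edge to the path \<open>a, b', c', d\<close>.\<close>
  define G where "G = (\<lambda>(a, b, c, b', c', d). ?e * ?e * (?r0 a b * ?r1 b c * ?r2 c d * (?r0 a b' * ?r1 b' c' * ?r2 c' d * \<Phi> (a, b, c, b', c', d))))"
  have G_meas [measurable]: "G \<in> borel_measurable (?m0 \<Otimes>\<^sub>M ?m1 \<Otimes>\<^sub>M ?m2 \<Otimes>\<^sub>M ?m1 \<Otimes>\<^sub>M ?m2 \<Otimes>\<^sub>M ?m3)"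
    unfolding G_def by measurable
  have "hexint k \<Phi> \<le> (\<integral>\<^sup>+s. \<integral>\<^sup>+t. \<integral>\<^sup>+c. \<integral>\<^sup>+b'.
        ?e * (?r1 (snd s) c * ?r2 c (snd t)) * (?e * (?r0 (fst s) b' * ?r1 b' (fst t)) * \<Phi> (fst s, snd s, c, b', fst t, snd t))
      \<partial>?m1 \<partial>?m2 \<partial>pairs (Suc (Suc k)) \<partial>pairs k)"
    unfolding hexint_def
  proof (intro nn_integral_mono)
    fix s t assume "s \<in> space (pairs k)" "t \<in> space (pairs (Suc (Suc k)))"
    then have [measurable]: "fst s \<in> space ?m0" "snd s \<in> space ?m1" "fst t \<in> space ?m2" "snd t \<in> space ?m3"
      "s \<in> space (?m0 \<Otimes>\<^sub>M ?m1)" "t \<in> space (?m2 \<Otimes>\<^sub>M ?m3)"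
      by (auto simp: space_pair_measure)
    have "(\<integral>\<^sup>+c. \<integral>\<^sup>+b'. \<Phi> (fst s, snd s, c, b', fst t, snd t) \<partial>bdg k (fst s) (fst t) \<partial>bdg (Suc k) (snd s) (snd t))
      \<le> (\<integral>\<^sup>+c. (\<integral>\<^sup>+b'. ?e * (?r0 (fst s) b' * ?r1 b' (fst t)) * \<Phi> (fst s, snd s, c, b', fst t, snd t) \<partial>?m1)
           \<partial>bdg (Suc k) (snd s) (snd t))"
      by (intro nn_integral_mono nn_integral_bdg_le) (simp_all, measurable)
    also have "\<dots> \<le> (\<integral>\<^sup>+c. ?e * (?r1 (snd s) c * ?r2 c (snd t)) *
        (\<integral>\<^sup>+b'. ?e * (?r0 (fst s) b' * ?r1 b' (fst t)) * \<Phi> (fst s, snd s, c, b', fst t, snd t) \<partial>?m1) \<partial>?m2)"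
      by (intro nn_integral_bdg_le) measurable
    also have "\<dots> = (\<integral>\<^sup>+c. \<integral>\<^sup>+b'.
        ?e * (?r1 (snd s) c * ?r2 c (snd t)) * (?e * (?r0 (fst s) b' * ?r1 b' (fst t)) * \<Phi> (fst s, snd s, c, b', fst t, snd t))
      \<partial>?m1 \<partial>?m2)"
      by (intro nn_integral_cong nn_integral_cmult[symmetric]) measurable
    finally show "(\<integral>\<^sup>+c. \<integral>\<^sup>+b'. \<Phi> (fst s, snd s, c, b', fst t, snd t) \<partial>bdg k (fst s) (fst t) \<partial>bdg (Suc k) (snd s) (snd t))
      \<le> (\<integral>\<^sup>+c. \<integral>\<^sup>+b'.
        ?e * (?r1 (snd s) c * ?r2 c (snd t)) * (?e * (?r0 (fst s) b' * ?r1 b' (fst t)) * \<Phi> (fst s, snd s, c, b', fst t, snd t))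
      \<partial>?m1 \<partial>?m2)" .
  qed
  also have "\<dots> = (\<integral>\<^sup>+a. \<integral>\<^sup>+b. ?r0 a b * (\<integral>\<^sup>+c'. \<integral>\<^sup>+d. ?r2 c' d * (\<integral>\<^sup>+c. \<integral>\<^sup>+b'.
        ?e * (?r1 b c * ?r2 c d) * (?e * (?r0 a b' * ?r1 b' c') * \<Phi> (a, b, c, b', c', d))
      \<partial>?m1 \<partial>?m2) \<partial>?m3 \<partial>?m2) \<partial>?m1 \<partial>?m0)"
  proof -
    have "(\<integral>\<^sup>+t. \<integral>\<^sup>+c. \<integral>\<^sup>+b'.
        ?e * (?r1 (snd s) c * ?r2 c (snd t)) * (?e * (?r0 (fst s) b' * ?r1 b' (fst t)) * \<Phi> (fst s, snd s, c, b', fst t, snd t))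
      \<partial>?m1 \<partial>?m2 \<partial>pairs (Suc (Suc k))) = (\<integral>\<^sup>+c'. \<integral>\<^sup>+d. ?r2 c' d * (\<integral>\<^sup>+c. \<integral>\<^sup>+b'.
        ?e * (?r1 (snd s) c * ?r2 c d) * (?e * (?r0 (fst s) b' * ?r1 b' c') * \<Phi> (fst s, snd s, c, b', c', d))
      \<partial>?m1 \<partial>?m2) \<partial>?m3 \<partial>?m2)" if "s \<in> space (pairs k)" for s
    proof -
      have [measurable]: "fst s \<in> space ?m0" "snd s \<in> space ?m1" "s \<in> space (?m0 \<Otimes>\<^sub>M ?m1)"
        using that by (auto simp: space_pair_measure)
      have "(\<lambda>t. \<integral>\<^sup>+c. \<integral>\<^sup>+b'.
        ?e * (?r1 (snd s) c * ?r2 c (snd t)) * (?e * (?r0 (fst s) b' * ?r1 b' (fst t)) * \<Phi> (fst s, snd s, c, b', fst t, snd t))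
      \<partial>?m1 \<partial>?m2) \<in> borel_measurable (?m2 \<Otimes>\<^sub>M ?m3)"
        by measurable
      from nn_integral_pairs[OF this] show ?thesis by (simp only: fst_conv snd_conv)
    qed
    note inner = this
    have "(\<lambda>s. \<integral>\<^sup>+c'. \<integral>\<^sup>+d. ?r2 c' d * (\<integral>\<^sup>+c. \<integral>\<^sup>+b'.
        ?e * (?r1 (snd s) c * ?r2 c d) * (?e * (?r0 (fst s) b' * ?r1 b' c') * \<Phi> (fst s, snd s, c, b', c', d))
      \<partial>?m1 \<partial>?m2) \<partial>?m3 \<partial>?m2) \<in> borel_measurable (?m0 \<Otimes>\<^sub>M ?m1)"
      by measurable
    note outer = nn_integral_pairs[OF this]
    show ?thesis
      by (rule trans[OF nn_integral_cong[OF inner] outer[unfolded fst_conv snd_conv]])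
  qed
  also have "\<dots> = (\<integral>\<^sup>+a. \<integral>\<^sup>+b. \<integral>\<^sup>+c'. \<integral>\<^sup>+d. \<integral>\<^sup>+c. \<integral>\<^sup>+b'. G (a, b, c, b', c', d) \<partial>?m1 \<partial>?m2 \<partial>?m3 \<partial>?m2 \<partial>?m1 \<partial>?m0)"
  proof (intro nn_integral_cong)
    fix a b assume [measurable]: "a \<in> space ?m0" "b \<in> space ?m1"
    let ?I = "\<lambda>c' d c b'. ?e * (?r1 b c * ?r2 c d) * (?e * (?r0 a b' * ?r1 b' c') * \<Phi> (a, b, c, b', c', d))"
    have "?r0 a b * (\<integral>\<^sup>+c'. \<integral>\<^sup>+d. ?r2 c' d * (\<integral>\<^sup>+c. \<integral>\<^sup>+b'. ?I c' d c b' \<partial>?m1 \<partial>?m2) \<partial>?m3 \<partial>?m2) =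
      (\<integral>\<^sup>+c'. ?r0 a b * (\<integral>\<^sup>+d. ?r2 c' d * (\<integral>\<^sup>+c. \<integral>\<^sup>+b'. ?I c' d c b' \<partial>?m1 \<partial>?m2) \<partial>?m3) \<partial>?m2)"
      by (rule nn_integral_cmult[symmetric]) measurable
    also have "\<dots> = (\<integral>\<^sup>+c'. \<integral>\<^sup>+d. ?r0 a b * (?r2 c' d * (\<integral>\<^sup>+c. \<integral>\<^sup>+b'. ?I c' d c b' \<partial>?m1 \<partial>?m2)) \<partial>?m3 \<partial>?m2)"
      by (intro nn_integral_cong nn_integral_cmult[symmetric]) measurable
    also have "\<dots> = (\<integral>\<^sup>+c'. \<integral>\<^sup>+d. \<integral>\<^sup>+c. \<integral>\<^sup>+b'. G (a, b, c, b', c', d) \<partial>?m1 \<partial>?m2 \<partial>?m3 \<partial>?m2)"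
    proof (intro nn_integral_cong)
      fix c' d assume [measurable]: "c' \<in> space ?m2" "d \<in> space ?m3"
      have "?r0 a b * (?r2 c' d * (\<integral>\<^sup>+c. \<integral>\<^sup>+b'. ?I c' d c b' \<partial>?m1 \<partial>?m2)) =
        (\<integral>\<^sup>+c. (?r0 a b * ?r2 c' d) * (\<integral>\<^sup>+b'. ?I c' d c b' \<partial>?m1) \<partial>?m2)"
        unfolding mult.assoc[symmetric] by (rule nn_integral_cmult[symmetric]) measurable
      also have "\<dots> = (\<integral>\<^sup>+c. \<integral>\<^sup>+b'. (?r0 a b * ?r2 c' d) * ?I c' d c b' \<partial>?m1 \<partial>?m2)"
        by (intro nn_integral_cong nn_integral_cmult[symmetric]) measurable
      also have "\<dots> = (\<integral>\<^sup>+c. \<integral>\<^sup>+b'. G (a, b, c, b', c', d) \<partial>?m1 \<partial>?m2)"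
        by (intro nn_integral_cong) (simp add: G_def mult_ac)
      finally show "?r0 a b * (?r2 c' d * (\<integral>\<^sup>+c. \<integral>\<^sup>+b'. ?I c' d c b' \<partial>?m1 \<partial>?m2)) =
        (\<integral>\<^sup>+c. \<integral>\<^sup>+b'. G (a, b, c, b', c', d) \<partial>?m1 \<partial>?m2)" .
    qed
    finally show "?r0 a b * (\<integral>\<^sup>+c'. \<integral>\<^sup>+d. ?r2 c' d * (\<integral>\<^sup>+c. \<integral>\<^sup>+b'. ?I c' d c b' \<partial>?m1 \<partial>?m2) \<partial>?m3 \<partial>?m2) =
      (\<integral>\<^sup>+c'. \<integral>\<^sup>+d. \<integral>\<^sup>+c. \<integral>\<^sup>+b'. G (a, b, c, b', c', d) \<partial>?m1 \<partial>?m2 \<partial>?m3 \<partial>?m2)" .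
  qed
  also have "\<dots> = (\<integral>\<^sup>+a. \<integral>\<^sup>+b. \<integral>\<^sup>+d. \<integral>\<^sup>+c'. \<integral>\<^sup>+c. \<integral>\<^sup>+b'. G (a, b, c, b', c', d) \<partial>?m1 \<partial>?m2 \<partial>?m2 \<partial>?m3 \<partial>?m1 \<partial>?m0)"
    by (rule nn_integral_cong, rule nn_integral_cong, rule nn_integral_swap[OF sf sf], measurable)
  also have "\<dots> = (\<integral>\<^sup>+a. \<integral>\<^sup>+d. \<integral>\<^sup>+b. \<integral>\<^sup>+c'. \<integral>\<^sup>+c. \<integral>\<^sup>+b'. G (a, b, c, b', c', d) \<partial>?m1 \<partial>?m2 \<partial>?m2 \<partial>?m1 \<partial>?m3 \<partial>?m0)"
    by (rule nn_integral_cong, rule nn_integral_swap[OF sf sf], measurable)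
  also have "\<dots> = (\<integral>\<^sup>+a. \<integral>\<^sup>+d. \<integral>\<^sup>+b. \<integral>\<^sup>+c. \<integral>\<^sup>+c'. \<integral>\<^sup>+b'. G (a, b, c, b', c', d) \<partial>?m1 \<partial>?m2 \<partial>?m2 \<partial>?m1 \<partial>?m3 \<partial>?m0)"
    by (rule nn_integral_cong, rule nn_integral_cong, rule nn_integral_cong, rule nn_integral_swap[OF sf sf], measurable)
  also have "\<dots> = (\<integral>\<^sup>+a. \<integral>\<^sup>+d. \<integral>\<^sup>+b. \<integral>\<^sup>+c. \<integral>\<^sup>+b'. \<integral>\<^sup>+c'. G (a, b, c, b', c', d) \<partial>?m2 \<partial>?m1 \<partial>?m2 \<partial>?m1 \<partial>?m3 \<partial>?m0)"
    by (rule nn_integral_cong, rule nn_integral_cong, rule nn_integral_cong, rule nn_integral_cong, rule nn_integral_swap[OF sf sf], measurable)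
  also have "\<dots> = ?e * ?e *
    (\<integral>\<^sup>+a. \<integral>\<^sup>+d. \<integral>\<^sup>+b. \<integral>\<^sup>+c. \<integral>\<^sup>+b'. \<integral>\<^sup>+c'. W (a, b, c, d) * (W (a, b', c', d) * \<Phi> (a, b, c, b', c', d))
       \<partial>?m2 \<partial>?m1 \<partial>?m2 \<partial>?m1 \<partial>?m3 \<partial>?m0)"
  proof -
    have W_meas [measurable]: "W \<in> borel_measurable (?m0 \<Otimes>\<^sub>M ?m1 \<Otimes>\<^sub>M ?m2 \<Otimes>\<^sub>M ?m3)"
      unfolding W_def by measurable
    have G_eq: "G (a, b, c, b', c', d) = ?e * ?e * (W (a, b, c, d) * (W (a, b', c', d) * \<Phi> (a, b, c, b', c', d)))" for a b c b' c' d
      by (simp add: G_def W_def)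
    show ?thesis
      unfolding G_eq
      apply (rule trans[rotated], rule nn_integral_cmult, measurable)
      apply (rule nn_integral_cong, rule trans[rotated], rule nn_integral_cmult, measurable)
      apply (rule nn_integral_cong, rule trans[rotated], rule nn_integral_cmult, measurable)
      apply (rule nn_integral_cong, rule trans[rotated], rule nn_integral_cmult, measurable)
      apply (rule nn_integral_cong, rule trans[rotated], rule nn_integral_cmult, measurable)
      apply (rule nn_integral_cong, rule nn_integral_cmult, measurable)
      done
  qed
  finally show ?thesis .
qed

section \<open>Decay of characteristic functions\<close>

definition hexbal :: "(nat \<Rightarrow> 'a \<times> 'a \<Rightarrow> real) \<Rightarrow> nat \<Rightarrow> 'a hexagon \<Rightarrow> real" where
  "hexbal f k = (\<lambda>(a, b, c, b', c', d). f k (a, b) + f (Suc k) (b, c) + f (Suc (Suc k)) (c, d)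
     - f k (a, b') - f (Suc k) (b', c') - f (Suc (Suc k)) (c', d))"

text \<open>\<open>dsq f \<xi> k\<close> is the square of the structure constant of index \<open>k + 3\<close> in the original time.\<close>

definition dsq :: "(nat \<Rightarrow> 'a \<times> 'a \<Rightarrow> real) \<Rightarrow> real \<Rightarrow> nat \<Rightarrow> real" where
  "dsq f \<xi> k = enn2real (hexint k (\<lambda>P. ennreal ((cmod (cis (\<xi> * hexbal f k P) - 1))\<^sup>2)))"

lemma cis_minus_1_sq_le: "(cmod (cis x - 1))\<^sup>2 \<le> 4"
  using cos_ge_minus_one[of x] unfolding norm_cis_minus_1_sq by linarith

lemma ennreal_dsq: "ennreal (dsq f \<xi> k) = hexint k (\<lambda>P. ennreal ((cmod (cis (\<xi> * hexbal f k P) - 1))\<^sup>2))"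
proof -
  have "hexint k (\<lambda>P. ennreal ((cmod (cis (\<xi> * hexbal f k P) - 1))\<^sup>2)) \<le> hexint k (\<lambda>_. 4)"
    using cis_minus_1_sq_le by (intro hexint_mono) (metis ennreal_leI ennreal_numeral zero_le_numeral)
  also have "\<dots> < top" by (simp add: hexint_const)
  finally show ?thesis unfolding dsq_def by simp
qed

lemma dsq_nonneg: "0 \<le> dsq f \<xi> k"
  by (simp add: dsq_def)

section \<open>Twisted three-step kernels\<close>

definition path_weight :: "nat \<Rightarrow> 'a \<Rightarrow> 'a \<Rightarrow> 'a \<times> 'a \<Rightarrow> real" where
  "path_weight k a d t = q k (a, fst t) * (q (Suc k) t * q (Suc (Suc k)) (snd t, d))"

definition path_sum :: "(nat \<Rightarrow> 'a \<times> 'a \<Rightarrow> real) \<Rightarrow> nat \<Rightarrow> 'a \<Rightarrow> 'a \<Rightarrow> 'a \<times> 'a \<Rightarrow> real" where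
  "path_sum f k a d t = f k (a, fst t) + f (Suc k) t + f (Suc (Suc k)) (snd t, d)"

text \<open>The density of the twisted three-step transition operator: a sum over the inner points
  of all paths from \<open>a\<close> to \<open>d\<close>, each with its density and the phase of the
  functional along it.\<close>

definition ker :: "(nat \<Rightarrow> 'a \<times> 'a \<Rightarrow> real) \<Rightarrow> real \<Rightarrow> nat \<Rightarrow> 'a \<Rightarrow> 'a \<Rightarrow> complex" where
  "ker f \<xi> k a d = (\<integral>t. path_weight k a d t *\<^sub>R cis (\<xi> * path_sum f k a d t) \<partial>(mm (Suc k)))"

definition ker0 :: "nat \<Rightarrow> 'a \<Rightarrow> 'a \<Rightarrow> real" where
  "ker0 k a d = (\<integral>t. path_weight k a d t \<partial>(mm (Suc k)))"

lemma pair_prob_m: "pair_prob_space (m j) (m k)"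
  using prob_m by (simp add: pair_prob_space_def pair_sigma_finite_def sigma_finite_m)

lemma prob_pair_m: "prob_space (m j \<Otimes>\<^sub>M m k)"
  by (rule prob_space_pair[OF prob_m prob_m])

lemma path_weight_meas:
  assumes [measurable]: "a \<in> space (m k)" "d \<in> space (m (Suc (Suc (Suc k))))"
  shows "path_weight k a d \<in> borel_measurable (mm (Suc k))"
  unfolding path_weight_def by measurable

lemma path_sum_meas:
  assumes [measurable]: "\<And>k. f k \<in> borel_measurable (mm k)"
    and [measurable]: "a \<in> space (m k)" "d \<in> space (m (Suc (Suc (Suc k))))"
  shows "path_sum f k a d \<in> borel_measurable (mm (Suc k))"
  unfolding path_sum_def by measurable

lemma path_weight_bounds:
  assumes a: "a \<in> space (m k)" and d: "d \<in> space (m (Suc (Suc (Suc k))))"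
    and t: "t \<in> space (mm (Suc k))"
  shows "0 \<le> path_weight k a d t" "path_weight k a d t \<le> 1 / e * (1 / e * (1 / e))"
    "path_weight k a d t \<le> 1 / e * (q k (a, fst t) * q (Suc k) t)"
proof -
  obtain b c where t: "t = (b, c)" and b: "b \<in> space (m (Suc k))" and c: "c \<in> space (m (Suc (Suc k)))"
    using t by (auto simp: space_pair_measure)
  note nn = q_nonneg[OF a b] q_nonneg[OF b c] q_nonneg[OF c d]
  note le = q_le[OF a b] q_le[OF b c] q_le[OF c d]
  show "0 \<le> path_weight k a d t" using nn by (simp add: path_weight_def t)
  show "path_weight k a d t \<le> 1 / e * (1 / e * (1 / e))"
    unfolding path_weight_def t fst_conv snd_conv using nn le e by (intro mult_mono) auto
  have "q k (a, b) * q (Suc k) (b, c) * q (Suc (Suc k)) (c, d) \<le> q k (a, b) * q (Suc k) (b, c) * (1 / e)"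
    using nn le by (intro mult_left_mono) auto
  then show "path_weight k a d t \<le> 1 / e * (q k (a, fst t) * q (Suc k) t)"
    by (simp add: path_weight_def t mult_ac)
qed

lemma integrable_path_weight:
  fixes g :: "'a \<times> 'a \<Rightarrow> 'b::{banach, second_countable_topology}"
  assumes a: "a \<in> space (m k)" and d: "d \<in> space (m (Suc (Suc (Suc k))))"
    and g: "g \<in> borel_measurable (mm (Suc k))" "\<And>t. norm (g t) \<le> 1"
  shows "integrable (mm (Suc k)) (\<lambda>t. path_weight k a d t *\<^sub>R g t)"
proof -
  interpret p: prob_space "m (Suc k) \<Otimes>\<^sub>M m (Suc (Suc k))" by (rule prob_pair_m)
  show ?thesis
  proof (rule p.integrable_const_bound[of _ "1 / e * (1 / e * (1 / e)) * 1"])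
    show "AE t in m (Suc k) \<Otimes>\<^sub>M m (Suc (Suc k)). norm (path_weight k a d t *\<^sub>R g t) \<le> 1 / e * (1 / e * (1 / e)) * 1"
    proof (rule AE_I2)
      fix t assume t: "t \<in> space (mm (Suc k))"
      show "norm (path_weight k a d t *\<^sub>R g t) \<le> 1 / e * (1 / e * (1 / e)) * 1"
        unfolding norm_scaleR using path_weight_bounds(1,2)[OF a d t] g(2)[of t] e by (intro mult_mono) auto
    qed
  qed (use path_weight_meas[OF a d] g(1) in measurable)
qed

lemma ker_meas [measurable]:
  assumes [measurable]: "\<And>k. f k \<in> borel_measurable (mm k)"
  shows "(\<lambda>z. ker f \<xi> k (fst z) (snd z)) \<in> borel_measurable (m k \<Otimes>\<^sub>M m (Suc (Suc (Suc k))))"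
proof -
  interpret p: pair_prob_space "m (Suc k)" "m (Suc (Suc k))" by (rule pair_prob_m)
  show ?thesis unfolding ker_def path_weight_def path_sum_def by measurable
qed

lemma ker0_meas [measurable]:
  "(\<lambda>z. ker0 k (fst z) (snd z)) \<in> borel_measurable (m k \<Otimes>\<^sub>M m (Suc (Suc (Suc k))))"
proof -
  interpret p: pair_prob_space "m (Suc k)" "m (Suc (Suc k))" by (rule pair_prob_m)
  show ?thesis unfolding ker0_def path_weight_def by measurable
qed

lemma ker_0: "ker f 0 k a d = of_real (ker0 k a d)"
  unfolding ker_def ker0_def integral_complex_of_real[symmetric]
  by (simp add: scaleR_conv_of_real)

lemma norm_ker_le:
  assumes a: "a \<in> space (m k)" and d: "d \<in> space (m (Suc (Suc (Suc k))))"
  shows "cmod (ker f \<xi> k a d) \<le> ker0 k a d"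
proof -
  have "cmod (ker f \<xi> k a d) \<le> (\<integral>t. cmod (path_weight k a d t *\<^sub>R cis (\<xi> * path_sum f k a d t)) \<partial>(mm (Suc k)))"
    unfolding ker_def by (rule integral_norm_bound)
  also have "\<dots> = ker0 k a d" unfolding ker0_def
    using path_weight_bounds(1)[OF a d] by (intro Bochner_Integration.integral_cong) auto
  finally show ?thesis .
qed

text \<open>Only the last of the three densities is bounded by \<open>1 / e\<close>; the other two
  integrate to one.\<close>

lemma ker0_le:
  assumes a: "a \<in> space (m k)" and d: "d \<in> space (m (Suc (Suc (Suc k))))"
  shows "ker0 k a d \<le> 1 / e"
proof -
  interpret p: pair_prob_space "m (Suc k)" "m (Suc (Suc k))" by (rule pair_prob_m)
  note a [measurable]
  have i: "integrable (mm (Suc k)) (\<lambda>t. q k (a, fst t) * q (Suc k) t)"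
  proof (rule p.P.integrable_const_bound[of _ "1 / e * (1 / e)"])
    show "AE t in m (Suc k) \<Otimes>\<^sub>M m (Suc (Suc k)). norm (q k (a, fst t) * q (Suc k) t) \<le> 1 / e * (1 / e)"
    proof (rule AE_I2)
      fix t assume "t \<in> space (mm (Suc k))"
      then obtain b c where t: "t = (b, c)" and b: "b \<in> space (m (Suc k))" and c: "c \<in> space (m (Suc (Suc k)))"
        by (auto simp: space_pair_measure)
      show "norm (q k (a, fst t) * q (Suc k) t) \<le> 1 / e * (1 / e)"
        unfolding norm_mult t using q_nonneg[OF a b] q_nonneg[OF b c] q_le[OF a b] q_le[OF b c] e
        by (intro mult_mono) auto
    qed
  qed measurable
  have "ker0 k a d \<le> (\<integral>t. 1 / e * (q k (a, fst t) * q (Suc k) t) \<partial>(mm (Suc k)))"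
    unfolding ker0_def
  proof (rule integral_mono)
    show "integrable (mm (Suc k)) (path_weight k a d)"
      using integrable_path_weight[OF a d, of "\<lambda>_. 1 :: real"] by simp
    show "integrable (mm (Suc k)) (\<lambda>t. 1 / e * (q k (a, fst t) * q (Suc k) t))"
      using i by (rule integrable_mult_right)
  qed (rule path_weight_bounds(3)[OF a d])
  also have "\<dots> = 1 / e * (\<integral>b. \<integral>c. q k (a, b) * q (Suc k) (b, c) \<partial>m (Suc (Suc k)) \<partial>m (Suc k))"
    using p.integral_fst'[OF i] by simp
  also have "(\<integral>b. \<integral>c. q k (a, b) * q (Suc k) (b, c) \<partial>m (Suc (Suc k)) \<partial>m (Suc k)) = (\<integral>b. q k (a, b) \<partial>m (Suc k))"
    by (intro Bochner_Integration.integral_cong refl) (simp add: q_total)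
  also have "\<dots> = 1" by (rule q_total[OF a])
  finally show ?thesis by simp
qed

text \<open>The transition operator twisted by the phase of \<open>f\<close>. Products of such
  operators applied to the constant 1 are conditional characteristic functions of sums.\<close>

definition Lop :: "(nat \<Rightarrow> 'a \<times> 'a \<Rightarrow> real) \<Rightarrow> real \<Rightarrow> nat \<Rightarrow> ('a \<Rightarrow> complex) \<Rightarrow> 'a \<Rightarrow> complex" where
  "Lop f \<xi> k u = avg k (\<lambda>z. cis (\<xi> * f k z) * u (snd z))"

lemma Lop_meas [measurable]:
  assumes [measurable]: "\<And>k. f k \<in> borel_measurable (mm k)" "u \<in> borel_measurable (m (Suc k))"
  shows "Lop f \<xi> k u \<in> borel_measurable (m k)"
  unfolding Lop_def by measurable

lemma Lop_bound:
  assumes [measurable]: "\<And>k. f k \<in> borel_measurable (mm k)" "u \<in> borel_measurable (m (Suc k))"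
    and "\<And>y. y \<in> space (m (Suc k)) \<Longrightarrow> cmod (u y) \<le> C" "x \<in> space (m k)"
  shows "cmod (Lop f \<xi> k u x) \<le> C"
  unfolding Lop_def using assms(3,4) by (intro avg_bound) (auto simp: norm_mult)

text \<open>Phases multiply along a path, and by Fubini the end point can be integrated
  last.\<close>

lemma Lop3_eq:
  assumes f [measurable]: "\<And>k. f k \<in> borel_measurable (mm k)"
    and u [measurable]: "u \<in> borel_measurable (m (Suc (Suc (Suc k))))"
    and uC: "\<And>y. y \<in> space (m (Suc (Suc (Suc k)))) \<Longrightarrow> cmod (u y) \<le> C"
    and a [measurable]: "a \<in> space (m k)"
  shows "Lop f \<xi> k (Lop f \<xi> (Suc k) (Lop f \<xi> (Suc (Suc k)) u)) a =
    (\<integral>d. ker f \<xi> k a d * u d \<partial>m (Suc (Suc (Suc k))))"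
proof -
  let ?m1 = "m (Suc k)" and ?m2 = "m (Suc (Suc k))" and ?m3 = "m (Suc (Suc (Suc k)))"
  interpret p: pair_prob_space ?m1 ?m2 by (rule pair_prob_m)
  interpret m3: prob_space ?m3 by (rule prob_m)
  interpret pp: pair_prob_space "?m1 \<Otimes>\<^sub>M ?m2" ?m3
    using p.P.prob_space_axioms prob_m
    by (simp add: pair_prob_space_def pair_sigma_finite_def sigma_finite_m p.P.sigma_finite_measure_axioms)
  let ?g = "\<lambda>z. (path_weight k a (snd z) (fst z) *\<^sub>R cis (\<xi> * path_sum f k a (snd z) (fst z))) * u (snd z)"
  have g_meas [measurable]: "?g \<in> borel_measurable ((?m1 \<Otimes>\<^sub>M ?m2) \<Otimes>\<^sub>M ?m3)"
    unfolding path_weight_def path_sum_def by measurable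
  obtain \<omega>\<^sub>0 where "\<omega>\<^sub>0 \<in> space M" using not_empty by blast
  then have C0: "0 \<le> C" using uC[OF space_Y] by (meson norm_ge_zero order_trans)
  have gi: "integrable ((?m1 \<Otimes>\<^sub>M ?m2) \<Otimes>\<^sub>M ?m3) (\<lambda>(t, d). ?g (t, d))"
  proof (rule pp.P.integrable_const_bound[of _ "1 / e * (1 / e * (1 / e)) * C"])
    show "AE z in (?m1 \<Otimes>\<^sub>M ?m2) \<Otimes>\<^sub>M ?m3. norm ((\<lambda>(t, d). ?g (t, d)) z) \<le> 1 / e * (1 / e * (1 / e)) * C"
    proof (rule AE_I2)
      fix z assume "z \<in> space ((?m1 \<Otimes>\<^sub>M ?m2) \<Otimes>\<^sub>M ?m3)"
      then have t: "fst z \<in> space (?m1 \<Otimes>\<^sub>M ?m2)" and d: "snd z \<in> space ?m3" by (auto simp: space_pair_measure)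
      have "norm (?g z) = path_weight k a (snd z) (fst z) * cmod (u (snd z))"
        using path_weight_bounds(1)[OF a d t] by (simp add: norm_mult)
      also have "\<dots> \<le> 1 / e * (1 / e * (1 / e)) * C"
        using path_weight_bounds(1,2)[OF a d t] uC[OF d] e by (intro mult_mono) auto
      finally show "norm ((\<lambda>(t, d). ?g (t, d)) z) \<le> 1 / e * (1 / e * (1 / e)) * C"
        by (simp add: case_prod_beta)
    qed
  qed (use g_meas in simp)
  have "Lop f \<xi> k (Lop f \<xi> (Suc k) (Lop f \<xi> (Suc (Suc k)) u)) a =
    (\<integral>b. \<integral>c. (\<integral>d. ?g ((b, c), d) \<partial>?m3) \<partial>?m2 \<partial>?m1)"
    unfolding Lop_def avg_def path_weight_def path_sum_def
    by (simp add: scaleR_conv_of_real distrib_left cis_mult[symmetric] mult_ac flip: integral_mult_right_zero)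
  also have "\<dots> = (\<integral>t. (\<integral>d. ?g (t, d) \<partial>?m3) \<partial>(?m1 \<Otimes>\<^sub>M ?m2))"
    using pp.integrable_fst'[OF gi] by (intro p.integral_fst') simp
  also have "\<dots> = (\<integral>d. (\<integral>t. ?g (t, d) \<partial>(?m1 \<Otimes>\<^sub>M ?m2)) \<partial>?m3)"
    by (rule pp.Fubini_integral[OF gi, symmetric])
  also have "\<dots> = (\<integral>d. ker f \<xi> k a d * u d \<partial>?m3)"
    unfolding ker_def fst_conv snd_conv integral_mult_left_zero ..
  finally show ?thesis .
qed

text \<open>The case of the zero functional and \<open>u = 1\<close> in \<open>Lop3_eq\<close>:
  untwisted averaging fixes constants.\<close>

lemma integral_ker0:
  assumes a: "a \<in> space (m k)"
  shows "(\<integral>d. ker0 k a d \<partial>m (Suc (Suc (Suc k)))) = 1"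
proof -
  have *: "Lop (\<lambda>_ _. 0) 0 j (\<lambda>_. 1) x = 1" if "x \<in> space (m j)" for j x
    unfolding Lop_def avg_def using q_total[OF that] by (simp add: scaleR_conv_of_real)
  have "Lop (\<lambda>_ _. 0) 0 j u x = Lop (\<lambda>_ _. 0) 0 j v x" if "\<And>y. y \<in> space (m (Suc j)) \<Longrightarrow> u y = v y" for j u v x
    unfolding Lop_def by (rule avg_cong) (simp add: that)
  note cong = this
  have "Lop (\<lambda>_ _. 0) 0 k (Lop (\<lambda>_ _. 0) 0 (Suc k) (Lop (\<lambda>_ _. 0) 0 (Suc (Suc k)) (\<lambda>_. 1))) a
    = Lop (\<lambda>_ _. 0) 0 k (Lop (\<lambda>_ _. 0) 0 (Suc k) (\<lambda>_. 1)) a"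
    by (intro cong *)
  also have "\<dots> = Lop (\<lambda>_ _. 0) 0 k (\<lambda>_. 1) a" by (intro cong *)
  also have "\<dots> = 1" by (rule *[OF a])
  also have "Lop (\<lambda>_ _. 0) 0 k (Lop (\<lambda>_ _. 0) 0 (Suc k) (Lop (\<lambda>_ _. 0) 0 (Suc (Suc k)) (\<lambda>_. 1))) a
    = (\<integral>d. ker (\<lambda>_ _. 0) 0 k a d * 1 \<partial>m (Suc (Suc (Suc k))))"
    by (rule Lop3_eq[OF _ _ _ a, of _ _ 1]) auto
  finally have "(\<integral>d. complex_of_real (ker0 k a d) \<partial>m (Suc (Suc (Suc k)))) = 1"
    by (simp add: ker_0)
  then show ?thesis by (simp only: integral_complex_of_real of_real_eq_1_iff)
qed

lemma hexbal_measurable: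
  assumes [measurable]: "\<And>k. f k \<in> borel_measurable (mm k)"
  shows "hexbal f k \<in> borel_measurable (hexagons k)"
  unfolding hexbal_def hexagons_def by measurable

text \<open>
  The deficit of \<open>\<bar>ker\<bar>\<^sup>2\<close> is a double integral over pairs of paths from \<open>a\<close> to \<open>d\<close>, that is, over
  hexagons. This links the operators to the structure constants.
\<close>

lemma path_pair_integral:
  assumes f [measurable]: "\<And>k. f k \<in> borel_measurable (mm k)"
    and a [measurable]: "a \<in> space (m k)" and d [measurable]: "d \<in> space (m (Suc (Suc (Suc k))))"
  defines "W \<equiv> (\<lambda>(a, b, c, d). ennreal (q k (a, b)) * ennreal (q (Suc k) (b, c)) * ennreal (q (Suc (Suc k)) (c, d)))"
  shows "(\<integral>\<^sup>+b. \<integral>\<^sup>+c. \<integral>\<^sup>+b'. \<integral>\<^sup>+c'. W (a, b, c, d) * (W (a, b', c', d) *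
         ennreal ((cmod (cis (\<xi> * hexbal f k (a, b, c, b', c', d)) - 1))\<^sup>2))
       \<partial>m (Suc (Suc k)) \<partial>m (Suc k) \<partial>m (Suc (Suc k)) \<partial>m (Suc k)) =
     ennreal (2 * (ker0 k a d)\<^sup>2 - 2 * (cmod (ker f \<xi> k a d))\<^sup>2)"
proof -
  let ?m1 = "m (Suc k)" and ?m2 = "m (Suc (Suc k))"
  interpret p: pair_prob_space ?m1 ?m2 by (rule pair_prob_m)
  let ?w = "path_weight k a d"
  note w_meas [measurable] = path_weight_meas[OF a d]
  note s_meas [measurable] = path_sum_meas[OF f a d]
  \<comment> \<open>The unnormalized law of the inner points of a path from \<open>a\<close> to
    \<open>d\<close>. Two independent samples of it form a hexagon with these end points, whose
    balance is a difference of two values of \<open>path_sum\<close>.\<close>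
  define N where "N = density (?m1 \<Otimes>\<^sub>M ?m2) (\<lambda>t. ennreal (?w t))"
  have sets_N [measurable_cong, simp]: "sets N = sets (?m1 \<Otimes>\<^sub>M ?m2)" by (simp add: N_def)
  have space_N [simp]: "space N = space (?m1 \<Otimes>\<^sub>M ?m2)" by (simp add: N_def)
  have iw: "integrable (?m1 \<Otimes>\<^sub>M ?m2) ?w"
    using integrable_path_weight[OF a d, of "\<lambda>_. 1 :: real"] by simp
  have w0: "0 \<le> ?w t" if "t \<in> space (?m1 \<Otimes>\<^sub>M ?m2)" for t by (rule path_weight_bounds[OF a d that])
  have em: "emeasure N (space N) = ennreal (ker0 k a d)"
  proof -
    have "emeasure N (space N) = (\<integral>\<^sup>+t. ennreal (?w t) \<partial>(?m1 \<Otimes>\<^sub>M ?m2))"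
      unfolding N_def by (simp add: emeasure_density cong: nn_integral_cong)
    also have "\<dots> = ennreal (ker0 k a d)" unfolding ker0_def
      using w0 by (intro nn_integral_eq_integral iw AE_I2) auto
    finally show ?thesis .
  qed
  have fN: "finite_measure N" by (rule finite_measureI) (simp only: em ennreal_neq_top not_False_eq_True infinity_ennreal_def)
  have k0: "0 \<le> ker0 k a d" using norm_ker_le[OF a d] norm_ge_zero order_trans by blast
  have mN: "measure N (space N) = ker0 k a d" using em k0 by (simp add: measure_def)
  have nnN: "(\<integral>\<^sup>+t. g t \<partial>N) = (\<integral>\<^sup>+b. \<integral>\<^sup>+c. W (a, b, c, d) * g (b, c) \<partial>?m2 \<partial>?m1)"
    if [measurable]: "g \<in> borel_measurable (?m1 \<Otimes>\<^sub>M ?m2)" for g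
  proof -
    have "(\<integral>\<^sup>+t. g t \<partial>N) = (\<integral>\<^sup>+t. ennreal (?w t) * g t \<partial>(?m1 \<Otimes>\<^sub>M ?m2))"
      unfolding N_def by (rule nn_integral_density) measurable
    also have "\<dots> = (\<integral>\<^sup>+b. \<integral>\<^sup>+c. ennreal (?w (b, c)) * g (b, c) \<partial>?m2 \<partial>?m1)"
      by (rule p.M2.nn_integral_fst[symmetric]) measurable
    also have "\<dots> = (\<integral>\<^sup>+b. \<integral>\<^sup>+c. W (a, b, c, d) * g (b, c) \<partial>?m2 \<partial>?m1)"
    proof (intro nn_integral_cong)
      fix b c assume b: "b \<in> space ?m1" and c: "c \<in> space ?m2"
      show "ennreal (?w (b, c)) * g (b, c) = W (a, b, c, d) * g (b, c)"
        unfolding path_weight_def W_def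
        using q_nonneg[OF a b] q_nonneg[OF b c] q_nonneg[OF c d] by (simp add: ennreal_mult mult.assoc)
    qed
    finally show ?thesis .
  qed
  let ?\<phi> = "\<lambda>t. \<xi> * path_sum f k a d t"
  let ?\<Phi> = "\<lambda>s t. ennreal ((cmod (cis (0 + ?\<phi> s - ?\<phi> t) - 1))\<^sup>2)"
  have \<phi>_meas [measurable]: "?\<phi> \<in> borel_measurable N" by measurable
  have kerN: "(\<integral>t. cis (?\<phi> t) \<partial>N) = ker f \<xi> k a d"
    unfolding ker_def N_def using w0 by (intro integral_density AE_I2) measurable
  have outer_meas: "(\<lambda>s. \<integral>\<^sup>+t. ?\<Phi> s t \<partial>N) \<in> borel_measurable (?m1 \<Otimes>\<^sub>M ?m2)"
  proof -
    interpret N: finite_measure N by fact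
    show ?thesis by measurable
  qed
  have "(\<integral>\<^sup>+b. \<integral>\<^sup>+c. \<integral>\<^sup>+b'. \<integral>\<^sup>+c'. W (a, b, c, d) * (W (a, b', c', d) *
         ennreal ((cmod (cis (\<xi> * hexbal f k (a, b, c, b', c', d)) - 1))\<^sup>2)) \<partial>?m2 \<partial>?m1 \<partial>?m2 \<partial>?m1)
    = (\<integral>\<^sup>+b. \<integral>\<^sup>+c. W (a, b, c, d) * (\<integral>\<^sup>+b'. \<integral>\<^sup>+c'. W (a, b', c', d) * ?\<Phi> (b, c) (b', c') \<partial>?m2 \<partial>?m1) \<partial>?m2 \<partial>?m1)"
  proof (rule nn_integral_cong, rule nn_integral_cong)
    fix b c assume b [measurable]: "b \<in> space ?m1" and c [measurable]: "c \<in> space ?m2"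
    have bc [measurable]: "(b, c) \<in> space (?m1 \<Otimes>\<^sub>M ?m2)" using b c by (simp add: space_pair_measure)
    have W_meas [measurable]: "(\<lambda>t. W (a, fst t, snd t, d)) \<in> borel_measurable (?m1 \<Otimes>\<^sub>M ?m2)"
      unfolding W_def by measurable
    have "(\<lambda>t. ?\<Phi> (b, c) t) \<in> borel_measurable (?m1 \<Otimes>\<^sub>M ?m2)" by measurable
    then have m1: "(\<lambda>t. W (a, fst t, snd t, d) * ?\<Phi> (b, c) t) \<in> borel_measurable (?m1 \<Otimes>\<^sub>M ?m2)"
      by (rule borel_measurable_times_ennreal[OF W_meas])
    have m2: "(\<lambda>t. W (a, b, c, d) * (W (a, fst t, snd t, d) * ?\<Phi> (b, c) t)) \<in> borel_measurable (?m1 \<Otimes>\<^sub>M ?m2)"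
      by (rule borel_measurable_times_ennreal[OF _ m1]) simp
    have eq: "\<xi> * hexbal f k (a, b, c, b', c', d) = 0 + ?\<phi> (b, c) - ?\<phi> (b', c')" for b' c'
      by (simp add: hexbal_def path_sum_def algebra_simps)
    have "W (a, b, c, d) * (\<integral>\<^sup>+b'. \<integral>\<^sup>+c'. W (a, b', c', d) * ?\<Phi> (b, c) (b', c') \<partial>?m2 \<partial>?m1) =
        W (a, b, c, d) * (\<integral>\<^sup>+t. W (a, fst t, snd t, d) * ?\<Phi> (b, c) t \<partial>(?m1 \<Otimes>\<^sub>M ?m2))"
      using p.M2.nn_integral_fst[OF m1] by (simp only: fst_conv snd_conv)
    also have "\<dots> = (\<integral>\<^sup>+t. W (a, b, c, d) * (W (a, fst t, snd t, d) * ?\<Phi> (b, c) t) \<partial>(?m1 \<Otimes>\<^sub>M ?m2))"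
      by (rule nn_integral_cmult[OF m1, symmetric])
    also have "\<dots> = (\<integral>\<^sup>+b'. \<integral>\<^sup>+c'. W (a, b, c, d) * (W (a, b', c', d) * ?\<Phi> (b, c) (b', c')) \<partial>?m2 \<partial>?m1)"
      using p.M2.nn_integral_fst[OF m2] by (simp only: fst_conv snd_conv)
    finally show "(\<integral>\<^sup>+b'. \<integral>\<^sup>+c'. W (a, b, c, d) * (W (a, b', c', d) *
         ennreal ((cmod (cis (\<xi> * hexbal f k (a, b, c, b', c', d)) - 1))\<^sup>2)) \<partial>?m2 \<partial>?m1) =
        W (a, b, c, d) * (\<integral>\<^sup>+b'. \<integral>\<^sup>+c'. W (a, b', c', d) * ?\<Phi> (b, c) (b', c') \<partial>?m2 \<partial>?m1)"
      unfolding eq by (rule sym)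
  qed
  also have "\<dots> = (\<integral>\<^sup>+b. \<integral>\<^sup>+c. W (a, b, c, d) * (\<integral>\<^sup>+t. ?\<Phi> (b, c) t \<partial>N) \<partial>?m2 \<partial>?m1)"
  proof (rule nn_integral_cong, rule nn_integral_cong)
    fix b c assume "b \<in> space ?m1" "c \<in> space ?m2"
    then have bc [measurable]: "(b, c) \<in> space (?m1 \<Otimes>\<^sub>M ?m2)" by (simp add: space_pair_measure)
    have "(\<lambda>t. ?\<Phi> (b, c) t) \<in> borel_measurable (?m1 \<Otimes>\<^sub>M ?m2)" by measurable
    from nnN[OF this] show "W (a, b, c, d) * (\<integral>\<^sup>+b'. \<integral>\<^sup>+c'. W (a, b', c', d) * ?\<Phi> (b, c) (b', c') \<partial>?m2 \<partial>?m1)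
      = W (a, b, c, d) * (\<integral>\<^sup>+t. ?\<Phi> (b, c) t \<partial>N)" by (simp only:)
  qed
  also have "\<dots> = (\<integral>\<^sup>+s. \<integral>\<^sup>+t. ?\<Phi> s t \<partial>N \<partial>N)"
    by (rule nnN[OF outer_meas, symmetric])
  also have "\<dots> = ennreal (2 * measure N (space N) * measure N (space N) -
      2 * Re (cis 0 * (\<integral>t. cis (?\<phi> t) \<partial>N) * cnj (\<integral>t. cis (?\<phi> t) \<partial>N)))"
    by (rule nn_integral_phase_difference[OF fN fN \<phi>_meas \<phi>_meas])
  also have "2 * measure N (space N) * measure N (space N) -
      2 * Re (cis 0 * (\<integral>t. cis (?\<phi> t) \<partial>N) * cnj (\<integral>t. cis (?\<phi> t) \<partial>N)) =
      2 * (ker0 k a d)\<^sup>2 - 2 * (cmod (ker f \<xi> k a d))\<^sup>2"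
  proof -
    have "Re (cis 0 * ker f \<xi> k a d * cnj (ker f \<xi> k a d)) = (cmod (ker f \<xi> k a d))\<^sup>2"
      unfolding cis_zero mult_1_left complex_norm_square[symmetric] by simp
    then show ?thesis unfolding kerN mN by (simp only: power2_eq_square mult.assoc)
  qed
  finally show ?thesis .
qed

text \<open>A difference of squares is the deficit times a sum of moduli, and that sum is at most
  \<open>2 / e\<close>. The structure constant is thus bounded by the first power of the deficit,
  which is exactly the mass an operator loses. The constant is \<open>4 / e\<close> from this step
  times \<open>1 / e\<close> for each of the two bridges.\<close>

lemma dsq_le:
  assumes f [measurable]: "\<And>k. f k \<in> borel_measurable (mm k)"
  shows "dsq f \<xi> k \<le> 4 / e ^ 3 * (\<integral>a. \<integral>d. ker0 k a d - cmod (ker f \<xi> k a d) \<partial>m (Suc (Suc (Suc k))) \<partial>m k)"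
proof -
  let ?m3 = "m (Suc (Suc (Suc k)))"
  interpret m3: prob_space ?m3 by (rule prob_m)
  let ?D = "\<lambda>a d. ker0 k a d - cmod (ker f \<xi> k a d)"
  have hm: "(\<lambda>P. ennreal ((cmod (cis (\<xi> * hexbal f k P) - 1))\<^sup>2)) \<in> borel_measurable (hexagons k)"
    using hexbal_measurable[OF f] by measurable
  have Dm [measurable]: "(\<lambda>z. ?D (fst z) (snd z)) \<in> borel_measurable (m k \<Otimes>\<^sub>M ?m3)" by measurable
  have D0: "0 \<le> ?D a d" "?D a d \<le> 1 / e" if "a \<in> space (m k)" "d \<in> space ?m3" for a d
    using norm_ker_le[OF that, of f \<xi>] ker0_le[OF that] norm_ge_zero[of "ker f \<xi> k a d"] by linarith+
  have pw: "2 * (ker0 k a d)\<^sup>2 - 2 * (cmod (ker f \<xi> k a d))\<^sup>2 \<le> 4 / e * ?D a d"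
    if "a \<in> space (m k)" "d \<in> space ?m3" for a d
  proof -
    have "2 * (ker0 k a d)\<^sup>2 - 2 * (cmod (ker f \<xi> k a d))\<^sup>2 = 2 * (?D a d * (ker0 k a d + cmod (ker f \<xi> k a d)))"
      by (simp add: power2_eq_square algebra_simps)
    also have "\<dots> \<le> 2 * (?D a d * (2 / e))"
      using D0[OF that] ker0_le[OF that] norm_ker_le[OF that, of f \<xi>] by (intro mult_left_mono) auto
    finally show ?thesis by (simp add: mult_ac)
  qed
  have iD: "integrable ?m3 (\<lambda>d. ?D a d)" if a [measurable]: "a \<in> space (m k)" for a
  proof (rule integrable_m[of _ _ "1 / e"])
    show "(\<lambda>d. ?D a d) \<in> borel_measurable ?m3"
      using measurable_compose[OF measurable_Pair1'[OF a] Dm] by simp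
    show "norm (?D a d) \<le> 1 / e" if "d \<in> space ?m3" for d using D0[OF a that] by simp
  qed
  have "ennreal (dsq f \<xi> k) \<le> ennreal (1 / e) * ennreal (1 / e) *
      (\<integral>\<^sup>+a. \<integral>\<^sup>+d. ennreal (2 * (ker0 k a d)\<^sup>2 - 2 * (cmod (ker f \<xi> k a d))\<^sup>2) \<partial>?m3 \<partial>m k)"
    unfolding ennreal_dsq
    by (rule order_trans[OF hexint_le[OF hm]])
       (rule mult_left_mono, rule eq_refl, rule nn_integral_cong, rule nn_integral_cong,
         rule path_pair_integral[OF f], assumption, assumption, simp)
  also have "\<dots> \<le> ennreal (1 / e) * ennreal (1 / e) * (\<integral>\<^sup>+a. \<integral>\<^sup>+d. ennreal (4 / e * ?D a d) \<partial>?m3 \<partial>m k)"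
    by (intro mult_left_mono nn_integral_mono ennreal_leI pw) auto
  also have "(\<integral>\<^sup>+a. \<integral>\<^sup>+d. ennreal (4 / e * ?D a d) \<partial>?m3 \<partial>m k) = (\<integral>\<^sup>+a. ennreal (4 / e * (\<integral>d. ?D a d \<partial>?m3)) \<partial>m k)"
  proof (rule nn_integral_cong)
    fix a assume a: "a \<in> space (m k)"
    have "(\<integral>\<^sup>+d. ennreal (4 / e * ?D a d) \<partial>?m3) = ennreal (\<integral>d. 4 / e * ?D a d \<partial>?m3)"
      using D0[OF a] e by (intro nn_integral_eq_integral AE_I2 integrable_mult_right iD a mult_nonneg_nonneg) auto
    then show "(\<integral>\<^sup>+d. ennreal (4 / e * ?D a d) \<partial>?m3) = ennreal (4 / e * (\<integral>d. ?D a d \<partial>?m3))"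
      by (simp only: integral_mult_right_zero)
  qed
  also have "\<dots> = ennreal (\<integral>a. 4 / e * (\<integral>d. ?D a d \<partial>?m3) \<partial>m k)"
  proof (intro nn_integral_eq_integral AE_I2 integrable_mult_right)
    show "integrable (m k) (\<lambda>a. \<integral>d. ?D a d \<partial>?m3)"
    proof (rule integrable_m[of _ _ "1 / e"])
      fix a assume a: "a \<in> space (m k)"
      have "(\<integral>d. ?D a d \<partial>?m3) \<le> (\<integral>d. 1 / e \<partial>?m3)"
        using D0[OF a] by (intro integral_mono iD a) auto
      moreover have "0 \<le> (\<integral>d. ?D a d \<partial>?m3)"
        using D0[OF a] by (intro integral_nonneg_AE AE_I2) auto
      ultimately show "norm (\<integral>d. ?D a d \<partial>?m3) \<le> 1 / e" by (simp add: m3.prob_space)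
    qed measurable
    show "0 \<le> 4 / e * (\<integral>d. ?D a d \<partial>?m3)" if "a \<in> space (m k)" for a
      using D0[OF that] e by (intro mult_nonneg_nonneg integral_nonneg_AE AE_I2) auto
  qed
  also have "ennreal (1 / e) * ennreal (1 / e) * \<dots> = ennreal (1 / e * (1 / e) * (\<integral>a. 4 / e * (\<integral>d. ?D a d \<partial>?m3) \<partial>m k))"
    using e by (simp only: ennreal_mult' mult_nonneg_nonneg zero_le_divide_1_iff less_imp_le)
  finally have le: "ennreal (dsq f \<xi> k) \<le> ennreal (1 / e * (1 / e) * (\<integral>a. 4 / e * (\<integral>d. ?D a d \<partial>?m3) \<partial>m k))" .
  have "0 \<le> 1 / e * (1 / e) * (\<integral>a. 4 / e * (\<integral>d. ?D a d \<partial>?m3) \<partial>m k)"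
    using D0 e by (intro mult_nonneg_nonneg integral_nonneg_AE AE_I2) auto
  then have "dsq f \<xi> k \<le> 1 / e * (1 / e) * (\<integral>a. 4 / e * (\<integral>d. ?D a d \<partial>?m3) \<partial>m k)"
    using le by (simp only: ennreal_le_iff)
  also have "\<dots> = 4 / e ^ 3 * (\<integral>a. \<integral>d. ?D a d \<partial>?m3 \<partial>m k)"
    by (simp add: power3_eq_cube)
  finally show ?thesis .
qed

lemma step2_meas:
  "x \<in> space (m k) \<Longrightarrow> step2 k x \<in> borel_measurable (m (Suc (Suc k)))"
  using measurable_compose[OF measurable_Pair1' step2_measurable, of x k] by simp

lemma integrable_step2:
  assumes x: "x \<in> space (m k)"
  shows "integrable (m (Suc (Suc k))) (step2 k x)"
proof (rule integrable_m[OF step2_meas[OF x], of "1 / e"])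
  fix z assume "z \<in> space (m (Suc (Suc k)))"
  from step2_pos[OF x this] step2_le[OF x this] show "norm (step2 k x z) \<le> 1 / e" by simp
qed

text \<open>
  The loss of mass of \<open>ker\<close> is only known on average over its starting point. The two steps in front
  spread the starting point over the whole space, because their density exceeds \<open>e\<close>.
\<close>

lemma five_step_contraction:
  assumes f [measurable]: "\<And>k. f k \<in> borel_measurable (mm k)"
    and U [measurable]: "\<And>k. U k \<in> borel_measurable (m k)"
    and rec: "\<And>i. i < 5 \<Longrightarrow> U (j + i) = Lop f \<xi> (j + i) (U (Suc (j + i)))"
    and B: "\<And>y. y \<in> space (m (j + 5)) \<Longrightarrow> cmod (U (j + 5) y) \<le> B"
    and x: "x \<in> space (m j)"
  shows "cmod (U j x) \<le> B * (1 - e ^ 4 / 4 * dsq f \<xi> (j + 2))"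
proof -
  let ?k = "Suc (Suc j)"
  let ?m3 = "m (Suc (Suc (Suc ?k)))"
  interpret m3: prob_space ?m3 by (rule prob_m)
  interpret mk: prob_space "m ?k" by (rule prob_m)
  have U0: "U j = Lop f \<xi> j (U (Suc j))" and U1: "U (Suc j) = Lop f \<xi> (Suc j) (U ?k)"
    and U2: "U ?k = Lop f \<xi> ?k (U (Suc ?k))" and U3: "U (Suc ?k) = Lop f \<xi> (Suc ?k) (U (Suc (Suc ?k)))"
    and U4: "U (Suc (Suc ?k)) = Lop f \<xi> (Suc (Suc ?k)) (U (Suc (Suc (Suc ?k))))"
    using rec[of 0] rec[of 1] rec[of 2] rec[of 3] rec[of 4] by (simp_all add: eval_nat_numeral)
  have B': "cmod (U (Suc (Suc (Suc ?k))) y) \<le> B" if "y \<in> space ?m3" for y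
    using B[of y] that by (simp add: eval_nat_numeral)
  obtain \<omega>\<^sub>0 where \<omega>0: "\<omega>\<^sub>0 \<in> space M" using not_empty by blast
  then have B0: "0 \<le> B" using B'[OF space_Y] by (meson norm_ge_zero order_trans)
  let ?D = "\<lambda>a d. ker0 ?k a d - cmod (ker f \<xi> ?k a d)"
  \<comment> \<open>The mass lost by the twisted kernel when it starts from \<open>a\<close>; by
    \<open>Uk\<close> below, a uniform bound \<open>B\<close> at the end shrinks to
    \<open>B * (1 - \<delta> a)\<close> at \<open>a\<close>.\<close>
  define \<delta> where "\<delta> a = (\<integral>d. ?D a d \<partial>?m3)" for a
  have Dm [measurable]: "(\<lambda>z. ?D (fst z) (snd z)) \<in> borel_measurable (m ?k \<Otimes>\<^sub>M ?m3)" by measurable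
  have km: "(\<lambda>d. ker f \<xi> ?k a d) \<in> borel_measurable ?m3" "(\<lambda>d. ker0 ?k a d) \<in> borel_measurable ?m3"
    if a: "a \<in> space (m ?k)" for a
    using measurable_compose[OF measurable_Pair1'[OF a] ker_meas[OF f]]
      measurable_compose[OF measurable_Pair1'[OF a] ker0_meas] by simp_all
  have k0: "0 \<le> ker0 ?k a d" if "a \<in> space (m ?k)" "d \<in> space ?m3" for a d
    using norm_ker_le[OF that, of f \<xi>] norm_ge_zero order_trans by blast
  have ik: "integrable ?m3 (\<lambda>d. cmod (ker f \<xi> ?k a d))" "integrable ?m3 (\<lambda>d. ker0 ?k a d)"
    if a: "a \<in> space (m ?k)" for a
    using order_trans[OF norm_ker_le[OF a, of _ f \<xi>] ker0_le[OF a]] ker0_le[OF a] k0[OF a] km[OF a]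
    by (auto intro!: integrable_m[of _ _ "1 / e"])
  have \<delta>_eq: "\<delta> a = 1 - (\<integral>d. cmod (ker f \<xi> ?k a d) \<partial>?m3)" if a: "a \<in> space (m ?k)" for a
    unfolding \<delta>_def using ik[OF a] integral_ker0[OF a] by simp
  have \<delta>_meas [measurable]: "\<delta> \<in> borel_measurable (m ?k)" unfolding \<delta>_def by measurable
  have \<delta>_bounds: "0 \<le> \<delta> a" "\<delta> a \<le> 1" if a: "a \<in> space (m ?k)" for a
  proof -
    show "0 \<le> \<delta> a" unfolding \<delta>_def using norm_ker_le[OF a] by (intro integral_nonneg_AE AE_I2) auto
    show "\<delta> a \<le> 1" unfolding \<delta>_eq[OF a] by simp
  qed
  have Uk: "cmod (U ?k a) \<le> B * (1 - \<delta> a)" if a: "a \<in> space (m ?k)" for a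
  proof -
    have "cmod (U ?k a) = cmod (\<integral>d. ker f \<xi> ?k a d * U (Suc (Suc (Suc ?k))) d \<partial>?m3)"
      unfolding U2 U3 U4 using B' by (subst Lop3_eq[OF f _ _ a, of _ B]) auto
    also have "\<dots> \<le> (\<integral>d. cmod (ker f \<xi> ?k a d * U (Suc (Suc (Suc ?k))) d) \<partial>?m3)"
      by (rule integral_norm_bound)
    also have "\<dots> \<le> (\<integral>d. cmod (ker f \<xi> ?k a d) * B \<partial>?m3)"
    proof (rule integral_mono)
      show "integrable ?m3 (\<lambda>d. cmod (ker f \<xi> ?k a d * U (Suc (Suc (Suc ?k))) d))"
      proof (rule integrable_m[of _ _ "1 / e * B"])
        show "norm (cmod (ker f \<xi> ?k a d * U (Suc (Suc (Suc ?k))) d)) \<le> 1 / e * B" if d: "d \<in> space ?m3" for d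
        proof -
          have "cmod (ker f \<xi> ?k a d) * cmod (U (Suc (Suc (Suc ?k))) d) \<le> 1 / e * B"
            using order_trans[OF norm_ker_le[OF a d] ker0_le[OF a d]] B'[OF d] e by (intro mult_mono) auto
          then show ?thesis by (simp add: norm_mult abs_mult)
        qed
      qed (use km[OF a] in measurable)
      show "integrable ?m3 (\<lambda>d. cmod (ker f \<xi> ?k a d) * B)" using ik(1)[OF a] by simp
      show "cmod (ker f \<xi> ?k a d * U (Suc (Suc (Suc ?k))) d) \<le> cmod (ker f \<xi> ?k a d) * B" if "d \<in> space ?m3" for d
        unfolding norm_mult using B'[OF that] by (intro mult_left_mono) auto
    qed
    also have "\<dots> = B * (1 - \<delta> a)" unfolding \<delta>_eq[OF a] by simp
    finally show ?thesis .
  qed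
  define g where "g a = B * (1 - \<delta> a)" for a
  have g_meas [measurable]: "g \<in> borel_measurable (m ?k)" unfolding g_def by measurable
  have gB: "\<bar>g a\<bar> \<le> B" if "a \<in> space (m ?k)" for a
    unfolding g_def using \<delta>_bounds[OF that] B0 mult_left_mono[of "1 - \<delta> a" 1 B] by simp
  have Lop_le: "cmod (Lop f \<xi> i u y) \<le> avg i (\<lambda>z. v (snd z)) y"
    if [measurable]: "u \<in> borel_measurable (m (Suc i))" "v \<in> borel_measurable (m (Suc i))"
      and v: "\<And>z. z \<in> space (m (Suc i)) \<Longrightarrow> cmod (u z) \<le> v z" "\<And>z. z \<in> space (m (Suc i)) \<Longrightarrow> \<bar>v z\<bar> \<le> B"
      and y [measurable]: "y \<in> space (m i)" for i u v y
  proof -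
    have "cmod (Lop f \<xi> i u y) \<le> (\<integral>z. cmod (q i (y, z) *\<^sub>R (cis (\<xi> * f i (y, z)) * u (snd (y, z)))) \<partial>m (Suc i))"
      unfolding Lop_def avg_def by (rule integral_norm_bound)
    also have "\<dots> \<le> (\<integral>z. q i (y, z) *\<^sub>R v (snd (y, z)) \<partial>m (Suc i))"
    proof (rule integral_mono)
      have uB: "cmod (cis (\<xi> * f i (y, z)) * u (snd (y, z))) \<le> B" if "z \<in> space (m (Suc i))" for z
        using v(1)[OF that] v(2)[OF that] by (simp add: norm_mult)
      show "integrable (m (Suc i)) (\<lambda>z. cmod (q i (y, z) *\<^sub>R (cis (\<xi> * f i (y, z)) * u (snd (y, z)))))"
        using uB by (intro integrable_norm integrable_q_scaleR[OF y, of _ B]) auto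
      show "integrable (m (Suc i)) (\<lambda>z. q i (y, z) *\<^sub>R v (snd (y, z)))"
        using v(2) by (intro integrable_q_scaleR[OF y, of _ B]) auto
      show "cmod (q i (y, z) *\<^sub>R (cis (\<xi> * f i (y, z)) * u (snd (y, z)))) \<le> q i (y, z) *\<^sub>R v (snd (y, z))"
        if z: "z \<in> space (m (Suc i))" for z
        using q_nonneg[OF y z] v(1)[OF z] by (simp add: norm_mult mult_left_mono)
    qed
    finally show ?thesis by (simp add: avg_def)
  qed
  have a1: "\<bar>avg (Suc j) (\<lambda>z. g (snd z)) y\<bar> \<le> B" if "y \<in> space (m (Suc j))" for y
    unfolding real_norm_def[symmetric] using that gB by (intro avg_bound) auto
  have "cmod (U j x) \<le> avg j (\<lambda>t. avg (Suc j) (\<lambda>z. g (snd z)) (snd t)) x"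
    unfolding U0
  proof (rule Lop_le[OF _ _ _ a1 x])
    show "cmod (U (Suc j) z) \<le> avg (Suc j) (\<lambda>z. g (snd z)) z" if "z \<in> space (m (Suc j))" for z
      unfolding U1 using Uk gB that by (intro Lop_le) (auto simp: g_def)
  qed auto
  also have "\<dots> = (\<integral>z. step2 j x z * g z \<partial>m ?k)"
    using gB by (intro avg_avg_snd x) auto
  \<comment> \<open>The two-step density is kept where it multiplies the constant 1, because its
    total mass is one there, and is replaced by its lower bound \<open>e\<close> only where it
    multiplies the loss.\<close>
  also have "\<dots> \<le> (\<integral>z. B * (step2 j x z - e * \<delta> z) \<partial>m ?k)"
  proof (rule integral_mono)
    note st = step2_meas[OF x]
    note ist = integrable_step2[OF x]
    show "integrable (m ?k) (\<lambda>z. step2 j x z * g z)"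
    proof (rule integrable_m[of _ _ "1 / e * B"])
      show "norm (step2 j x z * g z) \<le> 1 / e * B" if "z \<in> space (m ?k)" for z
        unfolding norm_mult using step2_gt[OF x that] step2_le[OF x that] gB[OF that] e by (intro mult_mono) auto
    qed (use st in measurable)
    show "integrable (m ?k) (\<lambda>z. B * (step2 j x z - e * \<delta> z))"
      using \<delta>_bounds by (intro integrable_mult_right Bochner_Integration.integrable_diff ist integrable_m[of \<delta> _ 1]) auto
    show "step2 j x z * g z \<le> B * (step2 j x z - e * \<delta> z)" if z: "z \<in> space (m ?k)" for z
    proof -
      have "B * (e * \<delta> z) \<le> B * (step2 j x z * \<delta> z)"
        using step2_gt[OF x z] \<delta>_bounds[OF z] B0 by (intro mult_left_mono mult_right_mono) auto
      then show ?thesis unfolding g_def by (simp add: algebra_simps)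
    qed
  qed
  also have "\<dots> = B * (1 - e * (\<integral>z. \<delta> z \<partial>m ?k))"
  proof -
    note st = step2_meas[OF x]
    note ist = integrable_step2[OF x]
    have i\<delta>: "integrable (m ?k) \<delta>" using \<delta>_bounds by (intro integrable_m[of \<delta> _ 1]) auto
    have "(\<integral>z. step2 j x z * 1 \<partial>m ?k) = avg j (\<lambda>t. avg (Suc j) (\<lambda>_. 1) (snd t)) x"
      by (rule avg_avg_snd[OF x, of "\<lambda>_. 1" 1, symmetric]) auto
    also have "\<dots> = avg j (\<lambda>_. 1) x" by (rule avg_cong) (simp add: avg_def q_total)
    also have "\<dots> = 1" using q_total[OF x] by (simp add: avg_def)
    finally show ?thesis using ist i\<delta> by simp
  qed
  \<comment> \<open>The factor \<open>e ^ 4 / 4\<close> is \<open>e\<close> times the reciprocal of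
    the constant in \<open>dsq_le\<close>.\<close>
  also have "\<dots> \<le> B * (1 - e ^ 4 / 4 * dsq f \<xi> ?k)"
  proof (intro mult_left_mono B0 diff_left_mono)
    have "e ^ 4 / 4 * dsq f \<xi> ?k \<le> e ^ 4 / 4 * (4 / e ^ 3 * (\<integral>z. \<delta> z \<partial>m ?k))"
      unfolding \<delta>_def using e by (intro mult_left_mono dsq_le f) auto
    also have "\<dots> = e * (\<integral>z. \<delta> z \<partial>m ?k)" using e by (simp add: eval_nat_numeral)
    finally show "e ^ 4 / 4 * dsq f \<xi> ?k \<le> e * (\<integral>z. \<delta> z \<partial>m ?k)" .
  qed
  finally show ?thesis by (simp add: numeral_2_eq_2)
qed

section \<open>Measurability of bridges and of conditional hexagon integrals\<close>

lemma bdg_kernel [measurable]: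
  "(\<lambda>z. bdg k (fst z) (snd z)) \<in> m k \<Otimes>\<^sub>M m (Suc (Suc k)) \<rightarrow>\<^sub>M subprob_algebra (m (Suc k))"
proof (rule measurable_subprob_algebra)
  interpret m1: sigma_finite_measure "m (Suc k)" by (rule sigma_finite_m)
  show "subprob_space (bdg k (fst z) (snd z))" if "z \<in> space (m k \<Otimes>\<^sub>M m (Suc (Suc k)))" for z
    using that by (intro prob_space_imp_subprob_space prob_bdg) (auto simp: space_pair_measure)
  fix A assume A [measurable]: "A \<in> sets (m (Suc k))"
  have "(\<lambda>z. \<integral>\<^sup>+y. ennreal (q k (fst z, y) * q (Suc k) (y, snd z) / step2 k (fst z) (snd z)) * indicator A y \<partial>m (Suc k))
     \<in> borel_measurable (m k \<Otimes>\<^sub>M m (Suc (Suc k)))"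
    by measurable
  also have "?this \<longleftrightarrow> (\<lambda>z. emeasure (bdg k (fst z) (snd z)) A) \<in> borel_measurable (m k \<Otimes>\<^sub>M m (Suc (Suc k)))"
  proof (rule measurable_cong)
    fix z assume "z \<in> space (m k \<Otimes>\<^sub>M m (Suc (Suc k)))"
    then show "(\<integral>\<^sup>+y. ennreal (q k (fst z, y) * q (Suc k) (y, snd z) / step2 k (fst z) (snd z)) * indicator A y \<partial>m (Suc k))
       = emeasure (bdg k (fst z) (snd z)) A"
      unfolding bdg_def using A bdg_weight_measurable[of "fst z" k "snd z"]
      by (subst emeasure_density) (auto simp: space_pair_measure)
  qed
  finally show "(\<lambda>z. emeasure (bdg k (fst z) (snd z)) A) \<in> borel_measurable (m k \<Otimes>\<^sub>M m (Suc (Suc k)))" .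
qed simp

lemma bdg_kernel' [measurable (raw)]:
  assumes [measurable]: "u \<in> N \<rightarrow>\<^sub>M m k" "v \<in> N \<rightarrow>\<^sub>M m (Suc (Suc k))"
  shows "(\<lambda>x. bdg k (u x) (v x)) \<in> N \<rightarrow>\<^sub>M subprob_algebra (m (Suc k))"
  using measurable_compose[OF measurable_Pair[OF assms] bdg_kernel] by simp

lemma bdg_integral_meas:
  assumes "(\<lambda>z. f (fst z) (snd z)) \<in> borel_measurable (N \<Otimes>\<^sub>M m (Suc k))"
    and "u \<in> N \<rightarrow>\<^sub>M m k" "v \<in> N \<rightarrow>\<^sub>M m (Suc (Suc k))"
  shows "(\<lambda>x. \<integral>\<^sup>+y. f x y \<partial>bdg k (u x) (v x)) \<in> borel_measurable N"
  using assms by (intro nn_integral_measurable_subprob_algebra2[OF _ bdg_kernel']) (simp_all add: case_prod_unfold)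

text \<open>The conditional expectation of a hexagon observable given the first edge, which later is
  frozen at a reference path.\<close>

definition hexcond :: "nat \<Rightarrow> ('a hexagon \<Rightarrow> ennreal) \<Rightarrow> 'a \<times> 'a \<Rightarrow> ennreal" where
  "hexcond k \<Phi> s = (\<integral>\<^sup>+t. \<integral>\<^sup>+c. \<integral>\<^sup>+b'. \<Phi> (fst s, snd s, c, b', fst t, snd t)
      \<partial>bdg k (fst s) (fst t) \<partial>bdg (Suc k) (snd s) (snd t) \<partial>pairs (Suc (Suc k)))"

lemma hexint_hexcond: "hexint k \<Phi> = (\<integral>\<^sup>+s. hexcond k \<Phi> s \<partial>pairs k)"
  by (simp add: hexint_def hexcond_def)

lemma hexcond_measurable:
  assumes \<Phi>: "\<Phi> \<in> borel_measurable (hexagons k)"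
  shows "(\<lambda>z. \<integral>\<^sup>+b'. \<Phi> (fst (fst (fst z)), snd (fst (fst z)), snd z, b', fst (snd (fst z)), snd (snd (fst z)))
      \<partial>bdg k (fst (fst (fst z))) (fst (snd (fst z))))
      \<in> borel_measurable ((pairs k \<Otimes>\<^sub>M pairs (Suc (Suc k))) \<Otimes>\<^sub>M m (Suc (Suc k)))" (is ?inner)
    and "(\<lambda>z. \<integral>\<^sup>+c. \<integral>\<^sup>+b'. \<Phi> (fst (fst z), snd (fst z), c, b', fst (snd z), snd (snd z))
      \<partial>bdg k (fst (fst z)) (fst (snd z)) \<partial>bdg (Suc k) (snd (fst z)) (snd (snd z)))
      \<in> borel_measurable (pairs k \<Otimes>\<^sub>M pairs (Suc (Suc k)))" (is ?middle)
    and "hexcond k \<Phi> \<in> borel_measurable (pairs k)" (is ?outer)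
proof -
  let ?m0 = "m k" and ?m1 = "m (Suc k)" and ?m2 = "m (Suc (Suc k))" and ?m3 = "m (Suc (Suc (Suc k)))"
  have [measurable]: "\<Phi> \<in> borel_measurable (?m0 \<Otimes>\<^sub>M ?m1 \<Otimes>\<^sub>M ?m2 \<Otimes>\<^sub>M ?m1 \<Otimes>\<^sub>M ?m2 \<Otimes>\<^sub>M ?m3)"
    using \<Phi> unfolding hexagons_def .
  interpret p2: prob_space "pairs (Suc (Suc k))" by (rule prob_pairs)
  show I3: ?inner
    by (rule bdg_integral_meas) measurable
  show I2: ?middle
    by (rule bdg_integral_meas[OF I3]) measurable
  show ?outer
    using p2.borel_measurable_nn_integral_fst[OF I2] by (simp add: hexcond_def[abs_def])
qed

text \<open>As \<open>hexint\<close> is an iterated integral, a constant has to pass through four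
  levels, and each level requires the measurability of the integral inside it.\<close>

lemma hexint_cmult:
  assumes \<Phi>: "\<Phi> \<in> borel_measurable (hexagons k)"
  shows "hexint k (\<lambda>P. C * \<Phi> P) = C * hexint k \<Phi>"
proof -
  let ?m0 = "m k" and ?m1 = "m (Suc k)" and ?m2 = "m (Suc (Suc k))" and ?m3 = "m (Suc (Suc (Suc k)))"
  have [measurable]: "\<Phi> \<in> borel_measurable (?m0 \<Otimes>\<^sub>M ?m1 \<Otimes>\<^sub>M ?m2 \<Otimes>\<^sub>M ?m1 \<Otimes>\<^sub>M ?m2 \<Otimes>\<^sub>M ?m3)"
    using \<Phi> unfolding hexagons_def .
  let ?I3 = "\<lambda>s t c. \<integral>\<^sup>+b'. \<Phi> (fst s, snd s, c, b', fst t, snd t) \<partial>bdg k (fst s) (fst t)"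
  let ?I2 = "\<lambda>s t. \<integral>\<^sup>+c. ?I3 s t c \<partial>bdg (Suc k) (snd s) (snd t)"
  note I3 = hexcond_measurable(1)[OF \<Phi>] and I2 = hexcond_measurable(2)[OF \<Phi>]
  have "hexint k (\<lambda>P. C * \<Phi> P) = (\<integral>\<^sup>+s. \<integral>\<^sup>+t. C * ?I2 s t \<partial>pairs (Suc (Suc k)) \<partial>pairs k)"
    unfolding hexint_def
  proof (rule nn_integral_cong, rule nn_integral_cong)
    fix s t assume s: "s \<in> space (pairs k)" and t: "t \<in> space (pairs (Suc (Suc k)))"
    have [measurable]: "fst s \<in> space ?m0" "snd s \<in> space ?m1" "fst t \<in> space ?m2" "snd t \<in> space ?m3"
      using s t by auto
    have "(\<integral>\<^sup>+c. \<integral>\<^sup>+b'. C * \<Phi> (fst s, snd s, c, b', fst t, snd t) \<partial>bdg k (fst s) (fst t) \<partial>bdg (Suc k) (snd s) (snd t))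
      = (\<integral>\<^sup>+c. C * ?I3 s t c \<partial>bdg (Suc k) (snd s) (snd t))"
    proof (rule nn_integral_cong)
      fix c assume "c \<in> space (bdg (Suc k) (snd s) (snd t))"
      then have [measurable]: "c \<in> space ?m2" by simp
      have "(\<lambda>b'. \<Phi> (fst s, snd s, c, b', fst t, snd t)) \<in> borel_measurable ?m1" by measurable
      then show "(\<integral>\<^sup>+b'. C * \<Phi> (fst s, snd s, c, b', fst t, snd t) \<partial>bdg k (fst s) (fst t)) = C * ?I3 s t c"
        by (intro nn_integral_cmult) simp
    qed
    also have "\<dots> = C * ?I2 s t"
    proof -
      have "(s, t) \<in> space (pairs k \<Otimes>\<^sub>M pairs (Suc (Suc k)))" using s t by (simp add: space_pair_measure)
      from measurable_compose[OF measurable_Pair1'[OF this] I3] show ?thesis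
        by (intro nn_integral_cmult) simp
    qed
    finally show "(\<integral>\<^sup>+c. \<integral>\<^sup>+b'. C * \<Phi> (fst s, snd s, c, b', fst t, snd t) \<partial>bdg k (fst s) (fst t) \<partial>bdg (Suc k) (snd s) (snd t))
      = C * ?I2 s t" .
  qed
  also have "\<dots> = (\<integral>\<^sup>+s. C * hexcond k \<Phi> s \<partial>pairs k)"
    unfolding hexcond_def
    using measurable_compose[OF measurable_Pair1' I2] by (intro nn_integral_cong nn_integral_cmult) simp
  also have "\<dots> = C * hexint k \<Phi>"
    unfolding hexint_hexcond by (rule nn_integral_cmult[OF hexcond_measurable(3)[OF \<Phi>]])
  finally show ?thesis .
qed

lemma dsq_double_le:
  assumes f [measurable]: "\<And>k. f k \<in> borel_measurable (mm k)"
  shows "dsq f (2 * \<xi>) k \<le> 4 * dsq f \<xi> k"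
proof -
  have [measurable]: "hexbal f k \<in> borel_measurable (hexagons k)" by (rule hexbal_measurable[OF f])
  have "ennreal (dsq f (2 * \<xi>) k) \<le> hexint k (\<lambda>P. ennreal 4 * ennreal ((cmod (cis (\<xi> * hexbal f k P) - 1))\<^sup>2))"
    unfolding ennreal_dsq
  proof (rule hexint_mono)
    fix P
    show "ennreal ((cmod (cis (2 * \<xi> * hexbal f k P) - 1))\<^sup>2) \<le> ennreal 4 * ennreal ((cmod (cis (\<xi> * hexbal f k P) - 1))\<^sup>2)"
      using norm_cis_double_minus_1_le[of "\<xi> * hexbal f k P"]
      by (subst ennreal_mult[symmetric]) (auto intro!: ennreal_leI simp: mult.assoc)
  qed
  also have "\<dots> = ennreal 4 * hexint k (\<lambda>P. ennreal ((cmod (cis (\<xi> * hexbal f k P) - 1))\<^sup>2))"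
    by (rule hexint_cmult) measurable
  also have "\<dots> = ennreal (4 * dsq f \<xi> k)"
    unfolding ennreal_dsq[symmetric] using dsq_nonneg by (subst ennreal_mult) auto
  finally show ?thesis using dsq_nonneg by (subst (asm) ennreal_le_iff) auto
qed

lemma dsq_le_4: "dsq f \<xi> k \<le> 4"
proof -
  have "ennreal (dsq f \<xi> k) \<le> hexint k (\<lambda>_. ennreal 4)"
    unfolding ennreal_dsq using cis_minus_1_sq_le by (intro hexint_mono ennreal_leI) auto
  then show ?thesis unfolding hexint_const by (subst (asm) ennreal_le_iff) auto
qed

section \<open>Characteristic functions of partial sums\<close>

definition psum :: "(nat \<Rightarrow> 'a \<times> 'a \<Rightarrow> real) \<Rightarrow> nat \<Rightarrow> 'w \<Rightarrow> real" where
  "psum f N \<omega> = (\<Sum>k<N. f k (YY k \<omega>))"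

lemma psum_F:
  assumes [measurable]: "\<And>k. f k \<in> borel_measurable (mm k)"
  shows "psum f N \<in> borel_measurable (F N)"
  unfolding psum_def by (intro borel_measurable_sum pair_meas_F) auto

text \<open>After \<open>r\<close> initial steps, blocks of five steps are laid end to end and each
  contributes one factor. The hexagon of a block begins two steps into it, whence the
  \<open>+ 2\<close>; the initial steps do not increase the supremum.\<close>

lemma characteristic_function_bound:
  assumes f [measurable]: "\<And>k. f k \<in> borel_measurable (mm k)"
  shows "cmod (\<integral>\<omega>. cis (\<xi> * psum f (r + 5 * J) \<omega>) \<partial>M) \<le> (\<Prod>i<J. 1 - e ^ 4 / 4 * dsq f \<xi> (r + 5 * i + 2))"
proof -
  let ?N = "r + 5 * J" and ?b = "\<lambda>i. 1 - e ^ 4 / 4 * dsq f \<xi> (r + 5 * i + 2)"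
  obtain U :: "nat \<Rightarrow> 'a \<Rightarrow> complex" where U_ge: "\<And>k. ?N \<le> k \<Longrightarrow> U k = (\<lambda>_. 1)"
    and U_lt: "\<And>k. k < ?N \<Longrightarrow> U k = Lop f \<xi> k (U (Suc k))"
    using backward_recursion[where N = ?N and z = "\<lambda>_. 1" and A = "Lop f \<xi>"] by metis
  have "U k \<in> borel_measurable (m k) \<and> (\<forall>x\<in>space (m k). cmod (U k x) \<le> 1)" for k
  proof (cases "k \<le> ?N")
    case True
    then show ?thesis
    proof (induction rule: inc_induct)
      case base
      show ?case by (simp add: U_ge)
    next
      case (step k)
      then show ?case using U_lt[of k] by (auto intro!: Lop_meas Lop_bound f)
    qed
  qed (simp add: U_ge)
  then have U_meas [measurable]: "\<And>k. U k \<in> borel_measurable (m k)"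
    and U1: "\<And>k x. x \<in> space (m k) \<Longrightarrow> cmod (U k x) \<le> 1" by blast+
  \<comment> \<open>The expectation of the phase collected up to time \<open>k\<close>, times the
    conditional phase of the rest, does not depend on \<open>k\<close>.\<close>
  have step: "(\<integral>\<omega>. cis (\<xi> * psum f k \<omega>) * U k (Y k \<omega>) \<partial>M) =
      (\<integral>\<omega>. cis (\<xi> * psum f (Suc k) \<omega>) * U (Suc k) (Y (Suc k) \<omega>) \<partial>M)" if "k < ?N" for k
  proof -
    note psum_F[OF f, of k, measurable]
    have "(\<integral>\<omega>. cis (\<xi> * psum f k \<omega>) * (\<lambda>z. cis (\<xi> * f k z) * U (Suc k) (snd z)) (YY k \<omega>) \<partial>M)
      = (\<integral>\<omega>. cis (\<xi> * psum f k \<omega>) * avg k (\<lambda>z. cis (\<xi> * f k z) * U (Suc k) (snd z)) (Y k \<omega>) \<partial>M)"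
    proof (rule markov_avg[where C = 1 and D = 1])
      show "(\<lambda>\<omega>. cis (\<xi> * psum f k \<omega>)) \<in> borel_measurable (F k)" by measurable
      show "(\<lambda>z. cis (\<xi> * f k z) * U (Suc k) (snd z)) \<in> borel_measurable (mm k)" by measurable
    qed (use U1 in \<open>auto simp: norm_mult\<close>)
    also have "\<dots> = (\<integral>\<omega>. cis (\<xi> * psum f k \<omega>) * U k (Y k \<omega>) \<partial>M)"
      unfolding U_lt[OF that] Lop_def ..
    finally show ?thesis by (simp add: psum_def distrib_left cis_mult[symmetric] mult_ac)
  qed
  have "(\<integral>\<omega>. cis (\<xi> * psum f k \<omega>) * U k (Y k \<omega>) \<partial>M) = (\<integral>\<omega>. U 0 (Y 0 \<omega>) \<partial>M)" if "k \<le> ?N" for k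
    using that by (induction k) (simp_all add: psum_def[of _ 0] step)
  from this[of ?N] have E: "(\<integral>\<omega>. cis (\<xi> * psum f ?N \<omega>) \<partial>M) = (\<integral>\<omega>. U 0 (Y 0 \<omega>) \<partial>M)"
    by (simp add: U_ge)
  have bnd: "\<forall>x\<in>space (m (r + 5 * i)). cmod (U (r + 5 * i) x) \<le> (\<Prod>j=i..<J. ?b j)" if "i \<le> J" for i
    using that
  proof (induction rule: inc_induct)
    case base
    show ?case by (simp add: U_ge)
  next
    case (step n)
    show ?case
    proof
      fix x assume x: "x \<in> space (m (r + 5 * n))"
      have "cmod (U (r + 5 * n) x) \<le> (\<Prod>j=Suc n..<J. ?b j) * (1 - e ^ 4 / 4 * dsq f \<xi> (r + 5 * n + 2))"
      proof (rule five_step_contraction[OF f U_meas _ _ x])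
        show "U (r + 5 * n + i) = Lop f \<xi> (r + 5 * n + i) (U (Suc (r + 5 * n + i)))" if "i < 5" for i
          using step.hyps that by (intro U_lt) auto
        show "cmod (U (r + 5 * n + 5) y) \<le> (\<Prod>j=Suc n..<J. ?b j)" if "y \<in> space (m (r + 5 * n + 5))" for y
          using step.IH that by (simp add: add.commute add.left_commute)
      qed
      then show "cmod (U (r + 5 * n) x) \<le> (\<Prod>j=n..<J. ?b j)"
        using step.hyps by (simp add: prod.atLeast_Suc_lessThan mult.commute)
    qed
  qed
  have "\<forall>x\<in>space (m k). cmod (U k x) \<le> (\<Prod>j<J. ?b j)" if "k \<le> r" for k
    using that
  proof (induction rule: inc_induct)
    case base
    show ?case using bnd[of 0] by (simp add: atLeast0LessThan)
  next
    case (step k)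
    then show ?case using U_lt[of k] by (auto intro!: Lop_bound f)
  qed
  from this[of 0] have U0: "cmod (U 0 (Y 0 \<omega>)) \<le> (\<Prod>j<J. ?b j)" if "\<omega> \<in> space M" for \<omega>
    using space_Y[OF that] by simp
  have "cmod (\<integral>\<omega>. cis (\<xi> * psum f ?N \<omega>) \<partial>M) \<le> (\<integral>\<omega>. cmod (U 0 (Y 0 \<omega>)) \<partial>M)"
    unfolding E by (rule integral_norm_bound)
  also have "\<dots> \<le> (\<integral>\<omega>. (\<Prod>j<J. ?b j) \<partial>M)"
    by (rule integral_mono[OF integrable_norm[OF integrable_bounded[of _ 1]]])
       (use U0 U1 space_Y in auto)
  finally show ?thesis by (simp add: prob_space)
qed

text \<open>For each residue \<open>r\<close> modulo 5, a product that stays above 1/2 limits the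
  sum of the corresponding terms to \<open>ln 2\<close> divided by the contraction constant. The
  five residues together cover all indices from 2 on.\<close>

lemma summable_dsq_small:
  assumes f: "\<And>k. f k \<in> borel_measurable (mm k)"
    and lower: "\<And>N. 1 / 2 \<le> cmod (\<integral>\<omega>. cis (\<xi> * psum f N \<omega>) \<partial>M)"
  shows "summable (dsq f \<xi>)"
proof -
  let ?g = "\<lambda>k. dsq f \<xi> (k + 2)"
  let ?c = "e ^ 4 / 4"
  have c: "0 < ?c" using e by simp
  \<comment> \<open>The factors of the product must be nonnegative to be compared with
    exponentials.\<close>
  have cd: "?c * dsq f \<xi> k \<le> 1" for k
  proof -
    have "?c * dsq f \<xi> k \<le> ?c * 4" using dsq_le_4 c by (intro mult_left_mono) auto
    also have "\<dots> \<le> 1" using e by (simp add: power_le_one)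
    finally show ?thesis .
  qed
  have res: "(\<Sum>i<J. ?g (5 * i + r)) \<le> ln 2 / ?c" for r J
  proof -
    have "1 / 2 \<le> (\<Prod>i<J. 1 - ?c * dsq f \<xi> (r + 5 * i + 2))"
      using order_trans[OF lower characteristic_function_bound[OF f]] .
    also have "\<dots> \<le> exp (- (\<Sum>i<J. ?c * dsq f \<xi> (r + 5 * i + 2)))"
      using cd by (intro prod_one_minus_le_exp) auto
    finally have "ln (1 / 2) \<le> ln (exp (- (\<Sum>i<J. ?c * dsq f \<xi> (r + 5 * i + 2))))"
      by (subst ln_le_cancel_iff) auto
    then have "?c * (\<Sum>i<J. ?g (5 * i + r)) \<le> ln 2"
      by (simp add: ln_div sum_distrib_left add_ac del: times_divide_eq_left)
    then show ?thesis using c by (simp add: field_simps)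
  qed
  have split: "(\<Sum>k<5 * J. ?g k) = (\<Sum>i<J. ?g (5 * i)) + (\<Sum>i<J. ?g (5 * i + 1)) + (\<Sum>i<J. ?g (5 * i + 2)) +
      (\<Sum>i<J. ?g (5 * i + 3)) + (\<Sum>i<J. ?g (5 * i + 4))" for J
    by (induction J) (simp_all add: eval_nat_numeral)
  have "summable ?g"
  proof (rule summableI_nonneg_bounded)
    show "0 \<le> ?g k" for k by (rule dsq_nonneg)
    fix n
    have "(\<Sum>k<n. ?g k) \<le> (\<Sum>k<5 * n. ?g k)" by (intro sum_mono2) (auto simp: dsq_nonneg)
    also have "\<dots> \<le> 5 * (ln 2 / ?c)"
    proof -
      have "(\<Sum>i<n. ?g (5 * i + 0)) \<le> ln 2 / ?c" "(\<Sum>i<n. ?g (5 * i + 1)) \<le> ln 2 / ?c"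
        "(\<Sum>i<n. ?g (5 * i + 2)) \<le> ln 2 / ?c" "(\<Sum>i<n. ?g (5 * i + 3)) \<le> ln 2 / ?c"
        "(\<Sum>i<n. ?g (5 * i + 4)) \<le> ln 2 / ?c"
        by (rule res)+
      then show ?thesis unfolding split by simp
    qed
    finally show "(\<Sum>k<n. ?g k) \<le> 5 * (ln 2 / ?c)" .
  qed
  then show ?thesis by (simp only: summable_iff_shift)
qed

lemma summable_dsq_of_tight:
  assumes f [measurable]: "\<And>k. f k \<in> borel_measurable (mm k)"
    and tight: "\<And>\<epsilon>. 0 < \<epsilon> \<Longrightarrow> \<exists>K. \<forall>N\<ge>1. \<P>(\<omega> in M. K < \<bar>psum f N \<omega> - c N\<bar>) < \<epsilon>"
  shows "summable (dsq f \<xi>)"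
proof -
  have psum_M [measurable]: "psum f N \<in> borel_measurable M" for N by (rule F_to_M[OF psum_F[OF f]])
  \<comment> \<open>The constants make the characteristic function of the centered sum differ from 1
    by at most 1/4 + 2 * 1/8: off the exceptional event the choice of \<open>\<delta>\<close> keeps
    the phase within 1/4 of 1, and on it the distance is at most 2.\<close>
  obtain K where K: "\<And>N. N \<ge> 1 \<Longrightarrow> \<P>(\<omega> in M. K < \<bar>psum f N \<omega> - c N\<bar>) < 1 / 8"
    using tight[of "1 / 8"] by auto
  define \<delta> where "\<delta> = 1 / (4 * (\<bar>K\<bar> + 1))"
  have \<delta>: "\<delta> > 0" by (simp add: \<delta>_def)
  have small: "summable (dsq f \<xi>)" if \<xi>: "\<bar>\<xi>\<bar> \<le> \<delta>" for \<xi>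
  proof (rule summable_dsq_small[OF f])
    fix N
    show "1 / 2 \<le> cmod (\<integral>\<omega>. cis (\<xi> * psum f N \<omega>) \<partial>M)"
    proof (cases "N = 0")
      case False
      let ?Z = "\<lambda>\<omega>. psum f N \<omega> - c N"
      let ?A = "{\<omega> \<in> space M. K < \<bar>?Z \<omega>\<bar>}"
      have A [measurable]: "?A \<in> sets M" by measurable
      have int: "integrable M (\<lambda>\<omega>. cis (\<xi> * ?Z \<omega>))" by (rule integrable_bounded[of _ 1]) auto
      have "cmod ((\<integral>\<omega>. cis (\<xi> * ?Z \<omega>) \<partial>M) - 1) = cmod (\<integral>\<omega>. cis (\<xi> * ?Z \<omega>) - 1 \<partial>M)"
        using int by (simp add: prob_space)
      also have "\<dots> \<le> (\<integral>\<omega>. cmod (cis (\<xi> * ?Z \<omega>) - 1) \<partial>M)" by (rule integral_norm_bound)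
      also have "\<dots> \<le> (\<integral>\<omega>. 1 / 4 + 2 * indicator ?A \<omega> \<partial>M)"
      proof (rule integral_mono)
        show "integrable M (\<lambda>\<omega>. cmod (cis (\<xi> * ?Z \<omega>) - 1))" using int by simp
        show "integrable M (\<lambda>\<omega>. 1 / 4 + 2 * indicator ?A \<omega> :: real)"
          using A by (intro Bochner_Integration.integrable_add integrable_mult_right integrable_real_indicator)
            (auto simp: emeasure_eq_measure)
        fix \<omega> assume \<omega>: "\<omega> \<in> space M"
        show "cmod (cis (\<xi> * ?Z \<omega>) - 1) \<le> 1 / 4 + 2 * indicator ?A \<omega>"
        proof (cases "\<omega> \<in> ?A")
          case True
          have "cmod (cis (\<xi> * ?Z \<omega>) - 1) \<le> 1 + 1" by (rule order_trans[OF norm_triangle_ineq4]) simp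
          then show ?thesis using True by (simp add: indicator_def)
        next
          case False
          then have ZK: "\<bar>?Z \<omega>\<bar> \<le> K" using \<omega> by auto
          have "(cmod (cis (\<xi> * ?Z \<omega>) - 1))\<^sup>2 \<le> (\<xi> * ?Z \<omega>)\<^sup>2"
          proof -
            have "cos (\<xi> * ?Z \<omega>) = 1 - 2 * (sin (\<xi> * ?Z \<omega> / 2))\<^sup>2" using cos_double_sin[of "\<xi> * ?Z \<omega> / 2"] by simp
            moreover have "(sin (\<xi> * ?Z \<omega> / 2))\<^sup>2 \<le> (\<xi> * ?Z \<omega> / 2)\<^sup>2"
              using abs_sin_x_le_abs_x[of "\<xi> * ?Z \<omega> / 2"] by (simp only: abs_le_square_iff)
            ultimately show ?thesis unfolding norm_cis_minus_1_sq by (simp add: power_divide)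
          qed
          then have "cmod (cis (\<xi> * ?Z \<omega>) - 1) \<le> \<bar>\<xi> * ?Z \<omega>\<bar>"
            by (metis abs_le_square_iff abs_norm_cancel)
          also have "\<dots> \<le> \<delta> * (\<bar>K\<bar> + 1)"
            unfolding abs_mult using \<xi> ZK \<delta> by (intro mult_mono) auto
          also have "\<dots> \<le> 1 / 4" unfolding \<delta>_def by (simp add: field_simps)
          finally show ?thesis using False by (simp add: indicator_def)
        qed
      qed
      also have "\<dots> = 1 / 4 + 2 * measure M ?A"
        using A by (subst Bochner_Integration.integral_add) (auto simp: prob_space emeasure_eq_measure)
      also have "\<dots> \<le> 1 / 2" using K[of N] False by simp
      finally have "cmod ((\<integral>\<omega>. cis (\<xi> * ?Z \<omega>) \<partial>M) - 1) \<le> 1 / 2" .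
      then have "1 / 2 \<le> cmod (\<integral>\<omega>. cis (\<xi> * ?Z \<omega>) \<partial>M)"
        using norm_triangle_sub[of 1 "\<integral>\<omega>. cis (\<xi> * ?Z \<omega>) \<partial>M"] by (simp add: norm_minus_commute)
      \<comment> \<open>The centering contributes only a factor of modulus one.\<close>
      also have "(\<integral>\<omega>. cis (\<xi> * ?Z \<omega>) \<partial>M) = (\<integral>\<omega>. cis (- \<xi> * c N) * cis (\<xi> * psum f N \<omega>) \<partial>M)"
        by (intro Bochner_Integration.integral_cong refl) (simp add: cis_mult right_diff_distrib)
      also have "\<dots> = cis (- \<xi> * c N) * (\<integral>\<omega>. cis (\<xi> * psum f N \<omega>) \<partial>M)"
        by (rule integral_mult_right_zero)
      finally show ?thesis by (simp add: norm_mult)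
    qed (simp add: psum_def prob_space)
  qed
  have double: "summable (dsq f \<xi>) \<Longrightarrow> summable (dsq f (2 ^ n * \<xi>))" for n \<xi>
  proof (induction n)
    case (Suc n)
    have "summable (\<lambda>k. 4 * dsq f (2 ^ n * \<xi>) k)" using Suc by (intro summable_mult) auto
    then show ?case
    proof (rule summable_comparison_test'[where N = 0])
      show "norm (dsq f (2 ^ Suc n * \<xi>) k) \<le> 4 * dsq f (2 ^ n * \<xi>) k" for k
        using dsq_double_le[OF f, of "2 ^ n * \<xi>" k] dsq_nonneg by (simp add: mult.assoc)
    qed
  qed simp
  \<comment> \<open>Enough halvings bring \<open>\<xi>\<close> into the small interval; each of the
    doublings back costs a factor 4.\<close>
  obtain n where n: "\<bar>\<xi>\<bar> / \<delta> < 2 ^ n" using real_arch_pow[of 2 "\<bar>\<xi>\<bar> / \<delta>"] by auto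
  have "summable (dsq f (2 ^ n * (\<xi> / 2 ^ n)))"
    using n \<delta> by (intro double small) (simp add: field_simps)
  then show ?thesis by simp
qed

section \<open>Reduction to a lattice-valued functional\<close>

lemma hexint_Y:
  assumes \<Phi>: "\<Phi> \<in> borel_measurable (hexagons k)"
  shows "hexint k \<Phi> = (\<integral>\<^sup>+\<omega>. hexcond k \<Phi> (YY k \<omega>) \<partial>M)"
    and "(\<lambda>\<omega>. hexcond k \<Phi> (YY k \<omega>)) \<in> borel_measurable M"
proof -
  have h [measurable]: "hexcond k \<Phi> \<in> borel_measurable (mm k)"
    using hexcond_measurable(3)[OF \<Phi>] by simp
  show "hexint k \<Phi> = (\<integral>\<^sup>+\<omega>. hexcond k \<Phi> (YY k \<omega>) \<partial>M)"
    unfolding hexint_hexcond pairs_def by (subst nn_integral_distr) auto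
  show "(\<lambda>\<omega>. hexcond k \<Phi> (YY k \<omega>)) \<in> borel_measurable M" by measurable
qed

text \<open>The mean phase of two steps of \<open>f\<close> over the bridge from \<open>z\<close> to
  \<open>x\<close>. The explicit density makes measurability in \<open>x\<close> immediate;
  \<open>bphase_eq\<close> gives the form as an integral over the bridge.\<close>

definition bphase :: "(nat \<Rightarrow> 'a \<times> 'a \<Rightarrow> real) \<Rightarrow> real \<Rightarrow> nat \<Rightarrow> 'a \<Rightarrow> 'a \<Rightarrow> complex" where
  "bphase f \<xi> k z x = (\<integral>y. (q k (z, y) * q (Suc k) (y, x) / step2 k z x) *\<^sub>R cis (\<xi> * (f k (z, y) + f (Suc k) (y, x))) \<partial>m (Suc k))"

lemma bphase_meas:
  assumes [measurable]: "\<And>k. f k \<in> borel_measurable (mm k)" and [measurable]: "z \<in> space (m k)"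
  shows "bphase f \<xi> k z \<in> borel_measurable (m (Suc (Suc k)))"
proof -
  interpret m1: sigma_finite_measure "m (Suc k)" by (rule sigma_finite_m)
  have st [measurable]: "(\<lambda>t. step2 k z (fst t)) \<in> borel_measurable (m (Suc (Suc k)) \<Otimes>\<^sub>M m (Suc k))"
    by (rule measurable_compose[OF measurable_fst step2_meas[OF assms(2)]])
  have "(\<lambda>(x, y). (q k (z, y) * q (Suc k) (y, x) / step2 k z x) *\<^sub>R cis (\<xi> * (f k (z, y) + f (Suc k) (y, x))))
     \<in> borel_measurable (m (Suc (Suc k)) \<Otimes>\<^sub>M m (Suc k))"
    unfolding case_prod_unfold by measurable
  from m1.borel_measurable_lebesgue_integral[OF this] show ?thesis
    unfolding bphase_def[abs_def] by simp
qed

lemma bphase_eq: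
  assumes [measurable]: "\<And>k. f k \<in> borel_measurable (mm k)"
    and z [measurable]: "z \<in> space (m k)" and x [measurable]: "x \<in> space (m (Suc (Suc k)))"
  shows "bphase f \<xi> k z x = (\<integral>y. cis (\<xi> * (f k (z, y) + f (Suc k) (y, x))) \<partial>bdg k z x)"
proof -
  have "(\<lambda>y. cis (\<xi> * (f k (z, y) + f (Suc k) (y, x)))) \<in> borel_measurable (m (Suc k))" by measurable
  moreover have "AE y in m (Suc k). 0 \<le> q k (z, y) * q (Suc k) (y, x) / step2 k z x"
    using bdg_weight_bounds(1)[OF z _ x] by (rule AE_I2)
  ultimately show ?thesis
    unfolding bphase_def bdg_def by (rule integral_density[OF _ bdg_weight_measurable[OF z x], symmetric])
qed

lemma bphase_le:
  assumes f: "\<And>k. f k \<in> borel_measurable (mm k)"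
    and z: "z \<in> space (m k)" and x: "x \<in> space (m (Suc (Suc k)))"
  shows "cmod (bphase f \<xi> k z x) \<le> 1"
proof -
  interpret b: prob_space "bdg k z x" by (rule prob_bdg[OF z x])
  have "cmod (bphase f \<xi> k z x) \<le> (\<integral>y. cmod (cis (\<xi> * (f k (z, y) + f (Suc k) (y, x)))) \<partial>bdg k z x)"
    unfolding bphase_eq[OF f z x] by (rule integral_norm_bound)
  then show ?thesis by (simp add: b.prob_space[simplified])
qed

text \<open>
  Averaging a hexagon over its two independent bridges turns it into a relation between \<open>f\<^bsub>k+2\<^esub>\<close> and
  the phases at its end points.
\<close>

lemma hexcond_phase:
  assumes f [measurable]: "\<And>k. f k \<in> borel_measurable (mm k)"
    and s: "s \<in> space (pairs k)"
  shows "hexcond k (\<lambda>P. ennreal ((cmod (cis (\<xi> * hexbal f k P) - 1))\<^sup>2)) s =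
    (\<integral>\<^sup>+t. ennreal (2 - 2 * Re (cis (\<xi> * (f k s - f (Suc (Suc k)) t)) *
        bphase f \<xi> (Suc k) (snd s) (snd t) * cnj (bphase f \<xi> k (fst s) (fst t)))) \<partial>pairs (Suc (Suc k)))"
  unfolding hexcond_def
proof (rule nn_integral_cong)
  fix t assume t: "t \<in> space (pairs (Suc (Suc k)))"
  have sp [measurable]: "fst s \<in> space (m k)" "snd s \<in> space (m (Suc k))"
    "fst t \<in> space (m (Suc (Suc k)))" "snd t \<in> space (m (Suc (Suc (Suc k))))"
    using s t by auto
  let ?A = "bdg (Suc k) (snd s) (snd t)" and ?B = "bdg k (fst s) (fst t)"
  interpret A: prob_space ?A by (rule prob_bdg) fact+
  interpret B: prob_space ?B by (rule prob_bdg) fact+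
  let ?\<kappa> = "\<xi> * (f k s - f (Suc (Suc k)) t)"
  let ?\<phi> = "\<lambda>c. \<xi> * (f (Suc k) (snd s, c) + f (Suc (Suc k)) (c, snd t))"
  let ?\<psi> = "\<lambda>b. \<xi> * (f k (fst s, b) + f (Suc k) (b, fst t))"
  have "\<xi> * hexbal f k (fst s, snd s, c, b', fst t, snd t) = ?\<kappa> + ?\<phi> c - ?\<psi> b'" for c b'
    by (cases s; cases t) (simp add: hexbal_def algebra_simps)
  then have "(\<integral>\<^sup>+c. \<integral>\<^sup>+b'. ennreal ((cmod (cis (\<xi> * hexbal f k (fst s, snd s, c, b', fst t, snd t)) - 1))\<^sup>2) \<partial>?B \<partial>?A)
    = (\<integral>\<^sup>+c. \<integral>\<^sup>+b'. ennreal ((cmod (cis (?\<kappa> + ?\<phi> c - ?\<psi> b') - 1))\<^sup>2) \<partial>?B \<partial>?A)"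
    by simp
  also have "\<dots> = ennreal (2 * measure ?A (space ?A) * measure ?B (space ?B) -
      2 * Re (cis ?\<kappa> * (\<integral>c. cis (?\<phi> c) \<partial>?A) * cnj (\<integral>b. cis (?\<psi> b) \<partial>?B)))"
    by (rule nn_integral_phase_difference[OF A.finite_measure_axioms B.finite_measure_axioms]) measurable
  also have "\<dots> = ennreal (2 - 2 * Re (cis ?\<kappa> * bphase f \<xi> (Suc k) (snd s) (snd t) * cnj (bphase f \<xi> k (fst s) (fst t))))"
    using A.prob_space B.prob_space bphase_eq[OF f sp(1,3)] bphase_eq[OF f sp(2,4)] by simp
  finally show "(\<integral>\<^sup>+c. \<integral>\<^sup>+b'. ennreal ((cmod (cis (\<xi> * hexbal f k (fst s, snd s, c, b', fst t, snd t)) - 1))\<^sup>2) \<partial>?B \<partial>?A)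
    = ennreal (2 - 2 * Re (cis ?\<kappa> * bphase f \<xi> (Suc k) (snd s) (snd t) * cnj (bphase f \<xi> k (fst s) (fst t))))" .
qed

text \<open>Along the chain, the expectations of the conditional terms add up to the sum of
  \<open>dsq\<close>. Their sum is therefore almost surely finite, and one sample point supplies
  \<open>z\<close>. Taking all edges from one trajectory makes consecutive edges share a
  point.\<close>

lemma obtain_reference_path:
  assumes f [measurable]: "\<And>k. f k \<in> borel_measurable (mm k)"
    and sm: "summable (dsq f \<xi>)"
  obtains z where "\<And>k. z k \<in> space (m k)"
    "(\<Sum>k. hexcond k (\<lambda>P. ennreal ((cmod (cis (\<xi> * hexbal f k P) - 1))\<^sup>2)) (z k, z (Suc k))) < top"
proof -
  let ?\<Phi> = "\<lambda>k P. ennreal ((cmod (cis (\<xi> * hexbal f k P) - 1))\<^sup>2)"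
  have \<Phi>: "?\<Phi> k \<in> borel_measurable (hexagons k)" for k
    using hexbal_measurable[OF f] by measurable
  let ?H = "\<lambda>k \<omega>. hexcond k (?\<Phi> k) (YY k \<omega>)"
  have H [measurable]: "?H k \<in> borel_measurable M" for k by (rule hexint_Y(2)[OF \<Phi>])
  have "(\<integral>\<^sup>+\<omega>. (\<Sum>k. ?H k \<omega>) \<partial>M) = (\<Sum>k. \<integral>\<^sup>+\<omega>. ?H k \<omega> \<partial>M)"
    by (rule nn_integral_suminf) measurable
  also have "\<dots> = (\<Sum>k. ennreal (dsq f \<xi> k))"
    unfolding hexint_Y(1)[OF \<Phi>, symmetric] ennreal_dsq ..
  also have "\<dots> \<noteq> top"
    using sm dsq_nonneg by (simp add: suminf_ennreal2)
  finally have "AE \<omega> in M. (\<Sum>k. ?H k \<omega>) \<noteq> \<infinity>"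
    by (intro nn_integral_PInf_AE) auto
  then have "AE \<omega> in M. \<omega> \<in> space M \<and> (\<Sum>k. ?H k \<omega>) \<noteq> \<infinity>"
    using AE_space by (intro eventually_conj)
  then have "\<exists>\<omega>. \<omega> \<in> space M \<and> (\<Sum>k. ?H k \<omega>) \<noteq> \<infinity>"
    using ae_filter_bot by (rule eventually_happens'[rotated])
  then obtain \<omega> where "\<omega> \<in> space M" "(\<Sum>k. ?H k \<omega>) < top" by (auto simp: less_top)
  then show ?thesis using space_Y by (intro that[of "\<lambda>k. Y k \<omega>"]) auto
qed

text \<open>With the first edge frozen, the two bridge averages are \<open>a (Suc k)\<close> at the
  later and \<open>a k\<close> at the earlier point of the second edge: one family of functions at
  consecutive times. This is why their arguments form a gradient, whose sum telescopes to a bounded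
  term.\<close>

lemma reduction:
  assumes f [measurable]: "\<And>k. f k \<in> borel_measurable (mm k)"
    and sm: "summable (dsq f \<xi>)" and \<xi>: "\<xi> \<noteq> 0"
  obtains g c ctr where "\<And>k. g k \<in> borel_measurable (mm k)"
    and "\<And>k t. t \<in> space (mm k) \<Longrightarrow> \<exists>n::int. g k t - c k = 2 * pi / \<xi> * of_int n"
    and "\<And>\<epsilon>. 0 < \<epsilon> \<Longrightarrow> \<exists>K. \<forall>N. \<P>(\<omega> in M. K < \<bar>psum (\<lambda>k t. f k t - g k t) N \<omega> - ctr N\<bar>) < \<epsilon>"
proof -
  let ?\<Phi> = "\<lambda>k P. ennreal ((cmod (cis (\<xi> * hexbal f k P) - 1))\<^sup>2)"
  obtain z where z: "\<And>k. z k \<in> space (m k)"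
    and fin: "(\<Sum>k. hexcond k (?\<Phi> k) (z k, z (Suc k))) < top"
    using obtain_reference_path[OF f sm] by blast
  define a where "a k = bphase f \<xi> k (z k)" for k
  have a_meas [measurable]: "a k \<in> borel_measurable (m (Suc (Suc k)))" for k
    unfolding a_def by (rule bphase_meas[OF f z])
  have a_le: "cmod (a k x) \<le> 1" if "x \<in> space (m (Suc (Suc k)))" for k x
    unfolding a_def by (rule bphase_le[OF f z that])
  define \<kappa> where "\<kappa> k t = \<xi> * (f k (z k, z (Suc k)) - f (Suc (Suc k)) t)" for k t
  have \<kappa>_meas [measurable]: "\<kappa> k \<in> borel_measurable (mm (Suc (Suc k)))" for k
    unfolding \<kappa>_def by measurable
  define v where "v k t = \<kappa> k t + Arg (a (Suc k) (snd t)) - Arg (a k (fst t))" for k t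
  have v_meas [measurable]: "v k \<in> borel_measurable (mm (Suc (Suc k)))" for k
    unfolding v_def by measurable
  \<comment> \<open>The representative of \<open>v\<close> modulo a full turn with absolute value at
    most \<open>pi\<close>.\<close>
  define \<theta> where "\<theta> k t = Arg (cis (v k t))" for k t
  have \<theta>_meas [measurable]: "\<theta> k \<in> borel_measurable (mm (Suc (Suc k)))" for k
    unfolding \<theta>_def by measurable
  have \<theta>_le: "\<bar>\<theta> k t\<bar> \<le> pi" for k t
    unfolding \<theta>_def using Arg_bounded[of "cis (v k t)"] by auto
  define w where "w k t = cis (\<kappa> k t) * a (Suc k) (snd t) * cnj (a k (fst t))" for k t
  \<comment> \<open>The factor 8 is the 16 of \<open>Arg_sq_le\<close> divided by the 2 in front of
    the real part.\<close>
  have \<theta>_sq: "(\<theta> k t)\<^sup>2 \<le> 8 * (2 - 2 * Re (w k t))" if "t \<in> space (pairs (Suc (Suc k)))" for k t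
  proof -
    have t: "fst t \<in> space (m (Suc (Suc k)))" "snd t \<in> space (m (Suc (Suc (Suc k))))" using that by auto
    let ?r = "cmod (a (Suc k) (snd t)) * cmod (a k (fst t))"
    have "w k t = cis (\<kappa> k t) * (of_real (cmod (a (Suc k) (snd t))) * cis (Arg (a (Suc k) (snd t)))) *
        cnj (of_real (cmod (a k (fst t))) * cis (Arg (a k (fst t))))"
      unfolding w_def mult_cis_Arg ..
    also have "\<dots> = of_real ?r * (cis (\<kappa> k t) * cis (Arg (a (Suc k) (snd t))) * cis (- Arg (a k (fst t))))"
      by (simp add: cis_cnj)
    also have "cis (\<kappa> k t) * cis (Arg (a (Suc k) (snd t))) * cis (- Arg (a k (fst t))) = cis (v k t)"
      by (simp add: cis_mult v_def)
    finally have "Re (w k t) = ?r * Re (cis (v k t))" by (simp only: Re_complex_of_real Im_complex_of_real times_complex.sel)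
    moreover have "?r \<le> 1" using a_le[OF t(1)] a_le[OF t(2)] by (simp add: mult_le_one)
    ultimately show ?thesis
      unfolding \<theta>_def using Arg_sq_le[of "cis (v k t)" ?r] by simp
  qed
  have w_bound: "0 \<le> 2 - 2 * Re (w k t)" if "t \<in> space (pairs (Suc (Suc k)))" for k t
    using order_trans[OF zero_le_power2 \<theta>_sq[OF that]] by (simp only: zero_le_mult_iff) simp
  have hc: "hexcond k (?\<Phi> k) (z k, z (Suc k)) = (\<integral>\<^sup>+t. ennreal (2 - 2 * Re (w k t)) \<partial>pairs (Suc (Suc k)))" for k
    using hexcond_phase[OF f, of "(z k, z (Suc k))" k \<xi>] z by (simp add: w_def \<kappa>_def a_def)
  \<comment> \<open>The two edges of a hexagon are independent, so the second one, with the first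
    frozen, still has the law of the edge of the chain at time \<open>k + 2\<close>. Hence the
    conditional term bounds a second moment along the chain.\<close>
  have E\<theta>: "ennreal (\<integral>\<omega>. (\<theta> k (YY (Suc (Suc k)) \<omega>))\<^sup>2 \<partial>M)
     \<le> 8 * hexcond k (?\<Phi> k) (z k, z (Suc k))" for k
  proof -
    let ?Z = "\<lambda>\<omega>. (YY (Suc (Suc k)) \<omega>)"
    have Z: "?Z \<in> M \<rightarrow>\<^sub>M m (Suc (Suc k)) \<Otimes>\<^sub>M m (Suc (Suc (Suc k)))" by (rule measurable_Pair[OF Y_meas Y_meas])
    have \<theta>2: "(\<lambda>t. (\<theta> k t)\<^sup>2) \<in> borel_measurable (mm (Suc (Suc k)))"
      using \<theta>_meas by (rule borel_measurable_power)
    have w2: "(\<lambda>t. ennreal (2 - 2 * Re (w k t))) \<in> borel_measurable (pairs (Suc (Suc k)))"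
      unfolding w_def by measurable
    have \<theta>_bound: "norm ((\<theta> k t)\<^sup>2) \<le> pi\<^sup>2" for t
      using power_mono[OF \<theta>_le[of k t], of 2] by simp
    have "integrable M (\<lambda>\<omega>. (\<theta> k (?Z \<omega>))\<^sup>2)"
      by (rule integrable_bounded[OF measurable_compose[OF Z \<theta>2] \<theta>_bound])
    then have "ennreal (\<integral>\<omega>. (\<theta> k (?Z \<omega>))\<^sup>2 \<partial>M) = (\<integral>\<^sup>+\<omega>. ennreal ((\<theta> k (?Z \<omega>))\<^sup>2) \<partial>M)"
      by (intro nn_integral_eq_integral[symmetric] AE_I2 zero_le_power2)
    also have "\<dots> = (\<integral>\<^sup>+t. ennreal ((\<theta> k t)\<^sup>2) \<partial>pairs (Suc (Suc k)))"
      unfolding pairs_def using \<theta>2 by (intro nn_integral_distr[OF Z, symmetric]) simp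
    also have "\<dots> \<le> (\<integral>\<^sup>+t. 8 * ennreal (2 - 2 * Re (w k t)) \<partial>pairs (Suc (Suc k)))"
    proof (rule nn_integral_mono)
      fix t assume t: "t \<in> space (pairs (Suc (Suc k)))"
      have "ennreal ((\<theta> k t)\<^sup>2) \<le> ennreal (8 * (2 - 2 * Re (w k t)))" by (rule ennreal_leI[OF \<theta>_sq[OF t]])
      also have "\<dots> = 8 * ennreal (2 - 2 * Re (w k t))"
        using ennreal_mult[OF _ w_bound[OF t], of 8] by simp
      finally show "ennreal ((\<theta> k t)\<^sup>2) \<le> 8 * ennreal (2 - 2 * Re (w k t))" .
    qed
    also have "\<dots> = 8 * hexcond k (?\<Phi> k) (z k, z (Suc k))"
      unfolding hc by (rule nn_integral_cmult[OF w2])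
    finally show ?thesis .
  qed
  have split2: "j = 0 \<or> j = 1 \<or> (\<exists>k. j = Suc (Suc k))" for j :: nat
    by presburger
  \<comment> \<open>The hexagon that starts at time \<open>k\<close> yields the error of the edge at
    time \<open>k + 2\<close>; the first two edges have none.\<close>
  define h where "h j = (if j < 2 then (\<lambda>_. 0) else \<theta> (j - 2))" for j
  have h_Suc: "h (Suc (Suc k)) = \<theta> k" for k by (simp add: h_def)
  have h_meas [measurable]: "h j \<in> borel_measurable (mm j)" for j
  proof (cases "j < 2")
    case False
    then obtain k where j: "j = Suc (Suc k)" using split2[of j] by auto
    show ?thesis unfolding j h_Suc by (rule \<theta>_meas)
  next
    case True
    then have "h j = (\<lambda>_. 0)" by (simp add: h_def)
    then show ?thesis by simp
  qed
  have h_le: "\<bar>h j t\<bar> \<le> pi" for j t unfolding h_def using \<theta>_le by auto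
  have "summable (\<lambda>k. \<integral>\<omega>. (h (k + 2) (Y (k + 2) \<omega>, Y (Suc (k + 2)) \<omega>))\<^sup>2 \<partial>M)"
  proof (rule summable_suminf_not_top)
    have "(\<Sum>k. ennreal (\<integral>\<omega>. (h (k + 2) (Y (k + 2) \<omega>, Y (Suc (k + 2)) \<omega>))\<^sup>2 \<partial>M))
       \<le> (\<Sum>k. 8 * hexcond k (?\<Phi> k) (z k, z (Suc k)))"
      using E\<theta> by (intro suminf_le) (auto simp: h_Suc)
    also have "\<dots> = 8 * (\<Sum>k. hexcond k (?\<Phi> k) (z k, z (Suc k)))" by (rule ennreal_suminf_cmult)
    also have "\<dots> < top" using fin by (simp add: ennreal_mult_less_top)
    finally show "(\<Sum>k. ennreal (\<integral>\<omega>. (h (k + 2) (Y (k + 2) \<omega>, Y (Suc (k + 2)) \<omega>))\<^sup>2 \<partial>M)) \<noteq> top" by simp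
  qed simp
  then have "summable (\<lambda>k. \<integral>\<omega>. (h k (YY k \<omega>))\<^sup>2 \<partial>M)"
    by (rule summable_iff_shift[THEN iffD1])
  from tight_of_summable_second_moments[OF h_meas h_le this]
  obtain c' V where V: "\<And>N. (\<integral>\<omega>. ((\<Sum>k<N. h k (YY k \<omega>)) - c' N)\<^sup>2 \<partial>M) \<le> V"
    by blast

  define g where "g j = (if j < 2 then (\<lambda>_. 0) else
    (\<lambda>t. f j t - Arg (a (j - 1) (snd t)) / \<xi> + Arg (a (j - 2) (fst t)) / \<xi> + \<theta> (j - 2) t / \<xi>))" for j
  define c where "c j = (if j < 2 then 0 else f (j - 2) (z (j - 2), z (j - 1)))" for j
  have g_Suc: "g (Suc (Suc k)) t = f (Suc (Suc k)) t - Arg (a (Suc k) (snd t)) / \<xi> + Arg (a k (fst t)) / \<xi> + \<theta> k t / \<xi>" for k t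
    by (simp add: g_def)
  have g_meas: "g j \<in> borel_measurable (mm j)" for j
  proof -
    have 1: "g (Suc (Suc k)) \<in> borel_measurable (mm (Suc (Suc k)))" for k
    proof -
      have "(\<lambda>t. f (Suc (Suc k)) t - Arg (a (Suc k) (snd t)) / \<xi> + Arg (a k (fst t)) / \<xi> + \<theta> k t / \<xi>)
          \<in> borel_measurable (mm (Suc (Suc k)))"
        by measurable
      then show ?thesis by (simp only: g_Suc[symmetric])
    qed
    have 2: "g j = (\<lambda>_. 0)" if "j < 2" for j using that by (simp add: g_def)
    show ?thesis
      using split2[of j]
    proof (elim disjE exE)
      fix k assume "j = Suc (Suc k)"
      then show ?thesis using 1[of k] by (simp only:)
    qed (simp_all add: 2)
  qed
  have g_lattice: "\<exists>n::int. g j t - c j = 2 * pi / \<xi> * of_int n" for j t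
  proof -
    have 1: "\<exists>n::int. g (Suc (Suc k)) t - c (Suc (Suc k)) = 2 * pi / \<xi> * of_int n" for k
    proof -
      have "cis (\<theta> k t) = cis (v k t)" unfolding \<theta>_def by (simp add: cis_Arg)
      then obtain n where n: "\<theta> k t = v k t + 2 * pi * of_int n" by (rule cis_eq_cisE)
      have "g (Suc (Suc k)) t - c (Suc (Suc k)) = 2 * pi / \<xi> * of_int n"
        unfolding g_Suc n v_def \<kappa>_def c_def using \<xi> by (simp add: field_simps)
      then show ?thesis by blast
    qed
    have 2: "g j t - c j = 2 * pi / \<xi> * of_int 0" if "j < 2" for j using that by (simp add: g_def c_def)
    show ?thesis
    proof (cases "j < 2")
      case False
      then obtain k where "j = Suc (Suc k)" using split2[of j] by auto
      then show ?thesis using 1[of k] by (simp only:)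
    qed (rule exI, erule 2)
  qed
  \<comment> \<open>The sum of \<open>f - g\<close> consists of two initial terms, a telescoped
    difference of two arguments over \<open>\<xi>\<close>, and the error sum over
    \<open>- \<xi>\<close>. Only the last part needs centering, hence
    \<open>- c' N / \<xi>\<close>.\<close>
  let ?S = "psum (\<lambda>k t. f k t - g k t)" and ?H = "\<lambda>N \<omega>. \<Sum>k<N. h k (YY k \<omega>)"
  let ?R = "\<lambda>\<omega>. \<bar>f 0 (Y 0 \<omega>, Y 1 \<omega>)\<bar> + \<bar>f 1 (Y 1 \<omega>, Y 2 \<omega>)\<bar>"
  have S_le: "\<bar>?S N \<omega> - (- c' N / \<xi>)\<bar> \<le> ?R \<omega> + 2 * pi / \<bar>\<xi>\<bar> + \<bar>?H N \<omega> - c' N\<bar> / \<bar>\<xi>\<bar>" for N \<omega>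
  proof -
    have S2: "?S (Suc (Suc n)) \<omega> = f 0 (Y 0 \<omega>, Y 1 \<omega>) + f 1 (Y 1 \<omega>, Y 2 \<omega>) +
       (Arg (a n (Y (Suc (Suc n)) \<omega>)) - Arg (a 0 (Y 2 \<omega>))) / \<xi> - ?H (Suc (Suc n)) \<omega> / \<xi>" for n
    proof (induction n)
      case 0
      show ?case by (simp add: psum_def g_def h_def numeral_2_eq_2)
    next
      case (Suc n)
      have "?S (Suc (Suc (Suc n))) \<omega> = ?S (Suc (Suc n)) \<omega> + (f (Suc (Suc n)) (Y (Suc (Suc n)) \<omega>, Y (Suc (Suc (Suc n))) \<omega>)
          - g (Suc (Suc n)) (Y (Suc (Suc n)) \<omega>, Y (Suc (Suc (Suc n))) \<omega>))"
        by (simp add: psum_def)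
      also have "\<dots> = f 0 (Y 0 \<omega>, Y 1 \<omega>) + f 1 (Y 1 \<omega>, Y 2 \<omega>) +
       (Arg (a (Suc n) (Y (Suc (Suc (Suc n))) \<omega>)) - Arg (a 0 (Y 2 \<omega>))) / \<xi>
        - (?H (Suc (Suc n)) \<omega> + \<theta> n (Y (Suc (Suc n)) \<omega>, Y (Suc (Suc (Suc n))) \<omega>)) / \<xi>"
        unfolding Suc g_Suc by (simp add: diff_divide_distrib add_divide_distrib)
      finally show ?case by (simp only: sum.lessThan_Suc[of _ "Suc (Suc n)"] h_Suc)
    qed
    have A: "\<bar>(Arg x - Arg y) / \<xi>\<bar> \<le> 2 * pi / \<bar>\<xi>\<bar>" for x y
      using Arg_bounded[of x] Arg_bounded[of y] unfolding abs_divide by (intro divide_right_mono) auto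
    have "\<exists>r d. ?S N \<omega> = r + d - ?H N \<omega> / \<xi> \<and> \<bar>r\<bar> \<le> ?R \<omega> \<and> \<bar>d\<bar> \<le> 2 * pi / \<bar>\<xi>\<bar>"
    proof (cases "N < 2")
      case True
      then consider "N = 0" | "N = 1" by linarith
      then have "?S N \<omega> = ?S N \<omega> + 0 - ?H N \<omega> / \<xi> \<and> \<bar>?S N \<omega>\<bar> \<le> ?R \<omega> \<and> \<bar>0 :: real\<bar> \<le> 2 * pi / \<bar>\<xi>\<bar>"
        by cases (simp_all add: psum_def h_def g_def)
      then show ?thesis by (intro exI)
    next
      case False
      then obtain n where N: "N = Suc (Suc n)" using split2[of N] by auto
      show ?thesis unfolding N S2
        by (intro exI[of _ "f 0 (Y 0 \<omega>, Y 1 \<omega>) + f 1 (Y 1 \<omega>, Y 2 \<omega>)"]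
            exI[of _ "(Arg (a n (Y (Suc (Suc n)) \<omega>)) - Arg (a 0 (Y 2 \<omega>))) / \<xi>"] conjI refl abs_triangle_ineq A)
    qed
    then obtain r d where *: "?S N \<omega> = r + d - ?H N \<omega> / \<xi>" "\<bar>r\<bar> \<le> ?R \<omega>" "\<bar>d\<bar> \<le> 2 * pi / \<bar>\<xi>\<bar>" by blast
    have "?S N \<omega> - (- c' N / \<xi>) = r + d - (?H N \<omega> - c' N) / \<xi>" unfolding *(1) by (simp add: diff_divide_distrib)
    then show ?thesis using *(2,3) abs_divide[of "?H N \<omega> - c' N" \<xi>] by linarith
  qed
  have tight: "\<exists>K. \<forall>N. \<P>(\<omega> in M. K < \<bar>?S N \<omega> - (- c' N / \<xi>)\<bar>) < \<epsilon>" if \<epsilon>: "0 < \<epsilon>" for \<epsilon> :: real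
  proof -
    have R_meas [measurable]: "?R \<in> borel_measurable M"
      using pair_meas[OF f, of 0] pair_meas[OF f, of 1] by (simp add: numeral_2_eq_2)
    have H_meas [measurable]: "?H N \<in> borel_measurable M" for N
      by measurable
    obtain K1 where K1: "\<P>(\<omega> in M. K1 < \<bar>?R \<omega>\<bar>) < \<epsilon> / 2" "0 \<le> K1"
      using tight_single[OF R_meas, of "\<epsilon> / 2"] \<epsilon> by auto
    \<comment> \<open>Chosen so that Chebyshev's inequality gives \<open>\<epsilon> / 4\<close>; the
      summand 1 keeps the threshold positive.\<close>
    define K2 where "K2 = sqrt (4 * (\<bar>V\<bar> + 1) / \<epsilon>)"
    have K2: "K2 > 0" "K2\<^sup>2 = 4 * (\<bar>V\<bar> + 1) / \<epsilon>" using \<epsilon> by (simp_all add: K2_def)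
    have P2: "\<P>(\<omega> in M. K2 < \<bar>?H N \<omega> - c' N\<bar>) \<le> \<epsilon> / 4" for N
    proof -
      have HN: "\<bar>?H N \<omega>\<bar> \<le> real N * pi" for \<omega>
      proof -
        have "\<bar>?H N \<omega>\<bar> \<le> (\<Sum>k<N. \<bar>h k (YY k \<omega>)\<bar>)" by (rule sum_abs)
        also have "\<dots> \<le> (\<Sum>k<N. pi)" by (intro sum_mono h_le)
        finally show ?thesis by simp
      qed
      have "integrable M (\<lambda>\<omega>. (?H N \<omega> - c' N)\<^sup>2)"
      proof (rule integrable_bounded[of _ "(real N * pi + \<bar>c' N\<bar>)\<^sup>2"])
        fix \<omega>
        have "\<bar>?H N \<omega> - c' N\<bar> \<le> real N * pi + \<bar>c' N\<bar>" using HN[of \<omega>] by linarith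
        from power_mono[OF this, of 2] show "norm ((?H N \<omega> - c' N)\<^sup>2) \<le> (real N * pi + \<bar>c' N\<bar>)\<^sup>2" by simp
      qed measurable
      then have "\<P>(\<omega> in M. K2 < \<bar>?H N \<omega> - c' N\<bar>) \<le> V / K2\<^sup>2"
        using V[of N] K2 by (intro prob_abs_gt_le) auto
      also have "\<dots> \<le> \<epsilon> / 4"
      proof -
        have "V * \<epsilon> \<le> (\<bar>V\<bar> + 1) * \<epsilon>" using \<epsilon> by (intro mult_right_mono) auto
        then show ?thesis unfolding K2(2) using \<epsilon> by (simp add: field_simps)
      qed
      finally show ?thesis .
    qed
    show ?thesis
    proof (intro exI allI)
      fix N
      let ?K = "K1 + 2 * pi / \<bar>\<xi>\<bar> + K2 / \<bar>\<xi>\<bar>"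
      have "{\<omega> \<in> space M. ?K < \<bar>?S N \<omega> - (- c' N / \<xi>)\<bar>} \<subseteq>
        {\<omega> \<in> space M. K1 < \<bar>?R \<omega>\<bar>} \<union> {\<omega> \<in> space M. K2 < \<bar>?H N \<omega> - c' N\<bar>}"
      proof safe
        fix \<omega> assume 1: "?K < \<bar>?S N \<omega> - (- c' N / \<xi>)\<bar>" and 2: "\<not> K2 < \<bar>?H N \<omega> - c' N\<bar>"
        have "\<bar>?H N \<omega> - c' N\<bar> / \<bar>\<xi>\<bar> \<le> K2 / \<bar>\<xi>\<bar>" using 2 by (intro divide_right_mono) auto
        then show "K1 < \<bar>?R \<omega>\<bar>" using 1 S_le[of N \<omega>] by linarith
      qed
      then have "\<P>(\<omega> in M. ?K < \<bar>?S N \<omega> - (- c' N / \<xi>)\<bar>) \<le>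
        measure M ({\<omega> \<in> space M. K1 < \<bar>?R \<omega>\<bar>} \<union> {\<omega> \<in> space M. K2 < \<bar>?H N \<omega> - c' N\<bar>})"
        by (intro finite_measure_mono) measurable
      also have "\<dots> \<le> \<P>(\<omega> in M. K1 < \<bar>?R \<omega>\<bar>) + \<P>(\<omega> in M. K2 < \<bar>?H N \<omega> - c' N\<bar>)"
        by (intro measure_Un_le) measurable
      also have "\<dots> < \<epsilon>" using K1(1) P2[of N] \<epsilon> by linarith
      finally show "\<P>(\<omega> in M. ?K < \<bar>?S N \<omega> - (- c' N / \<xi>)\<bar>) < \<epsilon>" .
    qed
  qed
  show ?thesis by (rule that[OF g_meas g_lattice tight])
qed

text \<open>Each time occurs in the balance once with either sign, so the constants \<open>c\<close>
  cancel and only values of \<open>g - c\<close> remain.\<close>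

lemma cis_hexbal_eq_1:
  assumes "\<And>k t. cis (\<xi> * (g k t - c k)) = 1"
  shows "cis (\<xi> * hexbal g k P) = 1"
proof -
  obtain a b c' b' c'' d where P: "P = (a, b, c', b', c'', d)" by (cases P)
  let ?v = "\<lambda>k t. \<xi> * (g k t - c k)"
  have "\<xi> * hexbal g k P = ?v k (a, b) + ?v (Suc k) (b, c') + ?v (Suc (Suc k)) (c', d)
     + - ?v k (a, b') + - ?v (Suc k) (b', c'') + - ?v (Suc (Suc k)) (c'', d)"
    unfolding P hexbal_def prod.case by (simp add: algebra_simps)
  also have "cis \<dots> = 1"
    unfolding cis_mult[symmetric] cis_cnj[symmetric] assms by simp
  finally show ?thesis .
qed

text \<open>The balance is linear in the functional, and the part \<open>f - h\<close> contributes
  only trivial phases.\<close>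

lemma dsq_cong_mod:
  assumes "\<And>k t. cis (\<xi> * (f k t - h k t - c k)) = 1"
  shows "dsq f \<xi> = dsq h \<xi>"
proof
  fix k
  have "cis (\<xi> * hexbal f k P) = cis (\<xi> * hexbal h k P)" for P
  proof -
    have "\<xi> * hexbal f k P = \<xi> * hexbal (\<lambda>k t. f k t - h k t) k P + \<xi> * hexbal h k P"
      by (cases P) (simp add: hexbal_def algebra_simps)
    then show ?thesis
      using cis_hexbal_eq_1[of \<xi> "\<lambda>k t. f k t - h k t" c k P] assms by (simp flip: cis_mult)
  qed
  then show "dsq f \<xi> k = dsq h \<xi> k" by (simp add: dsq_def)
qed

text \<open>
  Redefining \<open>g\<close> on a null set so that \<open>g - c\<close> takes values in the group everywhere avoids null sets
  of hexagons.
\<close>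

lemma summable_dsq_of_lattice:
  assumes f [measurable]: "\<And>k. f k \<in> borel_measurable (mm k)"
    and g [measurable]: "\<And>k. g k \<in> borel_measurable (mm k)"
    and lattice: "\<And>k. AE \<omega> in M. cis (\<xi> * (g k (YY k \<omega>) - c k)) = 1"
    and tight: "\<And>\<epsilon>. 0 < \<epsilon> \<Longrightarrow> \<exists>K. \<forall>N\<ge>1. \<P>(\<omega> in M. K < \<bar>psum (\<lambda>k t. f k t - g k t) N \<omega> - ctr N\<bar>) < \<epsilon>"
  shows "summable (dsq f \<xi>)"
proof -
  \<comment> \<open>The default \<open>c k\<close> makes \<open>g' - c\<close> vanish wherever
    \<open>g - c\<close> misses the lattice.\<close>
  define g' where "g' k t = (if cis (\<xi> * (g k t - c k)) = 1 then g k t else c k)" for k t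
  define h where "h k t = f k t - g' k t" for k t
  have g'_meas [measurable]: "g' k \<in> borel_measurable (mm k)" for k
    unfolding g'_def by measurable
  have h_meas [measurable]: "h k \<in> borel_measurable (mm k)" for k
    unfolding h_def by measurable
  have fg_meas [measurable]: "(\<lambda>t. f k t - g k t) \<in> borel_measurable (mm k)" for k
    by measurable
  have ae: "AE \<omega> in M. \<forall>k. cis (\<xi> * (g k (YY k \<omega>) - c k)) = 1"
    using lattice by (simp add: AE_all_countable)
  have "summable (dsq h \<xi>)"
  proof (rule summable_dsq_of_tight[OF h_meas])
    fix \<epsilon> :: real assume "0 < \<epsilon>"
    then obtain K where K: "\<And>N. N \<ge> 1 \<Longrightarrow> \<P>(\<omega> in M. K < \<bar>psum (\<lambda>k t. f k t - g k t) N \<omega> - ctr N\<bar>) < \<epsilon>"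
      using tight by blast
    \<comment> \<open>The modification changes the partial sums only on a null set, so tightness is
      inherited.\<close>
    have "\<P>(\<omega> in M. K < \<bar>psum h N \<omega> - ctr N\<bar>) = \<P>(\<omega> in M. K < \<bar>psum (\<lambda>k t. f k t - g k t) N \<omega> - ctr N\<bar>)" for N
    proof (rule finite_measure_eq_AE)
      have [measurable]: "psum h N \<in> borel_measurable M" "psum (\<lambda>k t. f k t - g k t) N \<in> borel_measurable M"
        by (rule F_to_M[OF psum_F[OF h_meas]], rule F_to_M[OF psum_F[OF fg_meas]])
      show "{\<omega> \<in> space M. K < \<bar>psum h N \<omega> - ctr N\<bar>} \<in> sets M"
        "{\<omega> \<in> space M. K < \<bar>psum (\<lambda>k t. f k t - g k t) N \<omega> - ctr N\<bar>} \<in> sets M" by measurable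
      show "AE \<omega> in M. \<omega> \<in> {\<omega> \<in> space M. K < \<bar>psum h N \<omega> - ctr N\<bar>} \<longleftrightarrow>
          \<omega> \<in> {\<omega> \<in> space M. K < \<bar>psum (\<lambda>k t. f k t - g k t) N \<omega> - ctr N\<bar>}"
        using ae by (rule eventually_mono) (simp add: psum_def h_def g'_def)
    qed
    then show "\<exists>K. \<forall>N\<ge>1. \<P>(\<omega> in M. K < \<bar>psum h N \<omega> - ctr N\<bar>) < \<epsilon>"
      using K by (intro exI[of _ K]) simp
  qed
  also have "dsq h \<xi> = dsq f \<xi>"
    by (rule dsq_cong_mod[symmetric, of _ _ _ c]) (simp add: h_def g'_def)
  finally show ?thesis .
qed

text \<open>Connects the monadic hexagon law with \<open>hexint\<close>. The integral is pushed
  through the binds from the outside inwards, and each bind needs its kernel to be jointly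
  measurable in all variables drawn so far; hence the facts \<open>K4\<close>, \<open>K3\<close>,
  \<open>K2\<close> and \<open>K1\<close>, established from the inside outwards.\<close>

lemma hexagon_bind:
  assumes \<Phi>: "\<Phi> \<in> borel_measurable (hexagons k)"
  defines "L \<equiv> pairs k \<bind> (\<lambda>s. pairs (Suc (Suc k)) \<bind> (\<lambda>t.
      bdg (Suc k) (snd s) (snd t) \<bind> (\<lambda>c. bdg k (fst s) (fst t) \<bind> (\<lambda>b'.
        return (hexagons k) (fst s, snd s, c, b', fst t, snd t)))))"
  shows "sets L = sets (hexagons k)" and "(\<integral>\<^sup>+P. \<Phi> P \<partial>L) = hexint k \<Phi>"
proof -
  let ?H = "hexagons k"
  let ?m1 = "m (Suc k)" and ?m2 = "m (Suc (Suc k))"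
  let ?P = "pairs k \<Otimes>\<^sub>M pairs (Suc (Suc k))"
  let ?g = "\<lambda>s t c b'. (fst s, snd s, c, b', fst t, snd t)"
  let ?K4 = "\<lambda>s t c b'. return ?H (?g s t c b')"
  let ?K3 = "\<lambda>s t c. bdg k (fst s) (fst t) \<bind> ?K4 s t c"
  let ?K2 = "\<lambda>s t. bdg (Suc k) (snd s) (snd t) \<bind> ?K3 s t"
  let ?K1 = "\<lambda>s. pairs (Suc (Suc k)) \<bind> ?K2 s"
  have g: "(\<lambda>z. ?g (fst (fst (fst z))) (snd (fst (fst z))) (snd (fst z)) (snd z)) \<in> (?P \<Otimes>\<^sub>M ?m2) \<Otimes>\<^sub>M ?m1 \<rightarrow>\<^sub>M ?H"
    unfolding hexagons_def by measurable
  have K4: "(\<lambda>z. ?K4 (fst (fst (fst z))) (snd (fst (fst z))) (snd (fst z)) (snd z))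
      \<in> (?P \<Otimes>\<^sub>M ?m2) \<Otimes>\<^sub>M ?m1 \<rightarrow>\<^sub>M subprob_algebra ?H"
    by (rule measurable_compose[OF g return_measurable])
  have B3: "(\<lambda>z. bdg k (fst (fst (fst z))) (fst (snd (fst z)))) \<in> ?P \<Otimes>\<^sub>M ?m2 \<rightarrow>\<^sub>M subprob_algebra ?m1"
    by (rule bdg_kernel') measurable
  have K3: "(\<lambda>z. ?K3 (fst (fst z)) (snd (fst z)) (snd z)) \<in> ?P \<Otimes>\<^sub>M ?m2 \<rightarrow>\<^sub>M subprob_algebra ?H"
    by (rule measurable_bind[OF B3 K4])
  have B2: "(\<lambda>z. bdg (Suc k) (snd (fst z)) (snd (snd z))) \<in> ?P \<rightarrow>\<^sub>M subprob_algebra ?m2"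
    by (rule bdg_kernel') measurable
  have K2: "(\<lambda>z. ?K2 (fst z) (snd z)) \<in> ?P \<rightarrow>\<^sub>M subprob_algebra ?H"
    by (rule measurable_bind[OF B2 K3])
  have B1: "(\<lambda>s. pairs (Suc (Suc k))) \<in> pairs k \<rightarrow>\<^sub>M subprob_algebra (pairs (Suc (Suc k)))"
    using prob_pairs by (intro measurable_const) (simp add: space_subprob_algebra prob_space_imp_subprob_space)
  have K1: "?K1 \<in> pairs k \<rightarrow>\<^sub>M subprob_algebra ?H"
    by (rule measurable_bind[OF B1 K2])
  show "sets L = sets (hexagons k)"
    unfolding L_def by (rule sets_bind[OF sets_kernel[OF K1] prob_space.not_empty[OF prob_pairs]])
  have "(\<integral>\<^sup>+P. \<Phi> P \<partial>(pairs k \<bind> ?K1)) = (\<integral>\<^sup>+s. \<integral>\<^sup>+P. \<Phi> P \<partial>?K1 s \<partial>pairs k)"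
    by (rule nn_integral_bind[OF \<Phi> K1])
  also have "\<dots> = (\<integral>\<^sup>+s. \<integral>\<^sup>+t. \<integral>\<^sup>+P. \<Phi> P \<partial>?K2 s t \<partial>pairs (Suc (Suc k)) \<partial>pairs k)"
  proof (rule nn_integral_cong)
    fix s assume s: "s \<in> space (pairs k)"
    have "?K2 s \<in> pairs (Suc (Suc k)) \<rightarrow>\<^sub>M subprob_algebra ?H"
      using measurable_compose[OF measurable_Pair1'[OF s] K2] by (simp only: fst_conv snd_conv)
    then show "(\<integral>\<^sup>+P. \<Phi> P \<partial>?K1 s) = (\<integral>\<^sup>+t. \<integral>\<^sup>+P. \<Phi> P \<partial>?K2 s t \<partial>pairs (Suc (Suc k)))"
      by (rule nn_integral_bind[OF \<Phi>])
  qed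
  also have "\<dots> = hexint k \<Phi>"
    unfolding hexint_def
  proof (rule nn_integral_cong, rule nn_integral_cong)
    fix s t assume s: "s \<in> space (pairs k)" and t: "t \<in> space (pairs (Suc (Suc k)))"
    have st: "(s, t) \<in> space ?P" using s t by (simp add: space_pair_measure)
    have "?K3 s t \<in> ?m2 \<rightarrow>\<^sub>M subprob_algebra ?H"
      using measurable_compose[OF measurable_Pair1'[OF st] K3] by (simp only: fst_conv snd_conv)
    then have "?K3 s t \<in> bdg (Suc k) (snd s) (snd t) \<rightarrow>\<^sub>M subprob_algebra ?H"
      by (simp only: measurable_cong_sets[OF sets_bdg refl])
    then have "(\<integral>\<^sup>+P. \<Phi> P \<partial>?K2 s t) = (\<integral>\<^sup>+c. \<integral>\<^sup>+P. \<Phi> P \<partial>?K3 s t c \<partial>bdg (Suc k) (snd s) (snd t))"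
      by (rule nn_integral_bind[OF \<Phi>])
    also have "\<dots> = (\<integral>\<^sup>+c. \<integral>\<^sup>+b'. \<Phi> (?g s t c b') \<partial>bdg k (fst s) (fst t) \<partial>bdg (Suc k) (snd s) (snd t))"
    proof (rule nn_integral_cong)
      fix c assume "c \<in> space (bdg (Suc k) (snd s) (snd t))"
      then have c: "c \<in> space ?m2" by simp
      then have stc: "((s, t), c) \<in> space (?P \<Otimes>\<^sub>M ?m2)" using st by (simp add: space_pair_measure)
      have "?K4 s t c \<in> ?m1 \<rightarrow>\<^sub>M subprob_algebra ?H"
        using measurable_compose[OF measurable_Pair1'[OF stc] K4] by (simp only: fst_conv snd_conv)
      then have "?K4 s t c \<in> bdg k (fst s) (fst t) \<rightarrow>\<^sub>M subprob_algebra ?H"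
        by (simp only: measurable_cong_sets[OF sets_bdg refl])
      then have "(\<integral>\<^sup>+P. \<Phi> P \<partial>?K3 s t c) = (\<integral>\<^sup>+b'. \<integral>\<^sup>+P. \<Phi> P \<partial>?K4 s t c b' \<partial>bdg k (fst s) (fst t))"
        by (rule nn_integral_bind[OF \<Phi>])
      also have "\<dots> = (\<integral>\<^sup>+b'. \<Phi> (?g s t c b') \<partial>bdg k (fst s) (fst t))"
      proof (rule nn_integral_cong)
        fix b' assume "b' \<in> space (bdg k (fst s) (fst t))"
        then have "?g s t c b' \<in> space ?H"
          using s t c by (auto simp: hexagons_def space_pair_measure)
        then show "(\<integral>\<^sup>+P. \<Phi> P \<partial>?K4 s t c b') = \<Phi> (?g s t c b')"
          by (rule nn_integral_return[OF _ \<Phi>])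
      qed
      finally show "(\<integral>\<^sup>+P. \<Phi> P \<partial>?K3 s t c) = (\<integral>\<^sup>+b'. \<Phi> (?g s t c b') \<partial>bdg k (fst s) (fst t))" .
    qed
    finally show "(\<integral>\<^sup>+P. \<Phi> P \<partial>?K2 s t) = (\<integral>\<^sup>+c. \<integral>\<^sup>+b'. \<Phi> (?g s t c b') \<partial>bdg k (fst s) (fst t) \<partial>bdg (Suc k) (snd s) (snd t))" .
  qed
  finally show "(\<integral>\<^sup>+P. \<Phi> P \<partial>L) = hexint k \<Phi>" unfolding L_def .
qed

end

section \<open>Essential range and co-range\<close>

lemma space_borel_metric [simp]: "space (borel_metric s) = mspace s"
  unfolding borel_metric_def by (rule space_measure_of) (use openin_subset[of "mtopology_of s"] in fastforce)

context uniformly_elliptic_chain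
begin

text \<open>The sigma-algebra of the Markov assumption at time \<open>Suc k\<close>; the index is
  shifted because the abstract chain starts at time 0.\<close>

definition history :: "nat \<Rightarrow> 'w measure" where
  "history k = vimage_algebra (space M) (\<lambda>\<omega>. \<lambda>i\<in>{1..Suc k}. X i \<omega>) (\<Pi>\<^sub>M i\<in>{1..Suc k}. borel_metric (S i))"

lemma history_meas:
  "(\<lambda>\<omega>. \<lambda>i\<in>{1..Suc k}. X i \<omega>) \<in> M \<rightarrow>\<^sub>M (\<Pi>\<^sub>M i\<in>{1..Suc k}. borel_metric (S i))"
  by (rule measurable_restrict) (auto intro: random_variable_X)

lemma subalgebra_history: "subalgebra M (history k)"
  unfolding subalgebra_def history_def using sets_image_in_sets[OF refl history_meas] by simp

lemma space_mu: "n \<ge> 1 \<Longrightarrow> space (\<mu> n) = mspace (S n)"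
  using sets_eq_imp_space_eq[OF sets_\<mu>] by simp

lemma sets_mu_pair: "n \<ge> 1 \<Longrightarrow> sets (\<mu> n \<Otimes>\<^sub>M \<mu> (Suc n)) = sets (borel_metric (S n) \<Otimes>\<^sub>M borel_metric (S (Suc n)))"
  by (intro sets_pair_measure_cong sets_\<mu>) auto

text \<open>Integrating the conditional probability over an event \<open>A\<close> of the past turns
  the almost sure statement into an identity; the transition kernel is then replaced by its
  density.\<close>

lemma markov_density:
  assumes n: "n = Suc k" and A: "A \<in> sets (history k)" and E: "E \<in> sets (\<mu> (Suc n))"
  shows "emeasure M (A \<inter> (X (Suc n) -` E \<inter> space M)) =
    (\<integral>\<^sup>+\<omega>. (\<integral>\<^sup>+y. ennreal (p n (X n \<omega>, y)) * indicator E y \<partial>\<mu> (Suc n)) * indicator A \<omega> \<partial>M)"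
proof -
  have n1: "n \<ge> 1" using n by simp
  have E': "E \<in> sets (borel_metric (S (Suc n)))" using E sets_\<mu>[of "Suc n"] by simp
  interpret fs: finite_measure_subalgebra M "history k"
    by standard (rule subalgebra_history)
  have AM: "A \<in> sets M" using A subalgebra_history[of k] by (auto simp: subalgebra_def)
  have XM [measurable]: "X n \<in> M \<rightarrow>\<^sub>M borel_metric (S n)" "X (Suc n) \<in> M \<rightarrow>\<^sub>M borel_metric (S (Suc n))"
    using n1 by (auto intro: random_variable_X)
  have XE: "X (Suc n) -` E \<inter> space M \<in> sets M" by (rule measurable_sets[OF XM(2) E'])
  have Xs: "X n \<omega> \<in> mspace (S n)" if "\<omega> \<in> space M" for \<omega>
    using measurable_space[OF XM(1) that] by simp
  let ?u = "\<lambda>\<omega>. measure (\<pi> n (X n \<omega>)) E"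
  have prob_\<pi>: "prob_space (\<pi> n (X n \<omega>))" if "\<omega> \<in> space M" for \<omega>
    using measurable_space[OF kernel[OF n1], of "X n \<omega>"] Xs[OF that] by (simp add: space_prob_algebra)
  have u_meas [measurable]: "?u \<in> borel_measurable M"
    using measurable_compose[OF measurable_compose[OF XM(1) measurable_prob_algebraD[OF kernel[OF n1]]]
        measurable_measure_subprob_algebra[OF E']] .
  have u01: "0 \<le> ?u \<omega>" "?u \<omega> \<le> 1" if "\<omega> \<in> space M" for \<omega>
    using prob_space.prob_le_1[OF prob_\<pi>[OF that]] by auto
  have int: "integrable M (\<lambda>\<omega>. indicat_real E (X (Suc n) \<omega>))"
    using E' by (intro integrable_const_bound[of _ 1]) auto
  have "measure M (A \<inter> (X (Suc n) -` E \<inter> space M)) = (\<integral>\<omega>. indicator A \<omega> * indicat_real E (X (Suc n) \<omega>) \<partial>M)"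
  proof -
    have "measure M (A \<inter> (X (Suc n) -` E \<inter> space M)) = (\<integral>\<omega>. indicator (A \<inter> (X (Suc n) -` E \<inter> space M)) \<omega> \<partial>M)"
      using AM XE by simp
    also have "\<dots> = (\<integral>\<omega>. indicator A \<omega> * indicat_real E (X (Suc n) \<omega>) \<partial>M)"
      by (intro Bochner_Integration.integral_cong refl) (auto simp: indicator_def)
    finally show ?thesis .
  qed
  also have "\<dots> = (\<integral>\<omega>. indicator A \<omega> * real_cond_exp M (history k) (\<lambda>\<omega>. indicat_real E (X (Suc n) \<omega>)) \<omega> \<partial>M)"
    using fs.real_cond_exp_intA[OF int A] by (simp add: set_lebesgue_integral_def)
  also have "\<dots> = (\<integral>\<omega>. indicator A \<omega> * ?u \<omega> \<partial>M)"
  proof (rule integral_cong_AE)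
    show "AE \<omega> in M. indicator A \<omega> * real_cond_exp M (history k) (\<lambda>\<omega>. indicat_real E (X (Suc n) \<omega>)) \<omega>
        = indicator A \<omega> * ?u \<omega>"
      using markov[OF n1 E'] unfolding history_def n[symmetric] by (rule eventually_mono) simp
  qed (use AM in measurable)
  finally have "emeasure M (A \<inter> (X (Suc n) -` E \<inter> space M)) = ennreal (\<integral>\<omega>. indicator A \<omega> * ?u \<omega> \<partial>M)"
    by (simp add: emeasure_eq_measure)
  also have "\<dots> = (\<integral>\<^sup>+\<omega>. ennreal (indicator A \<omega> * ?u \<omega>) \<partial>M)"
  proof (rule nn_integral_eq_integral[symmetric])
    show "integrable M (\<lambda>\<omega>. indicator A \<omega> * ?u \<omega>)"
      using u01 AM by (intro integrable_const_bound[of _ 1] AE_I2) (auto simp: indicator_def)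
  qed (use u01 in auto)
  also have "\<dots> = (\<integral>\<^sup>+\<omega>. (\<integral>\<^sup>+y. ennreal (p n (X n \<omega>, y)) * indicator E y \<partial>\<mu> (Suc n)) * indicator A \<omega> \<partial>M)"
  proof (rule nn_integral_cong)
    fix \<omega> assume \<omega>: "\<omega> \<in> space M"
    have x: "X n \<omega> \<in> space (borel_metric (S n))" using Xs[OF \<omega>] by simp
    have "(\<lambda>y. p n (X n \<omega>, y)) \<in> borel_measurable (borel_metric (S (Suc n)))"
      by (rule measurable_compose[OF measurable_Pair1'[OF x] measurable_p[OF n1]])
    then have "(\<lambda>y. p n (X n \<omega>, y)) \<in> borel_measurable (\<mu> (Suc n))"
      using measurable_cong_sets[OF sets_\<mu>[of "Suc n"] refl, of "borel :: real measure"] by simp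
    then have pm: "(\<lambda>y. ennreal (p n (X n \<omega>, y))) \<in> borel_measurable (\<mu> (Suc n))"
      by (rule measurable_compose[OF _ measurable_ennreal])
    interpret \<pi>: prob_space "\<pi> n (X n \<omega>)" by (rule prob_\<pi>[OF \<omega>])
    have "(\<integral>\<^sup>+y. ennreal (p n (X n \<omega>, y)) * indicator E y \<partial>\<mu> (Suc n)) = emeasure (\<pi> n (X n \<omega>)) E"
      unfolding transition_density[OF n1 Xs[OF \<omega>]] using emeasure_density[OF pm E] by simp
    also have "\<dots> = ennreal (?u \<omega>)" by (rule \<pi>.emeasure_eq_measure)
    finally show "ennreal (indicator A \<omega> * ?u \<omega>) =
        (\<integral>\<^sup>+y. ennreal (p n (X n \<omega>, y)) * indicator E y \<partial>\<mu> (Suc n)) * indicator A \<omega>"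
      by (simp add: indicator_def)
  qed
  finally show ?thesis .
qed

end

text \<open>The convention that \<open>\<mu> n\<close> is the law of \<open>X n\<close> becomes a
  locale assumption, so that the abstract setting can be attached as a sublocale.\<close>

locale uniformly_elliptic_marginals = uniformly_elliptic_chain M S X \<pi> \<epsilon>\<^sub>0 \<mu> p
  for M :: "'w measure" and S :: "nat \<Rightarrow> 'a metric" and X :: "nat \<Rightarrow> 'w \<Rightarrow> 'a"
    and \<pi> :: "nat \<Rightarrow> 'a \<Rightarrow> 'a measure" and \<epsilon>\<^sub>0 :: real
    and \<mu> :: "nat \<Rightarrow> 'a measure" and p :: "nat \<Rightarrow> 'a \<times> 'a \<Rightarrow> real" +
  assumes law: "n \<ge> 1 \<Longrightarrow> \<mu> n = distr M (borel_metric (S n)) (X n)"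

sublocale uniformly_elliptic_marginals \<subseteq>
  E: elliptic M history "\<lambda>k. \<mu> (Suc k)" "\<lambda>k. X (Suc k)" "\<lambda>k. p (Suc k)" \<epsilon>\<^sub>0
proof
  show "0 < \<epsilon>\<^sub>0" "\<epsilon>\<^sub>0 < 1" by (rule eps0)+
  show "subalgebra M (history k)" for k by (rule subalgebra_history)
  show "X (Suc j) \<in> history k \<rightarrow>\<^sub>M \<mu> (Suc j)" if "j \<le> k" for j k
  proof -
    have "(\<lambda>\<omega>. \<lambda>i\<in>{1..Suc k}. X i \<omega>) \<in> history k \<rightarrow>\<^sub>M (\<Pi>\<^sub>M i\<in>{1..Suc k}. borel_metric (S i))"
      unfolding history_def using measurable_space[OF history_meas] by (intro measurable_vimage_algebra1) auto
    from measurable_compose[OF this measurable_component_singleton[of "Suc j"]]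
    have "X (Suc j) \<in> history k \<rightarrow>\<^sub>M borel_metric (S (Suc j))" using that by simp
    then show ?thesis using measurable_cong_sets[OF refl sets_\<mu>[of "Suc j"], of "history k"] by simp
  qed
  show "distr M (\<mu> (Suc k)) (X (Suc k)) = \<mu> (Suc k)" for k
    using law[of "Suc k"] distr_cong[OF refl sets_\<mu>[of "Suc k"], of M "X (Suc k)" "X (Suc k)"] by simp
  show "p (Suc k) \<in> borel_measurable (\<mu> (Suc k) \<Otimes>\<^sub>M \<mu> (Suc (Suc k)))" for k
    using measurable_p[of "Suc k"] measurable_cong_sets[OF sets_mu_pair[of "Suc k"] refl, of "borel :: real measure"] by simp
  show "0 \<le> p (Suc k) (x, y)" "p (Suc k) (x, y) \<le> 1 / \<epsilon>\<^sub>0"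
    if "x \<in> space (\<mu> (Suc k))" "y \<in> space (\<mu> (Suc (Suc k)))" for k x y
    using p_bounds[of "Suc k" x y] that by (simp_all add: space_mu)
  show "(\<integral>y. p (Suc k) (x, y) \<partial>\<mu> (Suc (Suc k))) = 1" if x: "x \<in> space (\<mu> (Suc k))" for k x
  proof -
    have x': "x \<in> mspace (S (Suc k))" using x by (simp add: space_mu)
    then have x'': "x \<in> space (borel_metric (S (Suc k)))" by simp
    have "(\<lambda>y. p (Suc k) (x, y)) \<in> borel_measurable (borel_metric (S (Suc (Suc k))))"
      by (rule measurable_compose[OF measurable_Pair1'[OF x''] measurable_p]) simp
    then have pm: "(\<lambda>y. p (Suc k) (x, y)) \<in> borel_measurable (\<mu> (Suc (Suc k)))"
      using measurable_cong_sets[OF sets_\<mu>[of "Suc (Suc k)"] refl, of "borel :: real measure"] by simp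
    have "prob_space (\<pi> (Suc k) x)"
      using measurable_space[OF kernel[of "Suc k"], of x] x' by (simp add: space_prob_algebra)
    then have "emeasure (\<pi> (Suc k) x) (space (\<pi> (Suc k) x)) = 1" by (rule prob_space.emeasure_space_1)
    then have "(\<integral>\<^sup>+y. ennreal (p (Suc k) (x, y)) \<partial>\<mu> (Suc (Suc k))) = 1"
      unfolding transition_density[OF _ x', simplified]
      using pm by (simp add: emeasure_density cong: nn_integral_cong)
    moreover have "0 \<le> p (Suc k) (x, y)" if "y \<in> space (\<mu> (Suc (Suc k)))" for y
      using p_bounds[of "Suc k" x y] x' that by (simp add: space_mu)
    ultimately show ?thesis
      using pm by (subst integral_eq_nn_integral) auto
  qed
  show "\<epsilon>\<^sub>0 < (\<integral>y. p (Suc k) (x, y) * p (Suc (Suc k)) (y, z) \<partial>\<mu> (Suc (Suc k)))"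
    if "x \<in> space (\<mu> (Suc k))" "z \<in> space (\<mu> (Suc (Suc (Suc k))))" for k x z
    using two_step[of "Suc k" x z] that by (simp add: space_mu)
  show "emeasure M (A \<inter> (X (Suc (Suc k)) -` E \<inter> space M)) =
        (\<integral>\<^sup>+\<omega>. (\<integral>\<^sup>+y. ennreal (p (Suc k) (X (Suc k) \<omega>, y)) * indicator E y \<partial>\<mu> (Suc (Suc k))) * indicator A \<omega> \<partial>M)"
    if "A \<in> sets (history k)" "E \<in> sets (\<mu> (Suc (Suc k)))" for k A E
    using that by (rule markov_density[OF refl])
qed

context uniformly_elliptic_marginals
begin

lemma partial_sum_shift: "partial_sum X f N \<omega> = (\<Sum>k<N. f (Suc k) (X (Suc k) \<omega>, X (Suc (Suc k)) \<omega>))"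
  unfolding partial_sum_def One_nat_def by (rule sum.atLeast1_atMost_eq)

lemma additive_functional_shift:
  "additive_functional S f \<Longrightarrow> f (Suc k) \<in> borel_measurable (\<mu> (Suc k) \<Otimes>\<^sub>M \<mu> (Suc (Suc k)))"
  using measurable_cong_sets[OF sets_mu_pair[of "Suc k"] refl, of "borel :: real measure"]
  by (auto simp: additive_functional_def)

text \<open>Position \<open>k + 3\<close> begins at time \<open>k + 1\<close>, which is time
  \<open>k\<close> after the shift. Law and balance then agree term by term, and
  \<open>hexagon_bind\<close> turns the integral into \<open>hexint\<close>.\<close>

lemma structure_const_eq:
  assumes f: "additive_functional S f"
  shows "(structure_const M S X \<mu> p f (k + 3) \<xi>)\<^sup>2 =
    E.dsq (\<lambda>k. f (Suc k)) \<xi> k"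
proof -
  let ?f = "\<lambda>k. f (Suc k)"
  have f_meas: "?f k \<in> borel_measurable (\<mu> (Suc k) \<Otimes>\<^sub>M \<mu> (Suc (Suc k)))" for k
    by (rule additive_functional_shift[OF f])
  have pl: "pair_law M S X (Suc j) = E.pairs j" for j
    unfolding pair_law_def E.pairs_def by (rule distr_cong[OF refl]) (simp_all add: sets_mu_pair)
  have br: "bridge \<mu> p (Suc j) x z = E.bdg j x z" for j x z
    unfolding bridge_def E.bdg_def E.step2_def ..
  have nums: "k + 3 = Suc (Suc (Suc k))" "Suc (Suc (Suc k)) - 2 = Suc k"
    "Suc (Suc (Suc k)) - 1 = Suc (Suc k)" "Suc (Suc (Suc k)) + 1 = Suc (Suc (Suc (Suc k)))"
    by simp_all
  have hs: "sets (hexagon_space S (k + 3)) = sets (E.hexagons k)"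
    unfolding hexagon_space_def E.hexagons_def nums
    by (intro sets_pair_measure_cong) (rule sets_\<mu>[symmetric], simp)+
  have hl: "hexagon_law M S X \<mu> p (k + 3) = E.pairs k \<bind> (\<lambda>s. E.pairs (Suc (Suc k)) \<bind> (\<lambda>t.
      E.bdg (Suc k) (snd s) (snd t) \<bind> (\<lambda>c. E.bdg k (fst s) (fst t) \<bind> (\<lambda>b'.
        return (E.hexagons k) (fst s, snd s, c, b', fst t, snd t)))))"
    unfolding hexagon_law_def case_prod_unfold nums pl br return_sets_cong[OF hs[unfolded nums]] ..
  let ?\<Phi> = "\<lambda>P. (cmod (exp (\<i> * of_real (\<xi> * balance f (k + 3) P)) - 1))\<^sup>2"
  have bal: "balance f (k + 3) P = E.hexbal ?f k P" for P
    by (cases P) (simp only: balance.simps E.hexbal_def prod.case nums)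
  have \<Phi>: "?\<Phi> P = (cmod (cis (\<xi> * E.hexbal ?f k P) - 1))\<^sup>2" for P
    unfolding bal by (simp add: cis_conv_exp)
  have \<Phi>_meas: "(\<lambda>P. ennreal ((cmod (cis (\<xi> * E.hexbal ?f k P) - 1))\<^sup>2)) \<in> borel_measurable (E.hexagons k)"
    using E.hexbal_measurable[OF f_meas] by measurable
  have m: "(\<lambda>P. (cmod (cis (\<xi> * E.hexbal ?f k P) - 1))\<^sup>2) \<in> borel_measurable (E.hexagons k)"
    using E.hexbal_measurable[OF f_meas] by measurable
  have setsL: "sets (hexagon_law M S X \<mu> p (k + 3)) = sets (E.hexagons k)"
    unfolding hl by (rule E.hexagon_bind(1)[OF \<Phi>_meas])
  have "(structure_const M S X \<mu> p f (k + 3) \<xi>)\<^sup>2 = (\<integral>P. ?\<Phi> P \<partial>hexagon_law M S X \<mu> p (k + 3))"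
    unfolding structure_const_def by (rule real_sqrt_pow2) simp
  also have "\<dots> = enn2real (\<integral>\<^sup>+P. ennreal (?\<Phi> P) \<partial>hexagon_law M S X \<mu> p (k + 3))"
    unfolding \<Phi> using m unfolding measurable_cong_sets[OF setsL refl, symmetric]
    by (rule integral_eq_nn_integral) simp
  also have "(\<integral>\<^sup>+P. ennreal (?\<Phi> P) \<partial>hexagon_law M S X \<mu> p (k + 3)) = E.hexint k (\<lambda>P. ennreal (?\<Phi> P))"
    unfolding \<Phi> hl by (rule E.hexagon_bind(2)[OF \<Phi>_meas])
  also have "enn2real \<dots> = E.dsq ?f \<xi> k"
    unfolding \<Phi> E.dsq_def ..
  finally show ?thesis .
qed

lemma co_range_iff:
  assumes f: "additive_functional S f"
  shows "\<xi> \<in> co_range M S X \<mu> p f \<longleftrightarrow>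
    summable (E.dsq (\<lambda>k. f (Suc k)) \<xi>)"
  unfolding co_range_def mem_Collect_eq structure_const_eq[OF f] ..

text \<open>Annihilators of the groups that occur in the definition of \<open>G_ess\<close> are
  contained in the co-range: every lower bound on \<open>G_ess\<close> rests on this.\<close>

lemma co_range_of_lattice:
  assumes f: "additive_functional S f" and g: "additive_functional S g"
    and ct: "center_tight M X (\<lambda>n z. f n z - g n z)"
    and G: "closed G" "\<And>n. n \<ge> 1 \<Longrightarrow> \<P>(\<omega> in M. g n (X n \<omega>, X (Suc n) \<omega>) - c n \<in> G) = 1"
    and \<xi>: "\<And>x. x \<in> G \<Longrightarrow> cis (\<xi> * x) = 1"
  shows "\<xi> \<in> co_range M S X \<mu> p f"
proof -
  have fm: "f (Suc k) \<in> borel_measurable (\<mu> (Suc k) \<Otimes>\<^sub>M \<mu> (Suc (Suc k)))" for k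
    by (rule additive_functional_shift[OF f])
  have gm: "g (Suc k) \<in> borel_measurable (\<mu> (Suc k) \<Otimes>\<^sub>M \<mu> (Suc (Suc k)))" for k
    by (rule additive_functional_shift[OF g])
  obtain ctr where ctr: "\<And>\<epsilon>. 0 < \<epsilon> \<Longrightarrow> \<exists>K. \<forall>N\<ge>1. \<P>(\<omega> in M. \<bar>partial_sum X (\<lambda>n z. f n z - g n z) N \<omega> - ctr N\<bar> > K) < \<epsilon>"
    using ct unfolding center_tight_def by blast
  show ?thesis
    unfolding co_range_iff[OF f]
  proof (rule E.summable_dsq_of_lattice[OF fm gm])
    fix k
    have [measurable]: "(\<lambda>\<omega>. g (Suc k) (X (Suc k) \<omega>, X (Suc (Suc k)) \<omega>)) \<in> borel_measurable M"
      by (rule E.pair_meas[OF gm])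
    have [measurable]: "G \<in> sets borel" using G(1) by (rule borel_closed)
    have "\<P>(\<omega> in M. g (Suc k) (X (Suc k) \<omega>, X (Suc (Suc k)) \<omega>) - c (Suc k) \<in> G) = 1"
      by (rule G(2)) simp
    then have "AE \<omega> in M. g (Suc k) (X (Suc k) \<omega>, X (Suc (Suc k)) \<omega>) - c (Suc k) \<in> G"
      by (subst (asm) prob_Collect_eq_1) measurable
    then show "AE \<omega> in M. cis (\<xi> * (g (Suc k) (X (Suc k) \<omega>, X (Suc (Suc k)) \<omega>) - c (Suc k))) = 1"
      by (rule eventually_mono) (rule \<xi>)
  next
    show "\<exists>K. \<forall>N\<ge>1. \<P>(\<omega> in M. K < \<bar>E.psum (\<lambda>k t. f (Suc k) t - g (Suc k) t) N \<omega> - ctr N\<bar>) < \<epsilon>"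
      if "0 < \<epsilon>" for \<epsilon>
      using ctr[OF that] unfolding partial_sum_shift E.psum_def .
  qed
qed

text \<open>The functional supplied by \<open>reduction\<close> is admissible in the intersection
  that defines \<open>G_ess\<close>, and its algebraic range lies in the lattice.\<close>

lemma G_ess_subset_of_co_range:
  assumes f: "additive_functional S f" and \<xi>: "\<xi> \<in> co_range M S X \<mu> p f" "\<xi> \<noteq> 0"
  shows "G_ess M S X f \<subseteq> {2 * pi / \<xi> * of_int k | k::int. True}"
proof -
  have fm: "f (Suc k) \<in> borel_measurable (\<mu> (Suc k) \<Otimes>\<^sub>M \<mu> (Suc (Suc k)))" for k
    by (rule additive_functional_shift[OF f])
  obtain g c ctr where gm: "\<And>k. g k \<in> borel_measurable (\<mu> (Suc k) \<Otimes>\<^sub>M \<mu> (Suc (Suc k)))"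
    and gl: "\<And>k t. t \<in> space (\<mu> (Suc k) \<Otimes>\<^sub>M \<mu> (Suc (Suc k))) \<Longrightarrow> \<exists>n::int. g k t - c k = 2 * pi / \<xi> * of_int n"
    and gt: "\<And>\<epsilon>. 0 < \<epsilon> \<Longrightarrow> \<exists>K. \<forall>N. \<P>(\<omega> in M. K < \<bar>E.psum (\<lambda>k t. f (Suc k) t - g k t) N \<omega> - ctr N\<bar>) < \<epsilon>"
    using E.reduction[of "\<lambda>k. f (Suc k)" \<xi>, OF fm \<xi>(1)[unfolded co_range_iff[OF f]] \<xi>(2)] by blast
  let ?G = "{2 * pi / \<xi> * of_int k | k::int. True}"
  \<comment> \<open>The shift back to time starting at 1; the value at index 0 does not
    matter.\<close>
  let ?g = "\<lambda>n. g (n - 1)"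
  have g_add: "additive_functional S ?g"
    unfolding additive_functional_def
  proof (intro allI impI)
    fix n :: nat assume "n \<ge> 1"
    then obtain k where n: "n = Suc k" by (cases n) auto
    show "g (n - 1) \<in> borel_measurable (borel_metric (S n) \<Otimes>\<^sub>M borel_metric (S (Suc n)))"
      using gm[of k] measurable_cong_sets[OF sets_mu_pair[of "Suc k"] refl, of "borel :: real measure"] unfolding n by simp
  qed
  have ct: "center_tight M X (\<lambda>n z. f n z - ?g n z)"
    unfolding center_tight_def
  proof (intro exI[of _ ctr] allI impI)
    fix \<epsilon> :: real assume "0 < \<epsilon>"
    from gt[OF this] show "\<exists>K. \<forall>N\<ge>1. \<P>(\<omega> in M. \<bar>partial_sum X (\<lambda>n z. f n z - ?g n z) N \<omega> - ctr N\<bar> > K) < \<epsilon>"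
      unfolding partial_sum_shift E.psum_def diff_Suc_1 by blast
  qed
  have "\<P>(\<omega> in M. ?g n (X n \<omega>, X (Suc n) \<omega>) - c (n - 1) \<in> ?G) = 1" if n1: "n \<ge> 1" for n
  proof -
    obtain k where n: "n = Suc k" using n1 by (cases n) auto
    have "{\<omega> \<in> space M. ?g n (X n \<omega>, X (Suc n) \<omega>) - c (n - 1) \<in> ?G} = space M"
    proof (intro equalityI subsetI CollectI conjI)
      fix \<omega> assume \<omega>: "\<omega> \<in> space M"
      then have "(X (Suc k) \<omega>, X (Suc (Suc k)) \<omega>) \<in> space (\<mu> (Suc k) \<Otimes>\<^sub>M \<mu> (Suc (Suc k)))"
        using E.space_Y[OF \<omega>] by (simp add: space_pair_measure)
      from gl[OF this] show "\<exists>j::int. ?g n (X n \<omega>, X (Suc n) \<omega>) - c (n - 1) = 2 * pi / \<xi> * of_int j \<and> True"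
        unfolding n by simp
    qed auto
    then show ?thesis by (simp add: prob_space)
  qed
  then have "\<forall>n\<ge>1. \<P>(\<omega> in M. ?g n (X n \<omega>, X (Suc n) \<omega>) - (\<lambda>n. c (n - 1)) n \<in> ?G) = 1"
    by blast
  then have "G_alg M X ?g \<subseteq> ?G"
    unfolding G_alg_def
    by (intro Inter_lower CollectI conjI closed_real_subgroup_multiples) (rule exI)
  moreover have "G_ess M S X f \<subseteq> G_alg M X ?g"
    unfolding G_ess_def by (rule Inter_lower, rule CollectI, rule exI, rule conjI[OF refl conjI[OF g_add ct]])
  ultimately show ?thesis by (rule order_trans[rotated])
qed

text \<open>Both intersections are unfolded, which leaves one closed group at a time, known only
  through the inclusion of its annihilator in the co-range.\<close>

lemma subset_G_essI:
  assumes f: "additive_functional S f"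
    and H: "\<And>G. closed_real_subgroup G \<Longrightarrow>
      (\<And>\<xi>. (\<And>x. x \<in> G \<Longrightarrow> cis (\<xi> * x) = 1) \<Longrightarrow> \<xi> \<in> co_range M S X \<mu> p f) \<Longrightarrow> A \<subseteq> G"
  shows "A \<subseteq> G_ess M S X f"
  unfolding G_ess_def G_alg_def
proof (intro Inter_greatest)
  fix B assume "B \<in> {\<Inter>{G. closed_real_subgroup G \<and> (\<exists>c. \<forall>n\<ge>1. \<P>(\<omega> in M. g n (X n \<omega>, X (Suc n) \<omega>) - c n \<in> G) = 1)} | g.
    additive_functional S g \<and> center_tight M X (\<lambda>n z. f n z - g n z)}"
  then obtain g where g: "additive_functional S g" "center_tight M X (\<lambda>n z. f n z - g n z)"
    and B: "B = \<Inter>{G. closed_real_subgroup G \<and> (\<exists>c. \<forall>n\<ge>1. \<P>(\<omega> in M. g n (X n \<omega>, X (Suc n) \<omega>) - c n \<in> G) = 1)}"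
    by blast
  show "A \<subseteq> B" unfolding B
  proof (intro Inter_greatest)
    fix G assume "G \<in> {G. closed_real_subgroup G \<and> (\<exists>c. \<forall>n\<ge>1. \<P>(\<omega> in M. g n (X n \<omega>, X (Suc n) \<omega>) - c n \<in> G) = 1)}"
    then obtain c where G: "closed_real_subgroup G" "\<And>n. n \<ge> 1 \<Longrightarrow> \<P>(\<omega> in M. g n (X n \<omega>, X (Suc n) \<omega>) - c n \<in> G) = 1"
      by blast
    have "closed G" using G(1) by (simp add: closed_real_subgroup_def)
    show "A \<subseteq> G"
      by (rule H[OF G(1)]) (rule co_range_of_lattice[OF f g \<open>closed G\<close> G(2)])
  qed
qed

end

theorem theorem3p2:
  fixes M :: "'w measure"
    and S :: "nat \<Rightarrow> 'a metric"
    and X :: "nat \<Rightarrow> 'w \<Rightarrow> 'a"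
    and \<pi> :: "nat \<Rightarrow> 'a \<Rightarrow> 'a measure"
    and \<epsilon>\<^sub>0 :: real
    and \<mu> :: "nat \<Rightarrow> 'a measure"
    and p f :: "nat \<Rightarrow> 'a \<times> 'a \<Rightarrow> real"
  assumes "uniformly_elliptic_chain M S X \<pi> \<epsilon>\<^sub>0 \<mu> p"
    and "\<And>n. n \<ge> 1 \<Longrightarrow> \<mu> n = distr M (borel_metric (S n)) (X n)"
    and "additive_functional S f"
    and "as_uniformly_bounded M X f"
  shows "(co_range M S X \<mu> p f = {0} \<longrightarrow> G_ess M S X f = UNIV) \<and>
    (\<forall>t::real. t \<noteq> 0 \<and> co_range M S X \<mu> p f = {t * of_int k | k::int. True} \<longrightarrow>
       G_ess M S X f = {2 * pi / t * of_int k | k::int. True}) \<and>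
    (co_range M S X \<mu> p f = UNIV \<longrightarrow> G_ess M S X f = {0})"
proof (intro conjI allI impI)
  interpret uniformly_elliptic_marginals M S X \<pi> \<epsilon>\<^sub>0 \<mu> p
    using assms(1,2) by (simp add: uniformly_elliptic_marginals_def uniformly_elliptic_marginals_axioms_def)
  note f = assms(3)
  let ?H = "co_range M S X \<mu> p f"
  \<comment> \<open>The zero group is annihilated by every frequency, which forces the co-range to
    be the whole line, and the multiples of \<open>a\<close> are annihilated by
    \<open>2 * pi / a\<close>.\<close>
  have G_cases: thesis
    if G: "closed_real_subgroup G" "\<And>\<xi>. (\<And>x. x \<in> G \<Longrightarrow> cis (\<xi> * x) = 1) \<Longrightarrow> \<xi> \<in> ?H"
      and "G = UNIV \<Longrightarrow> thesis" "?H = UNIV \<Longrightarrow> thesis"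
      "\<And>a. a > 0 \<Longrightarrow> G = {a * of_int k | k::int. True} \<Longrightarrow> 2 * pi / a \<in> ?H \<Longrightarrow> thesis"
    for G thesis
  proof (rule closed_real_subgroup_cases[OF G(1)])
    assume "G = {0}"
    then have "\<xi> \<in> ?H" for \<xi> using G(2)[of \<xi>] by simp
    then show thesis using that(4) by blast
  next
    fix a :: real assume a: "a > 0" "G = {a * of_int k | k::int. True}"
    have "2 * pi / a \<in> ?H"
    proof (rule G(2))
      fix x assume "x \<in> G"
      then obtain k where "x = a * of_int k" using a by blast
      then have "2 * pi / a * x = 2 * pi * of_int k" using a by simp
      then show "cis (2 * pi / a * x) = 1" by (simp only: cis_multiple_2pi Ints_of_int)
    qed
    then show thesis using that(5) a by blast
  qed (use that in blast)
  show "G_ess M S X f = UNIV" if H: "?H = {0}"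
  proof -
    have "UNIV \<subseteq> G_ess M S X f"
    proof (rule subset_G_essI[OF f])
      fix G assume G: "closed_real_subgroup G" "\<And>\<xi>. (\<And>x. x \<in> G \<Longrightarrow> cis (\<xi> * x) = 1) \<Longrightarrow> \<xi> \<in> ?H"
      show "UNIV \<subseteq> G"
      proof (rule G_cases[OF G])
        assume "?H = UNIV"
        then have "(1 :: real) \<in> {0}" unfolding H by blast
        then show ?thesis by simp
      qed (use H in auto)
    qed
    then show ?thesis by blast
  qed
  show "G_ess M S X f = {2 * pi / t * of_int k | k::int. True}"
    if t: "t \<noteq> 0 \<and> ?H = {t * of_int k | k::int. True}" for t :: real
  proof
    have "t \<in> ?H" using t by (auto intro!: exI[of _ 1])
    then show "G_ess M S X f \<subseteq> {2 * pi / t * of_int k | k::int. True}"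
      using t by (intro G_ess_subset_of_co_range[OF f]) auto
    show "{2 * pi / t * of_int k | k::int. True} \<subseteq> G_ess M S X f"
    proof (rule subset_G_essI[OF f])
      fix G assume G: "closed_real_subgroup G" "\<And>\<xi>. (\<And>x. x \<in> G \<Longrightarrow> cis (\<xi> * x) = 1) \<Longrightarrow> \<xi> \<in> ?H"
      show "{2 * pi / t * of_int k | k::int. True} \<subseteq> G"
      proof (rule G_cases[OF G])
        assume "?H = UNIV"
        \<comment> \<open>The number \<open>t / 2\<close> lies outside the multiples of
          \<open>t\<close>, so this case cannot occur.\<close>
        then have "t / 2 \<in> {t * of_int k | k::int. True}" using t by blast
        then obtain k :: int where "t / 2 = t * of_int k" by blast
        then have "real_of_int (2 * k) = real_of_int 1" using t by (simp add: field_simps)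
        then have "2 * k = 1" by (simp only: of_int_eq_iff)
        then have False by presburger
        then show ?thesis ..
      next
        fix a :: real assume a: "a > 0" "G = {a * of_int k | k::int. True}" "2 * pi / a \<in> ?H"
        then obtain j :: int where j: "2 * pi / a = t * of_int j" using t by blast
        \<comment> \<open>Solving for \<open>2 * pi / t\<close> shows that it is itself a multiple
          of \<open>a\<close>.\<close>
        then have "2 * pi / t = a * of_int j" using t a(1) by (simp add: field_simps)
        then have "2 * pi / t * of_int k = a * of_int (j * k)" for k by simp
        then show ?thesis unfolding a(2) by blast
      qed auto
    qed
  qed
  show "G_ess M S X f = {0}" if H: "?H = UNIV"
  proof
    show "G_ess M S X f \<subseteq> {0}"
    proof
      fix x assume x: "x \<in> G_ess M S X f"
      have False if "x \<noteq> 0"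
      proof -
        \<comment> \<open>The frequency \<open>pi / x\<close> leads to the multiples of
          \<open>2 * x\<close>, which do not include \<open>x\<close>.\<close>
        have "G_ess M S X f \<subseteq> {2 * pi / (pi / x) * of_int k | k::int. True}"
          using H that by (intro G_ess_subset_of_co_range[OF f]) auto
        then obtain k :: int where "x = 2 * pi / (pi / x) * of_int k" using x by blast
        then have "real_of_int 1 = real_of_int (2 * k)" using that by (simp add: field_simps)
        then have "1 = 2 * k" by (simp only: of_int_eq_iff)
        then show False by presburger
      qed
      then show "x \<in> {0}" by blast
    qed
    show "{0} \<subseteq> G_ess M S X f"
      by (rule subset_G_essI[OF f]) (simp add: closed_real_subgroup_def)
  qed
qed

end
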